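(* Let $\mathrm{M}$ be a loopless matroid of rank $d$ on a finite set $E$, and let $i\in E$. If $i$ is not a coloop of $\mathrm{M}$, there is a direct sum decomposition of $\underline{\mathrm{CH}}(\mathrm{M})$ into indecomposable graded $\underline{\mathrm{CH}}(\mathrm{M}\setminus i)$-modules $$\underline{\mathrm{CH}}(\mathrm{M}) = \underline{\mathrm{CH}}_{(i)} \oplus \bigoplus_{F \in \underline{\mathscr{S}}_i} x_{F\cup i}\, \underline{\mathrm{CH}}_{(i)},$$ and all pairs of distinct summands are orthogonal for the Poincaré pairing of $\underline{\mathrm{CH}}(\mathrm{M})$. If $i$ is a coloop of $\mathrm{M}$, there is a direct sum decomposition of $\underline{\mathrm{CH}}(\mathrm{M})$ into indecomposable graded $\underline{\mathrm{CH}}(\mathrm{M}\setminus i)$-modules $$\underline{\mathrm{CH}}(\mathrm{M}) = \underline{\mathrm{CH}}_{(i)} \oplus x_{E\setminus i}\,\underline{\mathrm{CH}}_{(i)} \oplus \bigoplus_{F\in \underline{\mathscr{S}}_i} x_{F\cup i}\, \underline{\mathrm{CH}}_{(i)},$$ and all pairs of distinct summands except for the first two are orthogonal for the Poincaré pairing of $\underline{\mathrm{CH}}(\mathrm{M})$. (When $E=\{i\}$, the symbol $x_\varnothing$ on the right-hand side of the second decomposition is treated as zero.)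
   Context: Matroids. A matroid $\mathrm{M}$ on a finite set $E$ is a nonempty collection of subsets of $E$, called flats, such that (1) the intersection of any two flats is a flat; (2) for any flat $F$, any element of $E\setminus F$ is contained in exactly one flat that is minimal among the flats strictly containing $F$. It is loopless if $\varnothing$ is a flat. $\mathscr{L}(\mathrm{M})$ is the lattice of flats; a flat is proper if it is not $E$. Every maximal flag (chain) of proper flats has the same cardinality $d$, the rank of $\mathrm{M}$. The deletion $\mathrm{M}\setminus i$ is the matroid on $E\setminus i$ whose flats are the sets $F\setminus i$ for flats $F$ of $\mathrm{M}$. The element $i$ is a coloop of $\mathrm{M}$ if the ranks of $\mathrm{M}$ and $\mathrm{M}\setminus i$ differ. We write $F\cup i$ for $F\cup\{i\}$ and $E\setminus i$ for $E\setminus\{i\}$. Chow ring. Let $\underline{S}_\mathrm{M}=\mathbb{Q}[x_F\mid F \text{ a nonempty proper flat of } \mathrm{M}]$ and $\underline{\mathrm{CH}}(\mathrm{M})=\underline{S}_\mathrm{M}/(\underline{I}_\mathrm{M}+\underline{J}_\mathrm{M})$ (graded with $\deg x_F=1$), where $\underline{I}_\mathrm{M}$ is generated by the linear forms $\sum_{i_1\in F}x_F-\sum_{i_2\in F}x_F$ for all pairs of distinct $i_1,i_2\in E$, and $\underline{J}_\mathrm{M}$ is generated by $x_{F_1}x_{F_2}$ for all pairs of incomparable nonempty proper flats $F_1,F_2$. When $E$ is nonempty, there is a well-defined degree map, the linear isomorphism $\underline{\deg}_\mathrm{M}:\underline{\mathrm{CH}}^{d-1}(\mathrm{M})\to\mathbb{Q}$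 with $\prod_{F\in\mathscr{F}}x_F\mapsto 1$ for every complete (maximal) flag $\mathscr{F}$ of nonempty proper flats. The Poincaré pairing is $\underline{\mathrm{CH}}^k(\mathrm{M})\times\underline{\mathrm{CH}}^{d-k-1}(\mathrm{M})\to\mathbb{Q}$, $(\eta_1,\eta_2)\mapsto\underline{\deg}_\mathrm{M}(\eta_1\eta_2)$. Two graded subspaces are orthogonal if this pairing vanishes on all pairs of their elements of complementary degrees $k$ and $d-k-1$. Deletion. There is a graded algebra homomorphism $\underline{\theta}_i:\underline{\mathrm{CH}}(\mathrm{M}\setminus i)\to\underline{\mathrm{CH}}(\mathrm{M})$, $x_F\mapsto x_F+x_{F\cup i}$, where a variable in the target is set to zero if its label is not a flat of $\mathrm{M}$. It makes $\underline{\mathrm{CH}}(\mathrm{M})$ a graded $\underline{\mathrm{CH}}(\mathrm{M}\setminus i)$-module. $\underline{\mathrm{CH}}_{(i)}$ denotes the image of $\underline{\theta}_i$, and $$\underline{\mathscr{S}}_i=\{F\mid F \text{ is a nonempty proper subset of } E\setminus i \text{ such that } F\in\mathscr{L}(\mathrm{M}) \text{ and } F\cup i\in\mathscr{L}(\mathrm{M})\}.$$ *)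

theory Defs
  imports Complex_Main "HOL-Algebra.QuotRing" "HOL-Algebra.Module" "HOL-Library.Poly_Mapping"
begin

section \<open>Matroids given by their flats\<close>

record 'a matroid =
  ground :: "'a set"
  flats :: "'a set set"

definition covers :: "'a matroid \<Rightarrow> 'a set \<Rightarrow> 'a set \<Rightarrow> bool" where
  "covers M F G \<longleftrightarrow> G \<in> flats M \<and> F \<subset> G \<and> \<not> (\<exists>H\<in>flats M. F \<subset> H \<and> H \<subset> G)"

definition matroid :: "'a matroid \<Rightarrow> bool" where
  "matroid M \<longleftrightarrow>
     finite (ground M) \<and>
     flats M \<subseteq> Pow (ground M) \<and>
     flats M \<noteq> {} \<and>
     (\<forall>F\<in>flats M. \<forall>G\<in>flats M. F \<inter> G \<in> flats M) \<and>
     (\<forall>F\<in>flats M. \<forall>e\<in>ground M - F. \<exists>!G. covers M F G \<and> e \<in> G)"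

definition loopless :: "'a matroid \<Rightarrow> bool" where
  "loopless M \<longleftrightarrow> {} \<in> flats M"

definition proper_flats :: "'a matroid \<Rightarrow> 'a set set" where
  "proper_flats M = flats M - {ground M}"

definition nonempty_proper_flats :: "'a matroid \<Rightarrow> 'a set set" where
  "nonempty_proper_flats M = proper_flats M - {{}}"

text \<open>The common cardinality of the maximal flags of proper flats.\<close>

definition rank :: "'a matroid \<Rightarrow> nat" where
  "rank M = (THE d. \<forall>C. subset.maxchain (proper_flats M) C \<longrightarrow> card C = d)"

definition deletion :: "'a matroid \<Rightarrow> 'a \<Rightarrow> 'a matroid" where
  "deletion M i = \<lparr>ground = ground M - {i}, flats = (\<lambda>F. F - {i}) ` flats M\<rparr>"

definition coloop :: "'a matroid \<Rightarrow> 'a \<Rightarrow> bool" where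
  "coloop M i \<longleftrightarrow> i \<in> ground M \<and> rank M \<noteq> rank (deletion M i)"

text \<open>The set \<open>\<S>\<^sub>i\<close>.\<close>

definition S_flats :: "'a matroid \<Rightarrow> 'a \<Rightarrow> 'a set set" where
  "S_flats M i =
     {F. F \<noteq> {} \<and> F \<subset> ground M - {i} \<and> F \<in> flats M \<and> insert i F \<in> flats M}"


section \<open>Polynomials with variables indexed by sets\<close>

text \<open>
  A monomial is a finitely supported exponent function, and a polynomial is a finitely
  supported function from monomials to coefficients; the type class multiplication
  is the usual (convolution) product of polynomials.
\<close>

type_synonym 'a set_poly = "('a set \<Rightarrow>\<^sub>0 nat) \<Rightarrow>\<^sub>0 rat"

definition Var :: "'a set \<Rightarrow> 'a set_poly" where
  "Var F = Poly_Mapping.single (Poly_Mapping.single F 1) 1"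

definition Const :: "rat \<Rightarrow> 'a set_poly" where
  "Const q = Poly_Mapping.single 0 q"

definition vars :: "'a set_poly \<Rightarrow> 'a set set" where
  "vars p = (\<Union>m\<in>Poly_Mapping.keys p. Poly_Mapping.keys m)"

definition homogeneous :: "nat \<Rightarrow> 'a set_poly \<Rightarrow> bool" where
  "homogeneous k p \<longleftrightarrow>
     (\<forall>m\<in>Poly_Mapping.keys p. (\<Sum>F\<in>Poly_Mapping.keys m. Poly_Mapping.lookup m F) = k)"

definition substitute :: "('a set \<Rightarrow> 'a set_poly) \<Rightarrow> 'a set_poly \<Rightarrow> 'a set_poly" where
  "substitute s p =
     (\<Sum>m\<in>Poly_Mapping.keys p. Const (Poly_Mapping.lookup p m) *
        (\<Prod>F\<in>Poly_Mapping.keys m. s F ^ Poly_Mapping.lookup m F))"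


section \<open>The Chow ring\<close>

definition S_ring :: "'a matroid \<Rightarrow> 'a set_poly ring" where
  "S_ring M =
     \<lparr>carrier = {p. vars p \<subseteq> nonempty_proper_flats M},
      mult = (*), one = 1, zero = 0, add = (+)\<rparr>"

definition I_gens :: "'a matroid \<Rightarrow> 'a set_poly set" where
  "I_gens M =
     {(\<Sum>F\<in>{F \<in> nonempty_proper_flats M. i1 \<in> F}. Var F) -
      (\<Sum>F\<in>{F \<in> nonempty_proper_flats M. i2 \<in> F}. Var F) | i1 i2.
        i1 \<in> ground M \<and> i2 \<in> ground M \<and> i1 \<noteq> i2}"

definition J_gens :: "'a matroid \<Rightarrow> 'a set_poly set" where
  "J_gens M =
     {Var F1 * Var F2 | F1 F2.
        F1 \<in> nonempty_proper_flats M \<and> F2 \<in> nonempty_proper_flats M \<and>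
        \<not> F1 \<subseteq> F2 \<and> \<not> F2 \<subseteq> F1}"

definition CH_ideal :: "'a matroid \<Rightarrow> 'a set_poly set" where
  "CH_ideal M =
     (Idl\<^bsub>S_ring M\<^esub> (I_gens M)) <+>\<^bsub>S_ring M\<^esub> (Idl\<^bsub>S_ring M\<^esub> (J_gens M))"

definition CH :: "'a matroid \<Rightarrow> 'a set_poly set ring" where
  "CH M = S_ring M Quot CH_ideal M"

definition CH_class :: "'a matroid \<Rightarrow> 'a set_poly \<Rightarrow> 'a set_poly set" where
  "CH_class M p = CH_ideal M +>\<^bsub>S_ring M\<^esub> p"

definition CH_graded :: "'a matroid \<Rightarrow> nat \<Rightarrow> 'a set_poly set set" where
  "CH_graded M k = CH_class M ` {p \<in> carrier (S_ring M). homogeneous k p}"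

definition CH_scale :: "'a matroid \<Rightarrow> rat \<Rightarrow> 'a set_poly set \<Rightarrow> 'a set_poly set" where
  "CH_scale M q \<eta> = CH_class M (Const q) \<otimes>\<^bsub>CH M\<^esub> \<eta>"

text \<open>
  The variable \<open>x\<^sub>F\<close> as a polynomial, set to zero when its label is not a nonempty
  proper flat. In particular \<open>x\<close> with label the empty set is zero.
\<close>

definition x_poly :: "'a matroid \<Rightarrow> 'a set \<Rightarrow> 'a set_poly" where
  "x_poly M F = (if F \<in> nonempty_proper_flats M then Var F else 0)"

definition x_CH :: "'a matroid \<Rightarrow> 'a set \<Rightarrow> 'a set_poly set" where
  "x_CH M F = CH_class M (x_poly M F)"


section \<open>The degree map and the Poincare pairing\<close>

text \<open>
  The degree map is a \<open>\<rat>\<close>-linear isomorphism from the top degree piece; requiring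
  it to be extensional (\<open>undefined\<close> elsewhere) makes it a unique total function.
\<close>

definition is_degree_map :: "'a matroid \<Rightarrow> ('a set_poly set \<Rightarrow> rat) \<Rightarrow> bool" where
  "is_degree_map M f \<longleftrightarrow>
     f \<in> extensional (CH_graded M (rank M - 1)) \<and>
     bij_betw f (CH_graded M (rank M - 1)) UNIV \<and>
     (\<forall>\<eta>\<in>CH_graded M (rank M - 1). \<forall>\<xi>\<in>CH_graded M (rank M - 1).
        f (\<eta> \<oplus>\<^bsub>CH M\<^esub> \<xi>) = f \<eta> + f \<xi>) \<and>
     (\<forall>q. \<forall>\<eta>\<in>CH_graded M (rank M - 1). f (CH_scale M q \<eta>) = q * f \<eta>) \<and>
     (\<forall>C. subset.maxchain (nonempty_proper_flats M) C \<longrightarrow>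
        f (CH_class M (\<Prod>F\<in>C. Var F)) = 1)"

definition degree_map :: "'a matroid \<Rightarrow> 'a set_poly set \<Rightarrow> rat" where
  "degree_map M = (THE f. is_degree_map M f)"

definition orthogonal :: "'a matroid \<Rightarrow> 'a set_poly set set \<Rightarrow> 'a set_poly set set \<Rightarrow> bool" where
  "orthogonal M N1 N2 \<longleftrightarrow>
     (\<forall>k \<le> rank M - 1.
        \<forall>\<eta>1 \<in> N1 \<inter> CH_graded M k. \<forall>\<eta>2 \<in> N2 \<inter> CH_graded M (rank M - 1 - k).
          degree_map M (\<eta>1 \<otimes>\<^bsub>CH M\<^esub> \<eta>2) = 0)"


section \<open>The Chow ring as a module over the Chow ring of a deletion\<close>

text \<open>
  The homomorphism \<open>\<theta>\<^sub>i\<close> is induced on residue classes by a substitution, which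
  is constant modulo the target ideal on each class.
\<close>

definition theta :: "'a matroid \<Rightarrow> 'a \<Rightarrow> 'a set_poly set \<Rightarrow> 'a set_poly set" where
  "theta M i \<eta> =
     the_elem ((\<lambda>p. CH_class M (substitute (\<lambda>F. x_poly M F + x_poly M (insert i F)) p)) ` \<eta>)"

definition CH_image :: "'a matroid \<Rightarrow> 'a \<Rightarrow> 'a set_poly set set" where
  "CH_image M i = theta M i ` carrier (CH (deletion M i))"

definition CH_module :: "'a matroid \<Rightarrow> 'a \<Rightarrow> ('a set_poly set, 'a set_poly set) module" where
  "CH_module M i =
     \<lparr>carrier = carrier (CH M), mult = mult (CH M), one = one (CH M),
      zero = zero (CH M), add = add (CH M),
      smult = (\<lambda>a \<eta>. theta M i a \<otimes>\<^bsub>CH M\<^esub> \<eta>)\<rparr>"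

text \<open>Graded means: each element is a sum of homogeneous elements of the submodule.\<close>

definition graded_submodule :: "'a matroid \<Rightarrow> 'a \<Rightarrow> 'a set_poly set set \<Rightarrow> bool" where
  "graded_submodule M i N \<longleftrightarrow>
     submodule N (CH (deletion M i)) (CH_module M i) \<and>
     (\<forall>\<eta>\<in>N. \<exists>n f. (\<forall>k\<in>{..n}. f k \<in> N \<inter> CH_graded M k) \<and>
        \<eta> = finsum (CH M) f {..n::nat})"

text \<open>Indecomposability in the category of graded modules.\<close>

definition indecomposable :: "'a matroid \<Rightarrow> 'a \<Rightarrow> 'a set_poly set set \<Rightarrow> bool" where
  "indecomposable M i N \<longleftrightarrow>
     graded_submodule M i N \<and> N \<noteq> {\<zero>\<^bsub>CH M\<^esub>} \<and>
     \<not> (\<exists>A B. graded_submodule M i A \<and> graded_submodule M i B \<and>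
          A \<noteq> {\<zero>\<^bsub>CH M\<^esub>} \<and> B \<noteq> {\<zero>\<^bsub>CH M\<^esub>} \<and>
          A \<inter> B = {\<zero>\<^bsub>CH M\<^esub>} \<and> N = A <+>\<^bsub>CH M\<^esub> B)"

definition is_direct_sum ::
  "'a matroid \<Rightarrow> 'a \<Rightarrow> 'b set \<Rightarrow> ('b \<Rightarrow> 'a set_poly set set) \<Rightarrow> bool" where
  "is_direct_sum M i A N \<longleftrightarrow>
     finite A \<and> (\<forall>a\<in>A. graded_submodule M i (N a)) \<and>
     (\<forall>\<eta>\<in>carrier (CH M). \<exists>!f. f \<in> (\<Pi>\<^sub>E a\<in>A. N a) \<and> \<eta> = finsum (CH M) f A)"

text \<open>
  The summands are indexed by labels: \<open>None\<close> for the image of \<open>\<theta>\<^sub>i\<close>,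
  and \<open>Some G\<close> for its multiple by \<open>x\<^sub>G\<close>.
\<close>

definition summand :: "'a matroid \<Rightarrow> 'a \<Rightarrow> 'a set option \<Rightarrow> 'a set_poly set set" where
  "summand M i a =
     (case a of
        None \<Rightarrow> CH_image M i
      | Some G \<Rightarrow> {x_CH M G \<otimes>\<^bsub>CH M\<^esub> \<eta> | \<eta>. \<eta> \<in> CH_image M i})"

definition labels :: "'a matroid \<Rightarrow> 'a \<Rightarrow> 'a set option set" where
  "labels M i = {None} \<union> {Some (insert i F) | F. F \<in> S_flats M i}"

definition coloop_labels :: "'a matroid \<Rightarrow> 'a \<Rightarrow> 'a set option set" where
  "coloop_labels M i = {None, Some (ground M - {i})} \<union> {Some (insert i F) | F. F \<in> S_flats M i}"

end

theory Submission
  imports Defs "HOL-Library.Multiset"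
begin

text \<open>
  The degree functional is Eur's formula: a monomial supported on a flag has an explicit degree in
  terms of the reduced characteristic polynomials of the intervals of the flag. That it kills the
  linear relations is a telescoping sum based on Weisner's theorem. Writing \<open>x\<^sub>E\<close> for
  minus the sum of the \<open>x\<^sub>F\<close> with \<open>j \<in> F\<close>, every class has a Feichtner-Yuzvinsky normal form, and pairing
  with complementary monomials is triangular on normal forms; hence the pairing is nondegenerate.

  Put \<open>t\<^sub>F = x\<^sub>F + x\<^bsub>F \<union> i\<^esub>\<close>. The linear relations express the product of any two of the
  generators \<open>1\<close>, \<open>x\<^bsub>F \<union> i\<^esub>\<close>, \<open>x\<^bsub>E - i\<^esub>\<close> through one generator times elements of the image of \<open>\<theta>\<^sub>i\<close>,
  so the summands span. Multiplication by \<open>x\<^bsub>F \<union> i\<^esub>\<close> splits monomials in the \<open>t\<^sub>G\<close> into a part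
  below \<open>F\<close> and a part above \<open>F \<union> i\<close>, and a rank count shows that \<open>x\<^bsub>F \<union> i\<^esub> CH\<^sub>i\<close> vanishes in top
  degree; this gives orthogonality. Nondegeneracy of the pairing on the whole ring then makes the sum direct.
\<close>

section \<open>Flats, rank and closure\<close>

text \<open>Directness of the sum rests on a degree map and on Poincare duality, so both are
  established along the way. Triangularity makes the coefficients of a normal form vanish one after
  another; no dimension is counted and no basis is exhibited. The rank count behind orthogonality:
  after multiplication by the variable of \<open>F \<union> i\<close>, lower factors
  \<open>t_G\<close> live in the interval from the empty set to \<open>F\<close>, of length
  \<open>rk F\<close>, and upper factors in the interval from \<open>F \<union> i\<close> to
  \<open>E\<close>, of length \<open>d - rk F - 1\<close>. The lengths add up to
  \<open>d - 1\<close> only, because the step from \<open>F\<close> to \<open>F \<union> i\<close>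
  is lost. Top degree leaves \<open>d - 2\<close> factors, so one of the two intervals is filled and
  the product vanishes. For a coloop the deletion has rank \<open>d - 1\<close>, so the image of
  \<open>\<theta>_i\<close> itself vanishes in top degree and pairs to zero with itself. By duality
  it cannot also be orthogonal to its multiple by the variable of \<open>E - i\<close>; this pair is
  separated by the relation \<open>x * x = - x * \<theta>_i(a)\<close> for that variable.\<close>

inductive saturated :: "'a matroid \<Rightarrow> 'a set \<Rightarrow> nat \<Rightarrow> 'a set \<Rightarrow> bool" for M where
  refl: "A \<in> flats M \<Longrightarrow> saturated M A 0 A"
| step: "A \<in> flats M \<Longrightarrow> covers M A A' \<Longrightarrow> saturated M A' n B \<Longrightarrow> saturated M A (Suc n) B"

definition rk :: "'a matroid \<Rightarrow> 'a set \<Rightarrow> nat" where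
  "rk M F = (THE n. saturated M {} n F)"

definition flat_closure :: "'a matroid \<Rightarrow> 'a set \<Rightarrow> 'a set" where
  "flat_closure M X = \<Inter>{F \<in> flats M. X \<subseteq> F}"

locale flat_matroid =
  fixes M :: "'a matroid"
  assumes matroid: "matroid M"
begin

abbreviation E where "E \<equiv> ground M"

lemma finite_E: "finite E"
  using matroid by (simp add: matroid_def)

lemma flat_subset: "F \<in> flats M \<Longrightarrow> F \<subseteq> E"
  using matroid by (auto simp: matroid_def)

lemma finite_flat: "F \<in> flats M \<Longrightarrow> finite F"
  using flat_subset finite_E finite_subset by blast

lemma finite_flats: "finite (flats M)"
  using flat_subset finite_E by (meson Pow_iff finite_Pow_iff finite_subset subsetI)

lemma flat_Int: "F \<in> flats M \<Longrightarrow> G \<in> flats M \<Longrightarrow> F \<inter> G \<in> flats M"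
  using matroid by (simp add: matroid_def)

lemma unique_cover: "F \<in> flats M \<Longrightarrow> e \<in> E \<Longrightarrow> e \<notin> F \<Longrightarrow> \<exists>!G. covers M F G \<and> e \<in> G"
  using matroid by (simp add: matroid_def)

lemma coversD:
  assumes "covers M F G"
  shows "G \<in> flats M" "F \<subset> G" "\<And>H. H \<in> flats M \<Longrightarrow> F \<subseteq> H \<Longrightarrow> H \<subset> G \<Longrightarrow> H = F"
  using assms by (auto simp: covers_def)

lemma cover_least:
  assumes "F \<in> flats M" "covers M F G" "e \<in> G" "e \<notin> F" "H \<in> flats M" "F \<subseteq> H" "e \<in> H"
  shows "G \<subseteq> H"
proof -
  have "G \<inter> H \<in> flats M" using assms coversD flat_Int by blast
  moreover have "F \<subset> G \<inter> H" using assms coversD(2)[OF assms(2)] by blast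
  ultimately have "\<not> G \<inter> H \<subset> G" using assms(2) by (auto simp: covers_def)
  then show ?thesis by blast
qed

lemma cover_exists:
  assumes "F \<in> flats M" "H \<in> flats M" "F \<subseteq> H" "e \<in> H" "e \<notin> F"
  obtains G where "covers M F G" "e \<in> G" "G \<subseteq> H"
proof -
  obtain G where "covers M F G" "e \<in> G"
    using unique_cover[OF assms(1)] flat_subset[OF assms(2)] assms(4,5) by blast
  with cover_least[OF assms(1) this assms(5,2,3,4)] that show ?thesis by blast
qed

lemma E_flat: "E \<in> flats M"
proof -
  have "flats M \<noteq> {}" using matroid by (simp add: matroid_def)
  then obtain F where F: "F \<in> flats M" "\<And>G. G \<in> flats M \<Longrightarrow> F \<subseteq> G \<Longrightarrow> G = F"
    using finite_has_maximal[OF finite_flats] by metis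
  have "F = E"
  proof (rule ccontr)
    assume "F \<noteq> E"
    then obtain e where "e \<in> E" "e \<notin> F" using flat_subset[OF F(1)] by blast
    then obtain G where "covers M F G" using unique_cover[OF F(1)] by blast
    then show False using F(2) coversD by blast
  qed
  then show ?thesis using F by simp
qed

lemma closure_flat:
  assumes "X \<subseteq> E" shows "flat_closure M X \<in> flats M"
proof -
  have "\<Inter>\<F> \<in> flats M" if "\<F> \<subseteq> flats M" "\<F> \<noteq> {}" "finite \<F>" for \<F>
    using that(3,2,1)
    by (induction \<F> rule: finite_ne_induct) (auto intro: flat_Int)
  moreover have "E \<in> {F \<in> flats M. X \<subseteq> F}" using assms E_flat by simp
  ultimately show ?thesis unfolding flat_closure_def using finite_flats
    by (metis (no_types, lifting) empty_iff finite_subset mem_Collect_eq subsetI)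
qed

lemma closure_superset: "X \<subseteq> flat_closure M X"
  by (auto simp: flat_closure_def)

lemma closure_least: "F \<in> flats M \<Longrightarrow> X \<subseteq> F \<Longrightarrow> flat_closure M X \<subseteq> F"
  by (auto simp: flat_closure_def)

lemma closure_of_flat: "F \<in> flats M \<Longrightarrow> flat_closure M F = F"
  using closure_superset closure_least by blast

section \<open>Saturated chains: existence, equal length, joins\<close>

lemma saturated_flats:
  "saturated M A n B \<Longrightarrow> A \<in> flats M \<and> B \<in> flats M \<and> A \<subseteq> B"
  by (induction rule: saturated.induct) (auto dest: coversD)

lemma saturated_0_iff: "saturated M A 0 B \<longleftrightarrow> A \<in> flats M \<and> A = B"
  by (auto elim: saturated.cases intro: saturated.refl)

lemma saturated_exists:
  assumes "A \<in> flats M" "B \<in> flats M" "A \<subseteq> B"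
  shows "\<exists>n. saturated M A n B"
  using assms
proof (induction "card (B - A)" arbitrary: A rule: less_induct)
  case less
  show ?case
  proof (cases "A = B")
    case True then show ?thesis using less.prems saturated.refl by blast
  next
    case False
    then obtain e where e: "e \<in> B" "e \<notin> A" using less.prems by blast
    obtain G where G: "covers M A G" "e \<in> G" "G \<subseteq> B"
      using cover_exists[OF less.prems e] by blast
    have "card (B - G) < card (B - A)"
      using G e finite_flat[OF less.prems(2)] coversD[OF G(1)]
      by (intro psubset_card_mono) auto
    then obtain n where "saturated M G n B" using less.hyps coversD(1)[OF G(1)] less.prems(2) G(3) by blast
    from saturated.step[OF less.prems(1) G(1) this] show ?thesis by blast
  qed
qed

text \<open>The diamond of the Jordan-Dedekind argument. An element of \<open>b - a\<close>
  determines a cover \<open>c\<close> of \<open>a\<close>, an element of \<open>a - b\<close> a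
  cover \<open>c'\<close> of \<open>b\<close>. Each is the least flat above its base that contains
  its element, so each contains the other.\<close>

lemma common_cover:
  assumes "A \<in> flats M" "covers M A a" "covers M A b" "a \<noteq> b"
  obtains c where "covers M a c" "covers M b c" "\<And>H. H \<in> flats M \<Longrightarrow> a \<subseteq> H \<Longrightarrow> b \<subseteq> H \<Longrightarrow> c \<subseteq> H"
proof -
  have ab: "\<not> a \<subseteq> b" "\<not> b \<subseteq> a" using assms unfolding covers_def by blast+
  obtain e where e: "e \<in> b" "e \<notin> a" using ab by blast
  have af: "a \<in> flats M" "b \<in> flats M" "A \<subset> a" "A \<subset> b" using assms coversD by auto
  obtain c where c: "covers M a c" "e \<in> c"
    using unique_cover[OF af(1) _ e(2)] e flat_subset[OF af(2)] by blast
  have "b \<subseteq> c" using cover_least[OF assms(1,3) e(1), of c] e c coversD[OF c(1)] af by blast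
  obtain f where f: "f \<in> a" "f \<notin> b" using ab by blast
  obtain c' where c': "covers M b c'" "f \<in> c'"
    using unique_cover[OF af(2) _ f(2)] f flat_subset[OF af(1)] by blast
  have "a \<subseteq> c'" using cover_least[OF assms(1,2) f(1), of c'] f c' coversD[OF c'(1)] af by blast
  have "c \<subseteq> c'" using cover_least[OF af(1) c e(2), of c'] coversD[OF c'(1)] \<open>a \<subseteq> c'\<close> e by blast
  have "c' \<subseteq> c" using cover_least[OF af(2) c' f(2), of c] coversD[OF c(1)] \<open>b \<subseteq> c\<close> f by blast
  have "c \<subseteq> H" if "H \<in> flats M" "a \<subseteq> H" "b \<subseteq> H" for H
    using cover_least[OF af(1) c e(2) that(1,2)] e that by blast
  moreover have "c = c'" using \<open>c \<subseteq> c'\<close> \<open>c' \<subseteq> c\<close> by blast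
  ultimately show ?thesis using that[of c] c(1) c'(1) by simp
qed

text \<open>If two chains start with different covers, both are rerouted through the common cover of
  their first steps and share the rest of the way.\<close>

lemma saturated_unique:
  "saturated M A n B \<Longrightarrow> saturated M A m B \<Longrightarrow> n = m"
proof (induction n arbitrary: A m)
  case 0
  then have "A = B" by (simp add: saturated_0_iff)
  show ?case using 0(2)
  proof cases
    case (step a k)
    then show ?thesis using coversD(2)[OF step(3)] saturated_flats[OF step(4)] \<open>A = B\<close> by auto
  qed simp
next
  case (Suc n)
  obtain a where a: "A \<in> flats M" "covers M A a" "saturated M a n B" using Suc.prems(1) by cases
  have "A \<noteq> B" using coversD(2)[OF a(2)] saturated_flats[OF a(3)] by blast
  obtain b k where b: "m = Suc k" "covers M A b" "saturated M b k B"
    using Suc.prems(2) \<open>A \<noteq> B\<close> by cases blast+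
  show ?case
  proof (cases "a = b")
    case True then show ?thesis using Suc.IH a b by blast
  next
    case False
    obtain c where c: "covers M a c" "covers M b c" "c \<subseteq> B"
      by (rule common_cover[OF a(1,2) b(2) False]) (use saturated_flats[OF a(3)] saturated_flats[OF b(3)] in blast)
    obtain p where p: "saturated M c p B"
      using saturated_exists c coversD[OF c(1)] saturated_flats[OF a(3)] by blast
    have "n = Suc p" using Suc.IH[OF a(3) saturated.step[OF _ c(1) p]] saturated_flats[OF a(3)] by blast
    moreover have "saturated M b (Suc p) B"
      using saturated.step[OF _ c(2) p] saturated_flats[OF b(3)] by blast
    ultimately have "n = k" using Suc.IH[OF _ b(3)] by simp
    then show ?thesis using b by simp
  qed
qed

lemma saturated_trans: "saturated M A n B \<Longrightarrow> saturated M B m C \<Longrightarrow> saturated M A (n + m) C"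
  by (induction rule: saturated.induct) (auto intro: saturated.step)

text \<open>Semimodularity in terms of chain lengths: joined with \<open>H\<close>, each cover step
  of the chain from \<open>K\<close> to \<open>G\<close> is either absorbed or is again a cover
  step.\<close>

lemma saturated_join:
  "saturated M K n G \<Longrightarrow> H \<in> flats M \<Longrightarrow> K \<subseteq> H \<Longrightarrow> \<exists>m\<le>n. saturated M H m (flat_closure M (G \<union> H))"
proof (induction arbitrary: H rule: saturated.induct)
  case (refl A)
  then show ?case using closure_of_flat by (metis le_refl saturated.refl sup.absorb2)
next
  case (step K K1 n G)
  note K1 = coversD[OF step.hyps(2)]
  show ?case
  proof (cases "K1 \<subseteq> H")
    case True then show ?thesis using step.IH step.prems le_SucI by blast
  next
    case False
    then obtain e where e: "e \<in> K1" "e \<notin> H" by blast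
    have KG: "K1 \<subseteq> G" "G \<in> flats M" using saturated_flats[OF step.hyps(3)] by auto
    obtain H1 where H1: "covers M H H1" "e \<in> H1"
      using unique_cover[OF step.prems(1) _ e(2)] e flat_subset[OF K1(1)] by blast
    note H1' = coversD[OF H1(1)]
    have "K1 \<subseteq> H1"
      using cover_least[OF step.hyps(1,2) e(1), of H1] e step.prems H1 H1' by blast
    then obtain m where m: "m \<le> n" "saturated M H1 m (flat_closure M (G \<union> H1))"
      using step.IH H1' by blast
    have GH: "G \<union> H \<subseteq> E" "G \<union> H1 \<subseteq> E" using flat_subset KG step.prems H1' by auto
    have "H1 \<subseteq> flat_closure M (G \<union> H)"
      using cover_least[OF step.prems(1) H1 e(2), of "flat_closure M (G \<union> H)"] closure_flat[OF GH(1)]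
        closure_superset[of "G \<union> H"] e KG by blast
    then have "flat_closure M (G \<union> H1) \<subseteq> flat_closure M (G \<union> H)"
      using closure_superset[of "G \<union> H"] by (intro closure_least closure_flat GH) auto
    moreover have "flat_closure M (G \<union> H) \<subseteq> flat_closure M (G \<union> H1)"
      using closure_superset[of "G \<union> H1"] H1' by (intro closure_least closure_flat GH) auto
    ultimately have "saturated M H (Suc m) (flat_closure M (G \<union> H))"
      using saturated.step[OF step.prems(1) H1(1) m(2)] by simp
    then show ?thesis using m by (meson Suc_le_mono)
  qed
qed

end

locale loopless_matroid = flat_matroid +
  assumes loopless: "loopless M"
begin

section \<open>The rank function and maximal flags\<close>

lemma empty_flat: "{} \<in> flats M"
  using loopless by (simp add: loopless_def)

lemma saturated_rk: "F \<in> flats M \<Longrightarrow> saturated M {} (rk M F) F"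
proof -
  assume "F \<in> flats M"
  then obtain n where n: "saturated M {} n F" using saturated_exists[OF empty_flat] by blast
  have "rk M F = n" unfolding rk_def by (rule the_equality, rule n, erule saturated_unique[OF _ n])
  with n show ?thesis by simp
qed

lemma rk_saturated:
  assumes "saturated M A n B" shows "rk M B = rk M A + n"
proof -
  have "saturated M {} (rk M A + n) B"
    using saturated_trans[OF saturated_rk assms] saturated_flats[OF assms] by simp
  moreover have "saturated M {} (rk M B) B" using saturated_flats[OF assms] saturated_rk by blast
  ultimately show ?thesis using saturated_unique by metis
qed

lemma rk_empty [simp]: "rk M {} = 0"
  using saturated_unique[OF saturated_rk[OF empty_flat] saturated.refl[OF empty_flat]] .

lemma rk_cover: "A \<in> flats M \<Longrightarrow> covers M A B \<Longrightarrow> rk M B = Suc (rk M A)"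
  using rk_saturated[OF saturated.step[OF _ _ saturated.refl], of A B] coversD(1)[of A B] by simp

lemma rk_mono: "A \<in> flats M \<Longrightarrow> B \<in> flats M \<Longrightarrow> A \<subseteq> B \<Longrightarrow> rk M A \<le> rk M B"
  using saturated_exists[of A B] rk_saturated[of A _ B] by fastforce

lemma rk_less: 
  assumes "A \<in> flats M" "B \<in> flats M" "A \<subset> B"
  shows "rk M A < rk M B"
proof -
  obtain n where n: "saturated M A n B" using saturated_exists assms by blast
  have "n \<noteq> 0"
  proof
    assume "n = 0"
    then show False using n assms(3) by (simp add: saturated_0_iff)
  qed
  then show ?thesis using rk_saturated[OF n] by simp
qed

lemma rk_pos: "A \<in> flats M \<Longrightarrow> A \<noteq> {} \<Longrightarrow> 0 < rk M A"
  using rk_less[OF empty_flat, of A] by (simp add: psubset_eq)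

lemma rk_le: "A \<in> flats M \<Longrightarrow> rk M A \<le> rk M E"
  using rk_mono[OF _ E_flat flat_subset] .

lemma cover_iff_rk:
  assumes "A \<in> flats M" "B \<in> flats M" "A \<subseteq> B" "rk M B = Suc (rk M A)"
  shows "covers M A B"
  unfolding covers_def
proof (intro conjI)
  show "B \<in> flats M" "A \<subset> B" using assms by auto
  show "\<not> (\<exists>H\<in>flats M. A \<subset> H \<and> H \<subset> B)"
  proof
    assume "\<exists>H\<in>flats M. A \<subset> H \<and> H \<subset> B"
    then obtain H where "H \<in> flats M" "A \<subset> H" "H \<subset> B" by blast
    then show False using rk_less[of A H] rk_less[of H B] assms by linarith
  qed
qed

lemma rk_semimodular:
  assumes "G \<in> flats M" "H \<in> flats M" "K \<in> flats M" "K \<subseteq> G" "K \<subseteq> H"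
  shows "rk M (flat_closure M (G \<union> H)) + rk M K \<le> rk M H + rk M G"
proof -
  obtain n where n: "saturated M K n G" using saturated_exists assms by blast
  from saturated_join[OF n assms(2,5)] obtain m where m: "m \<le> n" "saturated M H m (flat_closure M (G \<union> H))"
    by blast
  show ?thesis using rk_saturated[OF n] rk_saturated[OF m(2)] m(1) by simp
qed

lemma proper_flats_iff: "F \<in> proper_flats M \<longleftrightarrow> F \<in> flats M \<and> F \<subset> E"
  using flat_subset[of F] by (auto simp: proper_flats_def)

lemma npf_iff: "F \<in> nonempty_proper_flats M \<longleftrightarrow> F \<in> flats M \<and> F \<noteq> {} \<and> F \<subset> E"
  by (auto simp: nonempty_proper_flats_def proper_flats_iff)

lemma finite_npf: "finite (nonempty_proper_flats M)"
  using finite_flats by (simp add: nonempty_proper_flats_def proper_flats_def)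

text \<open>Maximality excludes gaps: if the largest member \<open>A\<close> of rank at most
  \<open>n\<close> had smaller rank, a cover of \<open>A\<close> inside the next member
  \<open>B\<close> could be added to the chain. \<open>E\<close> stands in for \<open>B\<close> when
  no member of larger rank exists.\<close>

lemma maxchain_bij_rk:
  assumes C: "subset.maxchain (proper_flats M) C"
  shows "bij_betw (rk M) C {..<rk M E}"
proof -
  have ch: "subset.chain (proper_flats M) C" using C by (rule subset.maxchain_imp_chain)
  have Csub: "C \<subseteq> proper_flats M" and cmp: "\<And>A B. A \<in> C \<Longrightarrow> B \<in> C \<Longrightarrow> A \<subseteq> B \<or> B \<subseteq> A"
    using ch by (auto simp: subset_chain_def)
  have max: "G \<in> C" if "G \<in> proper_flats M" "\<And>A. A \<in> C \<Longrightarrow> A \<subseteq> G \<or> G \<subseteq> A" for G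
  proof (rule ccontr)
    assume "G \<notin> C"
    have "subset.chain (proper_flats M) (insert G C)"
      unfolding subset_chain_def using Csub cmp that by (metis (no_types, lifting) insert_iff insert_subset order_refl)
    then show False using C \<open>G \<notin> C\<close> by (auto simp: subset.maxchain_def)
  qed
  have fl: "A \<in> flats M" "A \<subset> E" if "A \<in> C" for A using that Csub proper_flats_iff[of A] by auto
  have fin: "finite C" using Csub finite_flats by (auto simp: proper_flats_def intro: finite_subset)
  have inj: "inj_on (rk M) C"
  proof (rule inj_onI)
    fix A B assume "A \<in> C" "B \<in> C" "rk M A = rk M B"
    then show "A = B" using cmp[of A B] rk_less[of A B] rk_less[of B A] fl by (metis less_irrefl psubsetI)
  qed
  have surj: "n \<in> rk M ` C" if n: "n < rk M E" for n
  proof -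
    have "E \<noteq> {}" using n by auto
    then have "{} \<in> proper_flats M" using empty_flat by (simp add: proper_flats_def)
    then have e: "{} \<in> {A \<in> C. rk M A \<le> n}" using max[of "{}"] by simp
    moreover have "finite {A \<in> C. rk M A \<le> n}" using fin by simp
    ultimately obtain A where "A \<in> {A \<in> C. rk M A \<le> n}"
      "\<And>A'. A' \<in> {A \<in> C. rk M A \<le> n} \<Longrightarrow> A \<subseteq> A' \<Longrightarrow> A = A'"
      using finite_has_maximal[of "{A \<in> C. rk M A \<le> n}"] by blast
    then have A: "A \<in> C" "rk M A \<le> n" "\<And>A'. A' \<in> C \<Longrightarrow> rk M A' \<le> n \<Longrightarrow> A \<subseteq> A' \<Longrightarrow> A' = A"
      by auto
    let ?U = "insert E {B \<in> C. n < rk M B}"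
    obtain B where B: "B \<in> ?U" "\<And>B'. B' \<in> ?U \<Longrightarrow> B' \<subseteq> B \<Longrightarrow> B' = B"
      using finite_has_minimal[of ?U] fin by auto
    have Bf: "B \<in> flats M" using B fl E_flat by auto
    have nB: "n < rk M B" using B n by auto
    have AB: "A \<subset> B"
    proof (cases "B = E")
      case True then show ?thesis using fl[OF A(1)] by simp
    next
      case False
      then have "B \<in> C" using B by auto
      then have "A \<subseteq> B \<or> B \<subseteq> A" using cmp A(1) by blast
      moreover have "\<not> B \<subseteq> A" using rk_mono[OF Bf fl(1)[OF A(1)]] A(2) nB by auto
      ultimately show ?thesis by blast
    qed
    show ?thesis
    proof (cases "rk M A = n")
      case True then show ?thesis using A by blast
    next
      case False
      obtain e where e: "e \<in> B" "e \<notin> A" using AB by blast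
      obtain G where G: "covers M A G" "e \<in> G" "G \<subseteq> B"
        using cover_exists[OF fl(1)[OF A(1)] Bf _ e] AB by blast
      have rG: "rk M G = Suc (rk M A)" using rk_cover G fl A by blast
      then have "rk M G \<le> n" using False A by simp
      then have "G \<subset> B" using G nB by auto
      have Gf: "G \<in> flats M" "A \<subset> G" using coversD G by auto
      have "G \<in> C"
      proof (rule max)
        show "G \<in> proper_flats M" using Gf \<open>G \<subset> B\<close> flat_subset[OF Bf] by (auto simp: proper_flats_def)
        fix X assume X: "X \<in> C"
        show "X \<subseteq> G \<or> G \<subseteq> X"
        proof (cases "rk M X \<le> n")
          case True
          then have "X \<subseteq> A" using A(3)[OF X True] cmp[OF X A(1)] by blast
          then show ?thesis using Gf by blast
        next
          case False
          have "B \<subseteq> X"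
          proof (cases "B = E")
            case True
            have "X \<in> ?U" using X \<open>\<not> rk M X \<le> n\<close> by simp
            then have "X = B" using B(2) fl[OF X] True by blast
            then show ?thesis by simp
          next
            case False
            then have "B \<in> C" using B by blast
            have "X \<in> ?U" using X \<open>\<not> rk M X \<le> n\<close> by simp
            then show ?thesis using cmp[OF X \<open>B \<in> C\<close>] B(2) by blast
          qed
          then show ?thesis using \<open>G \<subset> B\<close> by blast
        qed
      qed
      then have "G = A" using A(3) \<open>rk M G \<le> n\<close> Gf by blast
      then show ?thesis using Gf by blast
    qed
  qed
  moreover have "rk M A < rk M E" if "A \<in> C" for A using rk_less[OF fl(1)[OF that] E_flat fl(2)[OF that]] .
  ultimately have "rk M ` C = {..<rk M E}" using surj by auto
  then show ?thesis using inj by (simp add: bij_betw_def)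
qed

lemma maxchain_card: "subset.maxchain (proper_flats M) C \<Longrightarrow> card C = rk M E"
  using maxchain_bij_rk bij_betw_same_card by fastforce

lemma rank_eq: "rank M = rk M E"
  unfolding rank_def
proof (rule the_equality)
  show "\<forall>C. subset.maxchain (proper_flats M) C \<longrightarrow> card C = rk M E" using maxchain_card by blast
  fix d assume "\<forall>C. subset.maxchain (proper_flats M) C \<longrightarrow> card C = d"
  moreover obtain C where "subset.maxchain (proper_flats M) C" using subset.Hausdorff by blast
  ultimately show "d = rk M E" using maxchain_card by blast
qed

end

section \<open>Whitney numbers of intervals and the degree of a flag monomial\<close>

text \<open>The condition \<open>finite G\<close> in the index set makes \<open>card G\<close> a
  termination measure for arbitrary arguments.\<close>

function moebius :: "'a matroid \<Rightarrow> 'a set \<Rightarrow> 'a set \<Rightarrow> rat" where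
  "moebius M F G =
     (if F = G then 1 else - (\<Sum>H\<in>{H \<in> flats M. F \<subseteq> H \<and> H \<subset> G \<and> finite G}. moebius M F H))"
  by auto
termination
  by (relation "measure (\<lambda>(M, F, G). card G)") (auto intro: psubset_card_mono)

declare moebius.simps [simp del]

definition signless_moebius :: "'a matroid \<Rightarrow> 'a set \<Rightarrow> 'a set \<Rightarrow> rat" where
  "signless_moebius M F G = (-1) ^ (rk M G - rk M F) * moebius M F G"

definition whitney :: "'a matroid \<Rightarrow> 'a set \<Rightarrow> 'a set \<Rightarrow> nat \<Rightarrow> rat" where
  "whitney M F G a =
     (\<Sum>H\<in>{H \<in> flats M. F \<subseteq> H \<and> H \<subseteq> G \<and> rk M H = rk M F + a}. signless_moebius M F H)"

text \<open>The unsigned coefficients of the reduced characteristic polynomial of the interval.\<close>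

primrec reduced_whitney :: "'a matroid \<Rightarrow> 'a set \<Rightarrow> 'a set \<Rightarrow> nat \<Rightarrow> rat" where
  "reduced_whitney M F G 0 = 1"
| "reduced_whitney M F G (Suc a) = whitney M F G (Suc a) - reduced_whitney M F G a"

fun flag_list :: "'a matroid \<Rightarrow> 'a set \<Rightarrow> ('a set \<times> nat) list \<Rightarrow> bool" where
  "flag_list M F [] \<longleftrightarrow> True"
| "flag_list M F ((G, e) # l) \<longleftrightarrow>
     G \<in> flats M \<and> F \<subset> G \<and> G \<subset> ground M \<and> 0 < e \<and> flag_list M G l"

text \<open>Multiplication of the monomial of a flag by a variable compatible with it.\<close>

fun flag_insert :: "'a set \<Rightarrow> ('a set \<times> nat) list \<Rightarrow> ('a set \<times> nat) list" where
  "flag_insert H [] = [(H, 1)]"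
| "flag_insert H ((G, e) # l) =
     (if H = G then (G, Suc e) # l else if H \<subset> G then (H, 1) # (G, e) # l
      else (G, e) # flag_insert H l)"

text \<open>Eur's formula, read from the bottom of the flag; \<open>c\<close> is the degree accumulated so far.\<close>

fun flag_degree :: "'a matroid \<Rightarrow> 'a set \<Rightarrow> nat \<Rightarrow> ('a set \<times> nat) list \<Rightarrow> rat" where
  "flag_degree M F c [] = reduced_whitney M F (ground M) (c - rk M F)"
| "flag_degree M F c ((G, e) # l) = reduced_whitney M F G (c - rk M F) *
     (if rk M G \<le> c + e
      then (-1) ^ (e - 1) * of_nat ((e - 1) choose (c + e - rk M G)) * flag_degree M G (c + e) l
      else 0)"

text \<open>All of \<open>flag_degree\<close> except the leading Whitney factor. Only that factor
  depends on the starting flat \<open>F\<close>, so changes in the gap below the first flat of the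
  list can be studied in it alone.\<close>

fun flag_tail :: "'a matroid \<Rightarrow> nat \<Rightarrow> ('a set \<times> nat) list \<Rightarrow> rat" where
  "flag_tail M c [] = 1"
| "flag_tail M c ((G, e) # l) =
     (if rk M G \<le> c + e
      then (-1) ^ (e - 1) * of_nat ((e - 1) choose (c + e - rk M G)) * flag_degree M G (c + e) l
      else 0)"

definition flag_head :: "'a matroid \<Rightarrow> ('a set \<times> nat) list \<Rightarrow> 'a set" where
  "flag_head M l = (case l of [] \<Rightarrow> ground M | p # _ \<Rightarrow> fst p)"

definition compatible :: "'a matroid \<Rightarrow> 'a set \<Rightarrow> ('a set \<times> nat) list \<Rightarrow> 'a set set" where
  "compatible M F l =
     {H \<in> flats M. F \<subset> H \<and> H \<subset> ground M \<and> (\<forall>p\<in>set l. H \<subseteq> fst p \<or> fst p \<subseteq> H)}"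

lemma flag_degree_head_tail:
  "flag_degree M F c l = reduced_whitney M F (flag_head M l) (c - rk M F) * flag_tail M c l"
  by (cases l) (auto simp: flag_head_def)

lemma flag_list_above: "flag_list M F l \<Longrightarrow> p \<in> set l \<Longrightarrow> F \<subset> fst p"
  by (induction M F l rule: flag_list.induct) auto

lemma flag_list_flats: "flag_list M F l \<Longrightarrow> p \<in> set l \<Longrightarrow> fst p \<in> flats M \<and> fst p \<subset> ground M"
  by (induction M F l rule: flag_list.induct) auto

context loopless_matroid
begin

section \<open>Weisner's theorem and reduced Whitney numbers\<close>

lemma closure_insert_covers:
  assumes "H \<in> flats M" "e \<in> E" "e \<notin> H"
  shows "covers M H (flat_closure M (insert e H))"
proof -
  obtain G where G: "covers M H G" "e \<in> G" using unique_cover[OF assms] by blast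
  have sub: "insert e H \<subseteq> E" using assms flat_subset[OF assms(1)] by simp
  have "flat_closure M (insert e H) \<subseteq> G" using G coversD[OF G(1)] by (intro closure_least) auto
  moreover have "G \<subseteq> flat_closure M (insert e H)"
    using cover_least[OF assms(1) G assms(3) closure_flat[OF sub]] closure_superset[of "insert e H"] by simp
  ultimately show ?thesis using G(1) by simp
qed

lemma closure_insert_eq_iff:
  assumes "H \<in> flats M" "G \<in> flats M" "H \<subseteq> G" "e \<in> G" "e \<notin> H"
  shows "flat_closure M (insert e H) = G \<longleftrightarrow> rk M G = Suc (rk M H)"
proof
  have e: "e \<in> E" using assms flat_subset by blast
  assume "flat_closure M (insert e H) = G"
  then show "rk M G = Suc (rk M H)" using closure_insert_covers[OF assms(1) e assms(5)] rk_cover assms(1) by simp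
next
  assume "rk M G = Suc (rk M H)"
  then have c: "covers M H G" using cover_iff_rk assms by simp
  have e: "e \<in> E" using assms flat_subset by blast
  have sub: "insert e H \<subseteq> E" using e flat_subset[OF assms(1)] by simp
  show "flat_closure M (insert e H) = G"
  proof
    show "flat_closure M (insert e H) \<subseteq> G" using assms by (intro closure_least) auto
    show "G \<subseteq> flat_closure M (insert e H)"
      using cover_least[OF assms(1) c assms(4,5) closure_flat[OF sub]] closure_superset[of "insert e H"] by simp
  qed
qed

lemma moebius_self [simp]: "moebius M F F = 1"
  by (subst moebius.simps) simp

lemma finite_flats_Collect [simp]: "finite {H \<in> flats M. P H}"
  using finite_flats by simp

lemma moebius_sum:
  assumes "F \<in> flats M" "G \<in> flats M" "F \<subset> G"
  shows "(\<Sum>H\<in>{H \<in> flats M. F \<subseteq> H \<and> H \<subseteq> G}. moebius M F H) = 0"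
proof -
  have "{H \<in> flats M. F \<subseteq> H \<and> H \<subseteq> G} = insert G {H \<in> flats M. F \<subseteq> H \<and> H \<subset> G}"
    using assms by auto
  then have "(\<Sum>H\<in>{H \<in> flats M. F \<subseteq> H \<and> H \<subseteq> G}. moebius M F H)
      = moebius M F G + (\<Sum>H\<in>{H \<in> flats M. F \<subseteq> H \<and> H \<subset> G}. moebius M F H)"
    by simp
  moreover have "moebius M F G = - (\<Sum>H\<in>{H \<in> flats M. F \<subseteq> H \<and> H \<subset> G}. moebius M F H)"
    using assms finite_flat[OF assms(2)] by (subst moebius.simps) simp
  ultimately show ?thesis by simp
qed

text \<open>Partition the flats of the interval by their join \<open>K\<close> with
  \<open>j\<close>. The total is zero, and the fibres over \<open>K \<subset> G\<close> vanish by
  induction, hence so does the fibre over \<open>G\<close>.\<close>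

lemma weisner:
  assumes "F \<in> flats M" "G \<in> flats M" "F \<subseteq> G" "j \<in> G" "j \<notin> F"
  shows "(\<Sum>H\<in>{H \<in> flats M. F \<subseteq> H \<and> H \<subseteq> G \<and> flat_closure M (insert j H) = G}. moebius M F H) = 0"
  using assms
proof (induction "card G" arbitrary: G rule: less_induct)
  case less
  let ?X = "{H \<in> flats M. F \<subseteq> H \<and> H \<subseteq> G}"
  let ?T = "{K \<in> flats M. F \<subseteq> K \<and> K \<subseteq> G \<and> j \<in> K}"
  let ?g = "\<lambda>H. flat_closure M (insert j H)"
  have E: "insert j H \<subseteq> E" if "H \<in> ?X" for H using that flat_subset[of H] flat_subset[OF less.prems(2)] less.prems(4) by auto
  have img: "?g ` ?X \<subseteq> ?T"
  proof safe
    fix H assume H: "H \<in> flats M" "F \<subseteq> H" "H \<subseteq> G"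
    show "?g H \<in> flats M" using H E closure_flat by simp
    show "x \<in> ?g H" if "x \<in> F" for x using that H closure_superset[of "insert j H"] by blast
    show "x \<in> G" if "x \<in> ?g H" for x using that H less.prems closure_least[of G "insert j H"] by blast
    show "j \<in> ?g H" using closure_superset[of "insert j H"] by blast
  qed
  have inner: "{H \<in> ?X. ?g H = K} = {H \<in> flats M. F \<subseteq> H \<and> H \<subseteq> K \<and> ?g H = K}" if "K \<in> ?T" for K
  proof -
    have "H \<subseteq> K" if "?g H = K" for H using closure_superset[of "insert j H"] that by auto
    then show ?thesis using that by auto
  qed
  have "0 = (\<Sum>H\<in>?X. moebius M F H)" using moebius_sum[of F G] less.prems by auto
  also have "\<dots> = (\<Sum>K\<in>?T. \<Sum>H\<in>{H \<in> ?X. ?g H = K}. moebius M F H)"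
    using img by (subst sum.group) auto
  also have "\<dots> = (\<Sum>K\<in>?T. \<Sum>H\<in>{H \<in> flats M. F \<subseteq> H \<and> H \<subseteq> K \<and> ?g H = K}. moebius M F H)"
    using inner by (intro sum.cong) auto
  also have "\<dots> = (\<Sum>K\<in>{G}. \<Sum>H\<in>{H \<in> flats M. F \<subseteq> H \<and> H \<subseteq> K \<and> ?g H = K}. moebius M F H)"
  proof (rule sum.mono_neutral_right)
    show "{G} \<subseteq> ?T" using less.prems by auto
    show "\<forall>K\<in>?T - {G}. (\<Sum>H\<in>{H \<in> flats M. F \<subseteq> H \<and> H \<subseteq> K \<and> ?g H = K}. moebius M F H) = 0"
    proof
      fix K assume K: "K \<in> ?T - {G}"
      then have "card K < card G" using finite_flat[OF less.prems(2)] by (intro psubset_card_mono) auto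
      then show "(\<Sum>H\<in>{H \<in> flats M. F \<subseteq> H \<and> H \<subseteq> K \<and> ?g H = K}. moebius M F H) = 0"
        using less.hyps[of K] K less.prems by simp
    qed
  qed simp
  finally show ?case by simp
qed

lemma signless_moebius_self [simp]: "signless_moebius M F F = 1"
  by (simp add: signless_moebius_def)

text \<open>In Weisner's theorem the flats whose join with \<open>j\<close> is \<open>G\<close> are
  \<open>G\<close> itself and the flats of corank one in \<open>G\<close> that avoid
  \<open>j\<close>. The drop of the rank by one absorbs the sign.\<close>

lemma signless_moebius_rec:
  assumes "F \<in> flats M" "G \<in> flats M" "F \<subseteq> G" "j \<in> G" "j \<notin> F"
  shows "signless_moebius M F G =
    (\<Sum>H\<in>{H \<in> flats M. F \<subseteq> H \<and> H \<subseteq> G \<and> j \<notin> H \<and> rk M G = Suc (rk M H)}. signless_moebius M F H)"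
proof -
  let ?Y = "{H \<in> flats M. F \<subseteq> H \<and> H \<subseteq> G \<and> j \<notin> H \<and> rk M G = Suc (rk M H)}"
  have "{H \<in> flats M. F \<subseteq> H \<and> H \<subseteq> G \<and> flat_closure M (insert j H) = G} = insert G ?Y" (is "?A = _")
  proof (intro equalityI subsetI)
    fix H assume "H \<in> ?A"
    then show "H \<in> insert G ?Y"
      using closure_insert_eq_iff[of H G j] assms closure_of_flat[of H] by (cases "j \<in> H") (auto simp: insert_absorb)
  next
    fix H assume "H \<in> insert G ?Y"
    then show "H \<in> ?A"
      using closure_insert_eq_iff[of H G j] assms closure_of_flat[of G] by (auto simp: insert_absorb)
  qed
  moreover have "finite ?Y" "G \<notin> ?Y" using assms by auto
  ultimately have "moebius M F G = - (\<Sum>H\<in>?Y. moebius M F H)"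
    using weisner[OF assms] by simp
  then have "signless_moebius M F G = (\<Sum>H\<in>?Y. - ((-1) ^ (rk M G - rk M F)) * moebius M F H)"
    by (simp add: signless_moebius_def sum_distrib_left sum_negf)
  also have "\<dots> = (\<Sum>H\<in>?Y. signless_moebius M F H)"
  proof (rule sum.cong)
    fix H assume H: "H \<in> ?Y"
    then have "rk M F \<le> rk M H" using rk_mono assms by simp
    then have "rk M G - rk M F = Suc (rk M H - rk M F)" using H by simp
    then show "- ((-1) ^ (rk M G - rk M F)) * moebius M F H = signless_moebius M F H"
      by (simp add: signless_moebius_def)
  qed simp
  finally show ?thesis .
qed

text \<open>Joining with \<open>j\<close> maps the second index set to the first, and the fibre over
  \<open>H\<close> is the index set of \<open>signless_moebius_rec\<close> for
  \<open>H\<close>.\<close>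

lemma signless_moebius_shift:
  assumes "F \<in> flats M" "G \<in> flats M" "F \<subseteq> G" "j \<in> G" "j \<notin> F"
  shows "(\<Sum>H\<in>{H \<in> flats M. F \<subseteq> H \<and> H \<subseteq> G \<and> j \<in> H \<and> rk M H = rk M F + Suc a}. signless_moebius M F H)
    = (\<Sum>H\<in>{H \<in> flats M. F \<subseteq> H \<and> H \<subseteq> G \<and> j \<notin> H \<and> rk M H = rk M F + a}. signless_moebius M F H)"
    (is "(\<Sum>H\<in>?T. _) = (\<Sum>H\<in>?S. _)")
proof -
  let ?g = "\<lambda>H. flat_closure M (insert j H)"
  have jE: "j \<in> E" using assms flat_subset by blast
  have img: "?g H \<in> ?T" if H: "H \<in> ?S" for H
  proof -
    have c: "covers M H (?g H)" using closure_insert_covers[of H j] H jE by simp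
    have "?g H \<subseteq> G" using H assms by (intro closure_least) auto
    moreover have "j \<in> ?g H" using closure_superset[of "insert j H"] by simp
    moreover have "rk M (?g H) = Suc (rk M H)" using rk_cover[OF _ c] H by simp
    ultimately show ?thesis using H coversD[OF c] by auto
  qed
  have fib: "{H' \<in> ?S. ?g H' = H} = {H' \<in> flats M. F \<subseteq> H' \<and> H' \<subseteq> H \<and> j \<notin> H' \<and> rk M H = Suc (rk M H')}"
    if H: "H \<in> ?T" for H
  proof (intro equalityI subsetI)
    fix H' assume H': "H' \<in> {H' \<in> ?S. ?g H' = H}"
    then have "H' \<subseteq> H" using closure_superset[of "insert j H'"] by auto
    then show "H' \<in> {H' \<in> flats M. F \<subseteq> H' \<and> H' \<subseteq> H \<and> j \<notin> H' \<and> rk M H = Suc (rk M H')}"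
      using H H' by auto
  next
    fix H' assume H': "H' \<in> {H' \<in> flats M. F \<subseteq> H' \<and> H' \<subseteq> H \<and> j \<notin> H' \<and> rk M H = Suc (rk M H')}"
    then have "?g H' = H" using closure_insert_eq_iff[of H' H j] H by simp
    then show "H' \<in> {H' \<in> ?S. ?g H' = H}" using H H' by auto
  qed
  have "(\<Sum>H\<in>?T. signless_moebius M F H) = (\<Sum>H\<in>?T. \<Sum>H'\<in>{H' \<in> ?S. ?g H' = H}. signless_moebius M F H')"
  proof (rule sum.cong)
    fix H assume H: "H \<in> ?T"
    show "signless_moebius M F H = (\<Sum>H'\<in>{H' \<in> ?S. ?g H' = H}. signless_moebius M F H')"
      unfolding fib[OF H] using H by (intro signless_moebius_rec assms) auto
  qed simp
  also have "\<dots> = (\<Sum>H\<in>?S. signless_moebius M F H)"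
    using img by (subst sum.group) auto
  finally show ?thesis .
qed

text \<open>Dividing the characteristic polynomial by \<open>t - 1\<close> amounts to counting only
  flats through a chosen \<open>j\<close>: those avoiding \<open>j\<close> in one rank weigh as much
  as those containing it in the next. The result is independent of \<open>j\<close>, which is the
  source of the linear relations.\<close>

lemma sum_signless_containing:
  assumes "F \<in> flats M" "G \<in> flats M" "F \<subseteq> G" "j \<in> G" "j \<notin> F"
  shows "(\<Sum>H\<in>{H \<in> flats M. F \<subseteq> H \<and> H \<subseteq> G \<and> j \<in> H \<and> rk M H = rk M F + Suc a}. signless_moebius M F H)
    = reduced_whitney M F G a"
proof (induction a)
  case 0
  have "H = F" if "H \<in> flats M" "F \<subseteq> H" "rk M H = rk M F" for H
    using rk_less[OF assms(1) that(1)] that by (auto simp: psubset_eq)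
  then have "{H \<in> flats M. F \<subseteq> H \<and> H \<subseteq> G \<and> j \<notin> H \<and> rk M H = rk M F + 0} = {F}"
    using assms by auto
  then show ?case using signless_moebius_shift[OF assms, of 0] by simp
next
  case (Suc a)
  let ?P = "\<lambda>H. F \<subseteq> H \<and> H \<subseteq> G \<and> rk M H = rk M F + Suc a"
  have "whitney M F G (Suc a) = (\<Sum>H\<in>{H \<in> flats M. ?P H \<and> j \<in> H} \<union> {H \<in> flats M. ?P H \<and> j \<notin> H}. signless_moebius M F H)"
    unfolding whitney_def by (rule sum.cong) auto
  also have "\<dots> = (\<Sum>H\<in>{H \<in> flats M. ?P H \<and> j \<in> H}. signless_moebius M F H)
      + (\<Sum>H\<in>{H \<in> flats M. ?P H \<and> j \<notin> H}. signless_moebius M F H)"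
    by (rule sum.union_disjoint) auto
  also have "{H \<in> flats M. ?P H \<and> j \<in> H} = {H \<in> flats M. F \<subseteq> H \<and> H \<subseteq> G \<and> j \<in> H \<and> rk M H = rk M F + Suc a}"
    by auto
  also have "{H \<in> flats M. ?P H \<and> j \<notin> H} = {H \<in> flats M. F \<subseteq> H \<and> H \<subseteq> G \<and> j \<notin> H \<and> rk M H = rk M F + Suc a}"
    by auto
  finally show ?case using signless_moebius_shift[OF assms, of "Suc a"] Suc.IH by simp
qed

lemma reduced_whitney_top:
  assumes "F \<in> flats M" "G \<in> flats M" "F \<subseteq> G" "rk M G = rk M F + Suc a"
  shows "reduced_whitney M F G a = signless_moebius M F G"
proof -
  have "F \<noteq> G" using assms by auto
  then obtain j where j: "j \<in> G" "j \<notin> F" using assms by blast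
  have "H = G" if "H \<in> flats M" "H \<subseteq> G" "rk M H = rk M G" for H
    using rk_less[OF that(1) assms(2)] that by (auto simp: psubset_eq)
  then have "{H \<in> flats M. F \<subseteq> H \<and> H \<subseteq> G \<and> j \<in> H \<and> rk M H = rk M F + Suc a} = {G}"
    using assms j by auto
  then show ?thesis using sum_signless_containing[OF assms(1-3) j, of a] by simp
qed

lemma sum_signless_between:
  assumes "F \<in> flats M" "G \<in> flats M" "rk M F + Suc a < rk M G"
  shows "(\<Sum>H\<in>{H \<in> flats M. F \<subset> H \<and> H \<subset> G \<and> rk M H = rk M F + Suc a}. signless_moebius M F H)
    = reduced_whitney M F G a + reduced_whitney M F G (Suc a)"
proof -
  have "{H \<in> flats M. F \<subset> H \<and> H \<subset> G \<and> rk M H = rk M F + Suc a}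
      = {H \<in> flats M. F \<subseteq> H \<and> H \<subseteq> G \<and> rk M H = rk M F + Suc a}"
    using assms by auto
  then show ?thesis by (simp add: whitney_def)
qed

lemma sum_signless_between_containing:
  assumes "F \<in> flats M" "G \<in> flats M" "F \<subseteq> G" "j \<in> G" "j \<notin> F" "rk M F + Suc a < rk M G"
  shows "(\<Sum>H\<in>{H \<in> flats M. F \<subset> H \<and> H \<subset> G \<and> j \<in> H \<and> rk M H = rk M F + Suc a}. signless_moebius M F H)
    = reduced_whitney M F G a"
proof -
  have "{H \<in> flats M. F \<subset> H \<and> H \<subset> G \<and> j \<in> H \<and> rk M H = rk M F + Suc a}
      = {H \<in> flats M. F \<subseteq> H \<and> H \<subseteq> G \<and> j \<in> H \<and> rk M H = rk M F + Suc a}"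
    using assms by auto
  then show ?thesis using sum_signless_containing[OF assms(1-5), of a] by simp
qed

text \<open>With exponent 1 the binomial is \<open>0 choose (Suc c - rk M H)\<close>, so only rank
  \<open>Suc c\<close> contributes. There the Whitney factor below \<open>H\<close> is a top
  coefficient, by \<open>reduced_whitney_top\<close>, and the one above \<open>H\<close> has index
  0.\<close>

lemma flag_degree_new:
  assumes "F \<in> flats M" "H \<in> flats M" "F \<subset> H" "rk M F \<le> c"
  shows "flag_degree M F c ((H, 1) # l) =
    (if rk M H = rk M F + Suc (c - rk M F) then signless_moebius M F H * flag_tail M (Suc c) l else 0)"
proof (cases "rk M H = Suc c")
  case True
  have "flag_degree M H (Suc c) l = flag_tail M (Suc c) l"
    using True by (simp add: flag_degree_head_tail)
  then show ?thesis using True assms reduced_whitney_top[of F H "c - rk M F"] by simp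
next
  case False
  then show ?thesis using assms by (auto simp: binomial_eq_0)
qed

text \<open>The lower index of the binomial is at least \<open>e\<close>, hence exceeds
  \<open>e - 1\<close>. This covers the case in which the gap below \<open>G\<close> has no room for
  a flat of rank \<open>Suc c\<close>.\<close>

lemma flag_tail_eq_0:
  assumes "flag_list M F ((G, e) # l)" "rk M G \<le> Suc c"
  shows "flag_tail M (Suc c) ((G, e) # l) = 0"
proof -
  have "e - 1 < Suc c + e - rk M G" using assms by (auto simp: Suc_diff_le)
  then show ?thesis by (simp add: binomial_eq_0)
qed

text \<open>An insertion into the gap below the first flat changes only the leading factor, so the
  sum is governed by \<open>r\<close>, the weighted count of admissible flats of one rank in the
  gap. It serves for all flats and for the flats containing \<open>j\<close>.\<close>

lemma gap_sum:
  assumes "F \<in> flats M" "F \<subset> E" "flag_list M F l" "rk M F \<le> c" "Suc c < rk M E"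
    and Q: "\<And>a. rk M F + Suc a < rk M (flag_head M l) \<Longrightarrow>
       (\<Sum>H\<in>{H \<in> flats M. F \<subset> H \<and> H \<subset> flag_head M l \<and> Q H \<and> rk M H = rk M F + Suc a}. signless_moebius M F H) = r a"
  shows "(\<Sum>H\<in>{H \<in> flats M. F \<subset> H \<and> H \<subset> flag_head M l \<and> Q H}. flag_degree M F c ((H, 1) # l))
    = r (c - rk M F) * flag_tail M (Suc c) l"
proof -
  let ?X = "{H \<in> flats M. F \<subset> H \<and> H \<subset> flag_head M l \<and> Q H}"
  let ?n = "rk M F + Suc (c - rk M F)"
  have "(\<Sum>H\<in>?X. flag_degree M F c ((H, 1) # l))
      = (\<Sum>H\<in>?X. if rk M H = ?n then signless_moebius M F H * flag_tail M (Suc c) l else 0)"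
    using assms flag_degree_new by (intro sum.cong) auto
  also have "\<dots> = (\<Sum>H\<in>{H \<in> ?X. rk M H = ?n}. signless_moebius M F H * flag_tail M (Suc c) l)"
    by (subst sum.inter_filter) auto
  also have "{H \<in> ?X. rk M H = ?n} = {H \<in> flats M. F \<subset> H \<and> H \<subset> flag_head M l \<and> Q H \<and> rk M H = ?n}"
    by auto
  also have "(\<Sum>H\<in>\<dots>. signless_moebius M F H * flag_tail M (Suc c) l)
      = (\<Sum>H\<in>{H \<in> flats M. F \<subset> H \<and> H \<subset> flag_head M l \<and> Q H \<and> rk M H = ?n}. signless_moebius M F H) * flag_tail M (Suc c) l"
    by (simp add: sum_distrib_right)
  also have "\<dots> = r (c - rk M F) * flag_tail M (Suc c) l"
  proof (cases "?n < rk M (flag_head M l)")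
    case True
    then show ?thesis using Q by simp
  next
    case False
    then have "l \<noteq> []" using assms by (auto simp: flag_head_def)
    then obtain G e l' where l: "l = (G, e) # l'" by (metis list.exhaust surj_pair)
    then have "rk M G \<le> Suc c" using False assms by (simp add: flag_head_def)
    then have "flag_tail M (Suc c) l = 0" using flag_tail_eq_0 assms(3) l by blast
    then show ?thesis by simp
  qed
  finally show ?thesis .
qed

section \<open>Sums over all insertions into a flag\<close>

lemma finite_compatible [simp]: "finite (compatible M F l)"
  by (simp add: compatible_def)

lemma compatible_Cons:
  assumes "flag_list M F ((G, e) # l)"
  shows "compatible M F ((G, e) # l) = {H \<in> flats M. F \<subset> H \<and> H \<subset> G} \<union> insert G (compatible M G l)"
    (is "?L = ?A \<union> insert G ?B")
proof (intro equalityI subsetI)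
  fix H assume "H \<in> ?L"
  then show "H \<in> ?A \<union> insert G ?B" by (auto simp: compatible_def)
next
  fix H assume H: "H \<in> ?A \<union> insert G ?B"
  have above: "G \<subset> fst p" if "p \<in> set l" for p using flag_list_above[of M G l p] assms that by simp
  have "F \<subset> G" "G \<subset> E" "G \<in> flats M" using assms by auto
  moreover have "\<forall>p\<in>set l. H \<subseteq> fst p" if "H \<subseteq> G" using above that by blast
  ultimately show "H \<in> ?L" using H unfolding compatible_def by auto
qed

lemma flag_insert_above:
  assumes "G \<subset> H"
  shows "flag_insert H ((G, e) # l) = (G, e) # flag_insert H l"
  using assms by auto

text \<open>The contribution of raising the exponent of the first flat and of inserting above it is
  evaluated by Pascal's rule.\<close>

lemma member_above_sum:
  assumes e: "0 < e"
    and IH: "rk M G \<le> c + e \<Longrightarrow> (\<Sum>H\<in>X. flag_degree M G (c + e) (flag_insert H l))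
        = flag_degree M G (c + e) l + flag_degree M G (Suc (c + e)) l"
    and X: "\<And>H. H \<in> X \<Longrightarrow> G \<subset> H"
  shows "reduced_whitney M F G (c - rk M F) * flag_tail M (Suc c) ((G, e) # l)
      + flag_degree M F c (flag_insert G ((G, e) # l))
      + (\<Sum>H\<in>X. flag_degree M F c (flag_insert H ((G, e) # l)))
      = flag_degree M F c ((G, e) # l)"
proof -
  obtain n where n: "e = Suc n" using e by (cases e) auto
  let ?m = "reduced_whitney M F G (c - rk M F)"
  have S: "(\<Sum>H\<in>X. flag_degree M F c (flag_insert H ((G, e) # l))) =
    ?m * (if rk M G \<le> c + e then (-1) ^ (e - 1) * of_nat ((e - 1) choose (c + e - rk M G)) *
      (\<Sum>H\<in>X. flag_degree M G (c + e) (flag_insert H l)) else 0)"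
  proof -
    have "(\<Sum>H\<in>X. flag_degree M F c (flag_insert H ((G, e) # l))) = (\<Sum>H\<in>X. flag_degree M F c ((G, e) # flag_insert H l))"
      using X flag_insert_above by (intro sum.cong) auto
    then show ?thesis by (simp add: sum_distrib_left)
  qed
  consider "rk M G \<le> c + e" | "rk M G = Suc (c + e)" | "Suc (c + e) < rk M G" by linarith
  then show ?thesis
  proof cases
    case 1
    \<comment> \<open>The three contributions at \<open>Suc (c + e)\<close> carry
      \<open>(e - 1) choose Suc k\<close>, minus \<open>e choose Suc k\<close>, and
      \<open>(e - 1) choose k\<close>, which add up to zero; only the value at \<open>c + e\<close>
      is left.\<close>
    define k where "k = c + e - rk M G"
    have k: "Suc (c + e) - rk M G = Suc k" "Suc c + e - rk M G = Suc k" "c + Suc e - rk M G = Suc k" using 1 by (auto simp: k_def)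
    have k0: "Suc (c + n) - rk M G = k" using n by (simp add: k_def)
    show ?thesis using 1 k k0 unfolding S IH[OF 1]
      by (simp add: n) (simp add: algebra_simps)
  next
    case 2
    then show ?thesis unfolding S by (simp add: n)
  next
    case 3
    then show ?thesis unfolding S by simp
  qed
qed

lemma sum_Un_insert:
  assumes "finite A" "finite B" "x \<notin> A" "x \<notin> B" "A \<inter> B = {}"
  shows "sum f (A \<union> insert x B) = sum f A + (f x + sum f B)"
  using assms by (subst sum.union_disjoint) auto

text \<open>Needed above a flat that already contains \<open>j\<close>: there every flat contains
  \<open>j\<close>, and the restricted sum of the linear relation becomes the full one. The second
  summand comes from the gap below the first flat.\<close>

lemma flag_degree_insert_all:
  assumes "F \<in> flats M" "F \<subset> E" "flag_list M F l" "rk M F \<le> c" "c + sum_list (map snd l) + 2 \<le> rk M E"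
  shows "(\<Sum>H\<in>compatible M F l. flag_degree M F c (flag_insert H l))
    = flag_degree M F c l + flag_degree M F (Suc c) l"
  using assms
proof (induction l arbitrary: F c)
  case Nil
  have X: "compatible M F [] = {H \<in> flats M. F \<subset> H \<and> H \<subset> flag_head M [] \<and> True}"
    by (auto simp: compatible_def flag_head_def)
  show ?case
    unfolding X using gap_sum[of F "[]" c "\<lambda>_. True" "\<lambda>a. reduced_whitney M F E a + reduced_whitney M F E (Suc a)"]
      sum_signless_between[OF Nil(1) E_flat] Nil by (simp add: flag_head_def Suc_diff_le)
next
  case (Cons p l)
  obtain G e where p: "p = (G, e)" by (cases p)
  have G: "G \<in> flats M" "F \<subset> G" "G \<subset> E" "0 < e" "flag_list M G l" using Cons.prems(3) p by auto
  let ?A = "{H \<in> flats M. F \<subset> H \<and> H \<subset> G}"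
  let ?f = "\<lambda>H. flag_degree M F c (flag_insert H ((G, e) # l))"
  have 1: "(\<Sum>H\<in>compatible M F ((G, e) # l). ?f H) = (\<Sum>H\<in>?A. ?f H) + (?f G + (\<Sum>H\<in>compatible M G l. ?f H))"
    unfolding compatible_Cons[OF Cons.prems(3)[unfolded p]]
    by (rule sum_Un_insert) (auto simp: compatible_def)
  have A: "?A = {H \<in> flats M. F \<subset> H \<and> H \<subset> flag_head M ((G, e) # l) \<and> True}"
    by (auto simp: flag_head_def)
  have "(\<Sum>H\<in>?A. ?f H) = (\<Sum>H\<in>?A. flag_degree M F c ((H, 1) # (G, e) # l))"
    by (intro sum.cong) auto
  also have "\<dots> = (reduced_whitney M F G (c - rk M F) + reduced_whitney M F G (Suc (c - rk M F))) * flag_tail M (Suc c) ((G, e) # l)"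
    unfolding A
  proof (rule gap_sum)
    show "(\<Sum>H\<in>{H \<in> flats M. F \<subset> H \<and> H \<subset> flag_head M ((G, e) # l) \<and> True \<and> rk M H = rk M F + Suc a}. signless_moebius M F H)
        = reduced_whitney M F G a + reduced_whitney M F G (Suc a)"
      if "rk M F + Suc a < rk M (flag_head M ((G, e) # l))" for a
      using sum_signless_between[OF Cons.prems(1) G(1), of a] that by (simp add: flag_head_def del: reduced_whitney.simps)
  qed (use Cons.prems p in auto)
  finally have 2: "(\<Sum>H\<in>?A. ?f H) = reduced_whitney M F G (c - rk M F) * flag_tail M (Suc c) ((G, e) # l)
      + flag_degree M F (Suc c) ((G, e) # l)"
    using Cons.prems(4) by (simp add: flag_degree_head_tail[of M F "Suc c"] flag_head_def Suc_diff_le algebra_simps)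
  have 3: "reduced_whitney M F G (c - rk M F) * flag_tail M (Suc c) ((G, e) # l) + ?f G
      + (\<Sum>H\<in>compatible M G l. ?f H) = flag_degree M F c ((G, e) # l)"
  proof (rule member_above_sum[OF G(4)])
    show "(\<Sum>H\<in>compatible M G l. flag_degree M G (c + e) (flag_insert H l)) =
        flag_degree M G (c + e) l + flag_degree M G (Suc (c + e)) l" if "rk M G \<le> c + e"
      using Cons.IH[OF G(1,3,5) that] Cons.prems(5) p by simp
  qed (simp add: compatible_def)
  show ?case unfolding p using 1 2 3 by simp
qed

text \<open>Invariance of Eur's formula under the linear relations, since the right-hand side does
  not mention \<open>j\<close>. Flats of the flag avoiding \<open>j\<close> are passed over, as
  anything inserted at or below them avoids \<open>j\<close> too. At the first flat containing
  \<open>j\<close> the gap beneath it is counted by \<open>gap_sum\<close>, and above it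
  \<open>flag_degree_insert_all\<close> applies.\<close>

lemma flag_degree_insert_containing:
  assumes "F \<in> flats M" "F \<subset> E" "flag_list M F l" "rk M F \<le> c" "c + sum_list (map snd l) + 2 \<le> rk M E"
    and "j \<in> E" "j \<notin> F"
  shows "(\<Sum>H\<in>{H \<in> compatible M F l. j \<in> H}. flag_degree M F c (flag_insert H l)) = flag_degree M F c l"
  using assms
proof (induction l arbitrary: F c)
  case Nil
  have X: "{H \<in> compatible M F []. j \<in> H} = {H \<in> flats M. F \<subset> H \<and> H \<subset> flag_head M [] \<and> j \<in> H}"
    by (auto simp: compatible_def flag_head_def)
  have sub: "F \<subseteq> E" using Nil(2) by auto
  show ?case
    unfolding X using gap_sum[of F "[]" c "\<lambda>H. j \<in> H" "reduced_whitney M F E"]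
      sum_signless_between_containing[OF Nil(1) E_flat sub Nil(6,7)] Nil by (simp add: flag_head_def)
next
  case (Cons p l)
  obtain G e where p: "p = (G, e)" by (cases p)
  have G: "G \<in> flats M" "F \<subset> G" "G \<subset> E" "0 < e" "flag_list M G l" using Cons.prems(3) p by auto
  let ?f = "\<lambda>H. flag_degree M F c (flag_insert H ((G, e) # l))"
  show ?case
  proof (cases "j \<in> G")
    case True
    let ?A = "{H \<in> flats M. F \<subset> H \<and> H \<subset> G \<and> j \<in> H}"
    have sub: "F \<subseteq> G" using G by auto
    have "{H \<in> compatible M F ((G, e) # l). j \<in> H} = ?A \<union> insert G (compatible M G l)"
      using Cons.prems(3) p True by (subst compatible_Cons) (auto simp: compatible_def)
    then have 1: "(\<Sum>H\<in>{H \<in> compatible M F ((G, e) # l). j \<in> H}. ?f H)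
        = (\<Sum>H\<in>?A. ?f H) + (?f G + (\<Sum>H\<in>compatible M G l. ?f H))"
      by (simp only:) (rule sum_Un_insert, auto simp: compatible_def)
    have A: "?A = {H \<in> flats M. F \<subset> H \<and> H \<subset> flag_head M ((G, e) # l) \<and> j \<in> H}"
      by (auto simp: flag_head_def)
    have "(\<Sum>H\<in>?A. ?f H) = (\<Sum>H\<in>?A. flag_degree M F c ((H, 1) # (G, e) # l))"
      by (intro sum.cong) auto
    also have "\<dots> = reduced_whitney M F G (c - rk M F) * flag_tail M (Suc c) ((G, e) # l)"
      unfolding A
    proof (rule gap_sum)
      show "(\<Sum>H\<in>{H \<in> flats M. F \<subset> H \<and> H \<subset> flag_head M ((G, e) # l) \<and> j \<in> H \<and> rk M H = rk M F + Suc a}. signless_moebius M F H)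
          = reduced_whitney M F G a"
        if "rk M F + Suc a < rk M (flag_head M ((G, e) # l))" for a
        using sum_signless_between_containing[OF Cons.prems(1) G(1) sub True Cons.prems(7), of a] that
        by (simp add: flag_head_def del: reduced_whitney.simps)
    qed (use Cons.prems p in auto)
    finally have 2: "(\<Sum>H\<in>?A. ?f H) = reduced_whitney M F G (c - rk M F) * flag_tail M (Suc c) ((G, e) # l)" .
    have 3: "reduced_whitney M F G (c - rk M F) * flag_tail M (Suc c) ((G, e) # l) + ?f G
        + (\<Sum>H\<in>compatible M G l. ?f H) = flag_degree M F c ((G, e) # l)"
    proof (rule member_above_sum[OF G(4)])
      show "(\<Sum>H\<in>compatible M G l. flag_degree M G (c + e) (flag_insert H l)) =
          flag_degree M G (c + e) l + flag_degree M G (Suc (c + e)) l" if "rk M G \<le> c + e"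
        using flag_degree_insert_all[OF G(1,3,5) that] Cons.prems(5) p by simp
    qed (simp add: compatible_def)
    show ?thesis unfolding p using 1 2 3 by simp
  next
    case False
    let ?X = "{H \<in> compatible M G l. j \<in> H}"
    have X: "{H \<in> compatible M F ((G, e) # l). j \<in> H} = ?X"
      using Cons.prems(3) p False by (subst compatible_Cons) (auto simp: compatible_def)
    have "(\<Sum>H\<in>?X. ?f H) = (\<Sum>H\<in>?X. flag_degree M F c ((G, e) # flag_insert H l))"
      using flag_insert_above[of G] by (intro sum.cong) (auto simp: compatible_def)
    also have "\<dots> = reduced_whitney M F G (c - rk M F) *
        (if rk M G \<le> c + e then (-1) ^ (e - 1) * of_nat ((e - 1) choose (c + e - rk M G)) *
          (\<Sum>H\<in>?X. flag_degree M G (c + e) (flag_insert H l)) else 0)"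
      by (simp add: sum_distrib_left)
    also have "\<dots> = flag_degree M F c ((G, e) # l)"
      using Cons.IH[OF G(1,3,5) _ _ Cons.prems(6) False, of "c + e"] Cons.prems(5) p by simp
    finally show ?thesis unfolding p X .
  qed
qed

end

section \<open>Polynomials in set variables\<close>

definition mon_degree :: "('a set \<Rightarrow>\<^sub>0 nat) \<Rightarrow> nat" where
  "mon_degree m = (\<Sum>F\<in>Poly_Mapping.keys m. Poly_Mapping.lookup m F)"

definition mon_subst :: "('a set \<Rightarrow> 'a set_poly) \<Rightarrow> ('a set \<Rightarrow>\<^sub>0 nat) \<Rightarrow> 'a set_poly" where
  "mon_subst s m = (\<Prod>F\<in>Poly_Mapping.keys m. s F ^ Poly_Mapping.lookup m F)"

definition lin_ext :: "(('a set \<Rightarrow>\<^sub>0 nat) \<Rightarrow> rat) \<Rightarrow> 'a set_poly \<Rightarrow> rat" where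
  "lin_ext g p = (\<Sum>m\<in>Poly_Mapping.keys p. Poly_Mapping.lookup p m * g m)"

definition exponents :: "'a set multiset \<Rightarrow> 'a set \<Rightarrow>\<^sub>0 nat" where
  "exponents U = (\<Sum>F\<in>#U. Poly_Mapping.single F 1)"

inductive_set rat_span :: "'a set_poly set \<Rightarrow> 'a set_poly set" for B where
  zero: "0 \<in> rat_span B"
| step: "b \<in> B \<Longrightarrow> p \<in> rat_span B \<Longrightarrow> Const c * b + p \<in> rat_span B"

section \<open>Polynomial calculus: substitution, variables, grading, spans\<close>

lemma poly_sum_single: "p = (\<Sum>m\<in>Poly_Mapping.keys p. Poly_Mapping.single m (Poly_Mapping.lookup p m))"
proof (rule poly_mapping_eqI)
  fix k
  have "Poly_Mapping.lookup (\<Sum>m\<in>Poly_Mapping.keys p. Poly_Mapping.single m (Poly_Mapping.lookup p m)) k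
      = (\<Sum>m\<in>Poly_Mapping.keys p. if m = k then Poly_Mapping.lookup p k else 0)"
    unfolding lookup_sum by (intro sum.cong) (auto simp: lookup_single)
  also have "\<dots> = Poly_Mapping.lookup p k" by (simp add: in_keys_iff)
  finally show "Poly_Mapping.lookup p k
      = Poly_Mapping.lookup (\<Sum>m\<in>Poly_Mapping.keys p. Poly_Mapping.single m (Poly_Mapping.lookup p m)) k" by simp
qed

text \<open>The monomials are restricted to those of the given polynomial while coefficients are
  free, so conditions on its support pass to the single terms.\<close>

lemma poly_add_induct [case_names zero single add]:
  fixes p :: "'a set_poly"
  assumes "P 0" "\<And>m c. m \<in> Poly_Mapping.keys p \<Longrightarrow> P (Poly_Mapping.single m c)" "\<And>p q. P p \<Longrightarrow> P q \<Longrightarrow> P (p + q)"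
  shows "P p"
proof -
  have "P (\<Sum>m\<in>A. Poly_Mapping.single m (Poly_Mapping.lookup p m))" if "A \<subseteq> Poly_Mapping.keys p" for A
    using finite_subset[OF that finite_keys] that by (induction A rule: finite_induct) (auto intro: assms)
  then show ?thesis using poly_sum_single[of p] by (metis order_refl)
qed

lemma Const_0 [simp]: "Const 0 = 0" by (simp add: Const_def)
lemma Const_1 [simp]: "Const 1 = 1" by (simp add: Const_def)
lemma Const_add: "Const (a + b) = Const a + Const b" by (simp add: Const_def single_add)
lemma Const_minus: "Const (- a) = - Const a" by (simp add: Const_def single_uminus)
lemma Const_mult: "Const (a * b) = Const a * Const b" by (simp add: Const_def mult_single)

lemma keys_add_nat:
  fixes m m' :: "'b \<Rightarrow>\<^sub>0 nat"
  shows "Poly_Mapping.keys (m + m') = Poly_Mapping.keys m \<union> Poly_Mapping.keys m'"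
  by (auto simp: in_keys_iff lookup_add)

lemma mon_degree_add: "mon_degree (m + m') = mon_degree m + mon_degree m'"
  unfolding mon_degree_def by (rule setsum_keys_plus_distrib) auto

lemma mon_degree_single [simp]: "mon_degree (Poly_Mapping.single F n) = n"
  by (cases "n = 0") (auto simp: mon_degree_def)

lemma mon_degree_0 [simp]: "mon_degree 0 = 0"
  by (simp add: mon_degree_def)

lemma mon_subst_add: "mon_subst s (m + m') = mon_subst s m * mon_subst s m'"
proof -
  have "mon_subst s m = (\<Prod>F\<in>Poly_Mapping.keys m \<union> Poly_Mapping.keys m'. s F ^ Poly_Mapping.lookup m F)" for m m'
    unfolding mon_subst_def by (intro prod.mono_neutral_left) (auto simp: in_keys_iff)
  from this[of m m'] this[of m' m] show ?thesis
    by (simp add: mon_subst_def[of s "m + m'"] keys_add_nat lookup_add power_add prod.distrib Un_commute)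
qed

lemma mon_subst_0 [simp]: "mon_subst s 0 = 1" by (simp add: mon_subst_def)

lemma mon_subst_single [simp]: "mon_subst s (Poly_Mapping.single F n) = s F ^ n"
  by (cases "n = 0") (auto simp: mon_subst_def)

lemma substitute_eq: "substitute s p = (\<Sum>m\<in>Poly_Mapping.keys p. Const (Poly_Mapping.lookup p m) * mon_subst s m)"
  by (simp add: substitute_def mon_subst_def)

lemma substitute_add: "substitute s (p + q) = substitute s p + substitute s q"
  unfolding substitute_eq by (rule setsum_keys_plus_distrib) (auto simp: Const_add algebra_simps)

lemma substitute_0 [simp]: "substitute s 0 = 0" by (simp add: substitute_eq)

lemma substitute_single [simp]: "substitute s (Poly_Mapping.single m c) = Const c * mon_subst s m"
  by (cases "c = 0") (auto simp: substitute_eq)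

lemma substitute_Const [simp]: "substitute s (Const c) = Const c"
  by (simp add: Const_def[of c])

lemma substitute_1 [simp]: "substitute s 1 = 1"
  using substitute_Const[of s 1] by simp

lemma substitute_Var [simp]: "substitute s (Var F) = s F"
  by (simp add: Var_def)

lemma substitute_mult: "substitute s (p * q) = substitute s p * substitute s q"
proof (induction p rule: poly_add_induct)
  case (single m c)
  show ?case
  proof (induction q rule: poly_add_induct)
    case (single m' c')
    show ?case by (simp add: mult_single mon_subst_add Const_mult mult_ac)
  qed (simp_all add: distrib_left substitute_add)
qed (simp_all add: substitute_add distrib_right)

lemma substitute_minus: "substitute s (- p) = - substitute s p"
  using substitute_add[of s p "- p"] by (simp add: add_eq_0_iff)

lemma substitute_diff: "substitute s (p - q) = substitute s p - substitute s q"
  using substitute_add[of s p "- q"] by (simp add: substitute_minus)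

lemma substitute_sum: "substitute s (\<Sum>x\<in>A. f x) = (\<Sum>x\<in>A. substitute s (f x))"
  by (induction A rule: infinite_finite_induct) (simp_all add: substitute_add)

lemma substitute_prod_mset: "substitute s (\<Prod>x\<in>#U. f x) = (\<Prod>x\<in>#U. substitute s (f x))"
  by (induction U) (simp_all add: substitute_mult)

lemma Const_mult_single: "Const c * Poly_Mapping.single m d = Poly_Mapping.single m (c * d)"
  by (simp add: Const_def mult_single)

lemma mon_subst_Var: "mon_subst Var m = Poly_Mapping.single m 1"
proof -
  have pw: "Var F ^ n = Poly_Mapping.single (Poly_Mapping.single F n) 1" for F :: "'a set" and n
    by (induction n) (simp_all add: Var_def mult_single single_add[symmetric])
  have "(\<Prod>F\<in>A. Var F ^ f F) = Poly_Mapping.single (\<Sum>F\<in>A. Poly_Mapping.single F (f F)) 1"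
    if "finite A" for A :: "'a set set" and f
    using that by (induction A rule: finite_induct) (simp_all add: pw mult_single)
  moreover have "m = (\<Sum>F\<in>Poly_Mapping.keys m. Poly_Mapping.single F (Poly_Mapping.lookup m F))"
  proof (rule poly_mapping_eqI)
    fix k
    have "Poly_Mapping.lookup (\<Sum>F\<in>Poly_Mapping.keys m. Poly_Mapping.single F (Poly_Mapping.lookup m F)) k
      = (\<Sum>F\<in>Poly_Mapping.keys m. if F = k then Poly_Mapping.lookup m k else 0)"
      unfolding lookup_sum by (intro sum.cong) (auto simp: lookup_single)
    also have "\<dots> = Poly_Mapping.lookup m k" by (simp add: in_keys_iff)
    finally show "Poly_Mapping.lookup m k = Poly_Mapping.lookup
        (\<Sum>F\<in>Poly_Mapping.keys m. Poly_Mapping.single F (Poly_Mapping.lookup m F)) k" by simp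
  qed
  ultimately show ?thesis by (simp add: mon_subst_def)
qed

lemma substitute_cong:
  assumes "\<And>F. F \<in> vars p \<Longrightarrow> s F = t F"
  shows "substitute s p = substitute t p"
proof -
  have "s F = t F" if "m \<in> Poly_Mapping.keys p" "F \<in> Poly_Mapping.keys m" for m F
    using assms that by (auto simp: vars_def)
  then show ?thesis
    unfolding substitute_def by (intro sum.cong prod.cong arg_cong2[where f = "(*)"] refl) auto
qed

lemma substitute_Var_id: "substitute Var p = p"
  by (induction p rule: poly_add_induct) (simp_all add: substitute_add mon_subst_Var Const_mult_single)

lemma vars_0 [simp]: "vars 0 = {}" by (simp add: vars_def)
lemma vars_Const [simp]: "vars (Const c) = {}" by (auto simp: vars_def Const_def)
lemma vars_1 [simp]: "vars 1 = {}" using vars_Const[of 1] by simp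
lemma vars_Var [simp]: "vars (Var F) = {F}" by (auto simp: vars_def Var_def)

lemma vars_add: "vars (p + q) \<subseteq> vars p \<union> vars q"
  unfolding vars_def using keys_add[of p q] by blast

lemma keys_uminus_poly: "Poly_Mapping.keys (- p :: 'a set_poly) = Poly_Mapping.keys p"
  by (auto simp: in_keys_iff)

lemma vars_minus [simp]: "vars (- p) = vars p"
  by (simp add: vars_def keys_uminus_poly)

lemma vars_diff: "vars (p - q) \<subseteq> vars p \<union> vars q"
  using vars_add[of p "- q"] by simp

lemma vars_mult: "vars (p * q) \<subseteq> vars p \<union> vars q"
proof
  fix F assume "F \<in> vars (p * q)"
  then obtain m where "m \<in> Poly_Mapping.keys (p * q)" "F \<in> Poly_Mapping.keys m" by (auto simp: vars_def)
  then obtain a b where "a \<in> Poly_Mapping.keys p" "b \<in> Poly_Mapping.keys q" "F \<in> Poly_Mapping.keys (a + b)"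
    using keys_mult[of p q] by blast
  then show "F \<in> vars p \<union> vars q" unfolding keys_add_nat by (auto simp: vars_def)
qed

lemma vars_sum: "(\<And>x. x \<in> A \<Longrightarrow> vars (f x) \<subseteq> X) \<Longrightarrow> vars (\<Sum>x\<in>A. f x) \<subseteq> X"
  by (induction A rule: infinite_finite_induct) (auto dest!: subsetD[OF vars_add])

lemma vars_prod: "(\<And>x. x \<in> A \<Longrightarrow> vars (f x) \<subseteq> X) \<Longrightarrow> vars (\<Prod>x\<in>A. f x) \<subseteq> X"
  by (induction A rule: infinite_finite_induct) (auto dest!: subsetD[OF vars_mult])

lemma vars_power: "vars p \<subseteq> X \<Longrightarrow> vars (p ^ n) \<subseteq> X"
  by (induction n) (auto dest!: subsetD[OF vars_mult])

lemma vars_substitute: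
  assumes "\<And>F. F \<in> vars p \<Longrightarrow> vars (s F) \<subseteq> X"
  shows "vars (substitute s p) \<subseteq> X"
  unfolding substitute_def
proof (rule vars_sum)
  fix m assume m: "m \<in> Poly_Mapping.keys p"
  have "vars (\<Prod>F\<in>Poly_Mapping.keys m. s F ^ Poly_Mapping.lookup m F) \<subseteq> X"
    using assms m by (intro vars_prod vars_power) (auto simp: vars_def)
  then show "vars (Const (Poly_Mapping.lookup p m) * (\<Prod>F\<in>Poly_Mapping.keys m. s F ^ Poly_Mapping.lookup m F)) \<subseteq> X"
    using vars_mult by fastforce
qed

lemma homogeneous_iff: "homogeneous k p \<longleftrightarrow> (\<forall>m\<in>Poly_Mapping.keys p. mon_degree m = k)"
  by (simp add: homogeneous_def mon_degree_def)

lemma homogeneous_0 [simp]: "homogeneous k 0" by (simp add: homogeneous_iff)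
lemma homogeneous_single: "homogeneous (mon_degree m) (Poly_Mapping.single m c)"
  by (simp add: homogeneous_iff)
lemma homogeneous_Const [simp]: "homogeneous 0 (Const c)"
  using homogeneous_single[of 0 c] by (simp add: Const_def)
lemma homogeneous_1 [simp]: "homogeneous 0 1" using homogeneous_Const[of 1] by simp
lemma homogeneous_Var [simp]: "homogeneous 1 (Var F)"
  using homogeneous_single[of "Poly_Mapping.single F 1" 1] by (simp add: Var_def)
lemma homogeneous_add: "homogeneous k p \<Longrightarrow> homogeneous k q \<Longrightarrow> homogeneous k (p + q)"
  unfolding homogeneous_iff using keys_add[of p q] by blast
lemma homogeneous_minus: "homogeneous k p \<Longrightarrow> homogeneous k (- p)"
  by (simp add: homogeneous_iff keys_uminus_poly)
lemma homogeneous_diff: "homogeneous k p \<Longrightarrow> homogeneous k q \<Longrightarrow> homogeneous k (p - q)"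
  using homogeneous_add[of k p "- q"] homogeneous_minus[of k q] by simp
lemma homogeneous_mult:
  assumes "homogeneous k p" "homogeneous l q"
  shows "homogeneous (k + l) (p * q)"
  unfolding homogeneous_iff
proof
  fix m assume "m \<in> Poly_Mapping.keys (p * q)"
  then obtain a b where "m = a + b" "a \<in> Poly_Mapping.keys p" "b \<in> Poly_Mapping.keys q"
    using keys_mult[of p q] by blast
  then show "mon_degree m = k + l" using assms by (simp add: mon_degree_add homogeneous_iff)
qed
lemma homogeneous_Const_mult: "homogeneous k p \<Longrightarrow> homogeneous k (Const c * p)"
  using homogeneous_mult[of 0 "Const c" k p] by simp
lemma homogeneous_sum: "(\<And>x. x \<in> A \<Longrightarrow> homogeneous k (f x)) \<Longrightarrow> homogeneous k (\<Sum>x\<in>A. f x)"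
  by (induction A rule: infinite_finite_induct) (auto intro: homogeneous_add)
lemma homogeneous_prod_mset:
  "(\<And>x. x \<in># U \<Longrightarrow> homogeneous 1 (f x)) \<Longrightarrow> homogeneous (size U) (\<Prod>x\<in>#U. f x)"
proof (induction U)
  case (add x U)
  then have "homogeneous (1 + size U) (f x * (\<Prod>x\<in>#U. f x))" by (intro homogeneous_mult) auto
  then show ?case by simp
qed simp
lemma homogeneous_power: "homogeneous k p \<Longrightarrow> homogeneous (n * k) (p ^ n)"
  by (induction n) (auto intro: homogeneous_mult)

lemma homogeneous_mon_subst:
  assumes "\<And>F. F \<in> Poly_Mapping.keys m \<Longrightarrow> homogeneous 1 (s F)"
  shows "homogeneous (mon_degree m) (mon_subst s m)"
proof -
  have "homogeneous (\<Sum>F\<in>A. f F) (\<Prod>F\<in>A. s F ^ f F)" if "finite A" "\<And>F. F \<in> A \<Longrightarrow> homogeneous 1 (s F)" for A and f :: "'a set \<Rightarrow> nat"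
    using that
  proof (induction A rule: finite_induct)
    case (insert F A)
    then show ?case using homogeneous_mult[OF homogeneous_power[of 1 "s F" "f F"]] by simp
  qed simp
  then show ?thesis using assms by (simp add: mon_degree_def mon_subst_def)
qed

lemma homogeneous_substitute:
  assumes "\<And>F. F \<in> vars p \<Longrightarrow> homogeneous 1 (s F)" "homogeneous k p"
  shows "homogeneous k (substitute s p)"
  unfolding substitute_eq
proof (rule homogeneous_sum)
  fix m assume m: "m \<in> Poly_Mapping.keys p"
  then have "homogeneous (mon_degree m) (mon_subst s m)"
    using assms(1) by (intro homogeneous_mon_subst) (auto simp: vars_def)
  moreover have "mon_degree m = k" using assms(2) m by (simp add: homogeneous_iff)
  ultimately show "homogeneous k (Const (Poly_Mapping.lookup p m) * mon_subst s m)"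
    by (simp add: homogeneous_Const_mult)
qed

lemma homogeneous_decomposition:
  fixes p :: "'a set_poly"
  obtains n f where "p = (\<Sum>k\<le>n. f k)" "\<And>k. homogeneous k (f k)" "\<And>k. vars (f k) \<subseteq> vars p"
proof -
  define f where "f k = (\<Sum>m\<in>{m \<in> Poly_Mapping.keys p. mon_degree m = k}. Poly_Mapping.single m (Poly_Mapping.lookup p m))" for k
  obtain n where n: "\<forall>m\<in>Poly_Mapping.keys p. mon_degree m \<le> n"
    using finite_nat_set_iff_bounded_le[of "mon_degree ` Poly_Mapping.keys p"] by auto
  have "(\<Sum>k\<le>n. f k) = (\<Sum>m\<in>Poly_Mapping.keys p. Poly_Mapping.single m (Poly_Mapping.lookup p m))"
    unfolding f_def using n by (intro sum.group) auto
  then have "p = (\<Sum>k\<le>n. f k)" using poly_sum_single[of p] by simp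
  moreover have "homogeneous k (f k)" for k
    unfolding f_def using homogeneous_single by (intro homogeneous_sum) auto
  moreover have "vars (f k) \<subseteq> vars p" for k
    unfolding f_def by (rule vars_sum) (auto simp: vars_def)
  ultimately show ?thesis using that by blast
qed

lemma lin_ext_add: "lin_ext g (p + q) = lin_ext g p + lin_ext g q"
  unfolding lin_ext_def by (rule setsum_keys_plus_distrib) (auto simp: algebra_simps)
lemma lin_ext_0 [simp]: "lin_ext g 0 = 0" by (simp add: lin_ext_def)
lemma lin_ext_single [simp]: "lin_ext g (Poly_Mapping.single m c) = c * g m"
  by (cases "c = 0") (auto simp: lin_ext_def)
lemma lin_ext_minus: "lin_ext g (- p) = - lin_ext g p"
  using lin_ext_add[of g p "- p"] by simp
lemma lin_ext_diff: "lin_ext g (p - q) = lin_ext g p - lin_ext g q"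
  using lin_ext_add[of g p "- q"] by (simp add: lin_ext_minus)
lemma lin_ext_sum: "lin_ext g (\<Sum>x\<in>A. f x) = (\<Sum>x\<in>A. lin_ext g (f x))"
  by (induction A rule: infinite_finite_induct) (simp_all add: lin_ext_add)
lemma lin_ext_Const_mult: "lin_ext g (Const c * p) = c * lin_ext g p"
  by (induction p rule: poly_add_induct) (simp_all add: lin_ext_add distrib_left Const_mult_single)

lemma exponents_empty [simp]: "exponents {#} = 0" by (simp add: exponents_def)
lemma exponents_add: "exponents (add_mset F U) = Poly_Mapping.single F 1 + exponents U"
  by (simp add: exponents_def)

lemma prod_Var_mset: "(\<Prod>F\<in>#U. Var F) = Poly_Mapping.single (exponents U) 1"
  by (induction U) (simp_all add: exponents_add Var_def mult_single)

lemma lookup_exponents: "Poly_Mapping.lookup (exponents U) F = count U F"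
  by (induction U) (simp_all add: exponents_add lookup_add lookup_single)

lemma keys_exponents: "Poly_Mapping.keys (exponents U) = set_mset U"
  by (auto simp: in_keys_iff lookup_exponents)

lemma mon_degree_exponents: "mon_degree (exponents U) = size U"
  by (induction U) (simp_all add: exponents_add mon_degree_add)

lemma exponents_surj: "\<exists>U. m = exponents U"
proof
  show "m = exponents (Abs_multiset (Poly_Mapping.lookup m))"
  proof (rule poly_mapping_eqI)
    fix k
    have "finite {x. 0 < Poly_Mapping.lookup m x}" using finite_keys[of m] by (simp add: keys.rep_eq)
    then show "Poly_Mapping.lookup m k = Poly_Mapping.lookup (exponents (Abs_multiset (Poly_Mapping.lookup m))) k"
      by (simp add: lookup_exponents Abs_multiset_inverse)
  qed
qed

lemma rat_span_add: "p \<in> rat_span B \<Longrightarrow> q \<in> rat_span B \<Longrightarrow> p + q \<in> rat_span B"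
  by (induction rule: rat_span.induct) (auto simp: add.assoc intro: rat_span.step)

lemma rat_span_base: "b \<in> B \<Longrightarrow> b \<in> rat_span B"
  using rat_span.step[OF _ rat_span.zero, of b B 1] by simp

lemma rat_span_Const_mult: "p \<in> rat_span B \<Longrightarrow> Const c * p \<in> rat_span B"
proof (induction rule: rat_span.induct)
  case (step b p c')
  then have "Const (c * c') * b + Const c * p \<in> rat_span B" by (intro rat_span.step)
  then show ?case by (simp add: Const_mult algebra_simps)
qed (simp add: rat_span.zero)

lemma rat_span_sum: "(\<And>x. x \<in> A \<Longrightarrow> f x \<in> rat_span B) \<Longrightarrow> (\<Sum>x\<in>A. f x) \<in> rat_span B"
  by (induction A rule: infinite_finite_induct) (auto intro: rat_span.zero rat_span_add)

lemma rat_span_mono: "B \<subseteq> C \<Longrightarrow> rat_span B \<subseteq> rat_span C"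
proof
  fix p assume "B \<subseteq> C" "p \<in> rat_span B"
  from this(2,1) show "p \<in> rat_span C" by (induction rule: rat_span.induct) (auto intro: rat_span.intros)
qed

lemma rat_span_mult:
  assumes "p \<in> rat_span B" "q \<in> rat_span C" "\<And>b c. b \<in> B \<Longrightarrow> c \<in> C \<Longrightarrow> b * c \<in> rat_span D"
  shows "p * q \<in> rat_span D"
  using assms(1)
proof (induction rule: rat_span.induct)
  case (step b p c)
  have "b * q \<in> rat_span D" using assms(2)
  proof (induction rule: rat_span.induct)
    case (step b' q' c')
    have "Const c' * (b * b') + b * q' \<in> rat_span D"
      using assms(3) \<open>b \<in> B\<close> step by (intro rat_span_add rat_span_Const_mult) auto
    then show ?case by (simp add: algebra_simps)
  qed (simp add: rat_span.zero)
  then have "Const c * (b * q) + p * q \<in> rat_span D" using step.IH by (intro rat_span_add rat_span_Const_mult)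
  then show ?case by (simp add: algebra_simps)
qed (simp add: rat_span.zero)

lemma homogeneous_in_span:
  assumes "vars p \<subseteq> X" "homogeneous k p"
  shows "p \<in> rat_span {\<Prod>F\<in>#U. Var F | U. set_mset U \<subseteq> X \<and> size U = k}" (is "p \<in> rat_span ?B")
proof -
  have "Poly_Mapping.single m c \<in> rat_span ?B" if m: "m \<in> Poly_Mapping.keys p" for m c
  proof -
    obtain U where U: "m = exponents U" using exponents_surj by blast
    have "(\<Prod>F\<in>#U. Var F) \<in> ?B"
      using assms m U keys_exponents[of U] mon_degree_exponents[of U]
      by (auto simp: vars_def homogeneous_iff intro!: exI[of _ U])
    then have "Const c * (\<Prod>F\<in>#U. Var F) \<in> rat_span ?B" by (intro rat_span_Const_mult rat_span_base)
    then show ?thesis by (simp add: prod_Var_mset U Const_mult_single)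
  qed
  then show ?thesis
    by (rule poly_add_induct[where P = "\<lambda>q. q \<in> rat_span ?B" and p = p, rotated]) (auto intro: rat_span.zero rat_span_add)
qed

lemma set_poly_induct [consumes 1, case_names Const add Var]:
  fixes p :: "'a set_poly"
  assumes "vars p \<subseteq> X" "\<And>c. P (Const c)" "\<And>p q. vars p \<subseteq> X \<Longrightarrow> vars q \<subseteq> X \<Longrightarrow> P p \<Longrightarrow> P q \<Longrightarrow> P (p + q)"
    "\<And>F p. F \<in> X \<Longrightarrow> vars p \<subseteq> X \<Longrightarrow> P p \<Longrightarrow> P (Var F * p)"
  shows "P p"
proof -
  have sing: "vars (Poly_Mapping.single m c) \<subseteq> X \<and> P (Poly_Mapping.single m c)" if "m \<in> Poly_Mapping.keys p" for m c
  proof -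
    obtain U where U: "m = exponents U" using exponents_surj by blast
    have "set_mset U \<subseteq> X" using assms(1) that U keys_exponents[of U] by (auto simp: vars_def)
    then have "vars (Poly_Mapping.single (exponents U) c) \<subseteq> X \<and> P (Poly_Mapping.single (exponents U) c)"
    proof (induction U)
      case empty
      show ?case using assms(2)[of c] vars_Const[where 'a = 'a, of c] by (simp add: Const_def)
    next
      case (add F U)
      have "Poly_Mapping.single (exponents (add_mset F U)) c = Var F * Poly_Mapping.single (exponents U) c"
        by (simp add: Var_def mult_single exponents_add)
      then show ?case using add assms(4)[of F] vars_mult[of "Var F" "Poly_Mapping.single (exponents U) c"] by auto
    qed
    then show ?thesis using U by simp
  qed
  have "vars p \<subseteq> X \<and> P p"
  proof (induction p rule: poly_add_induct)
    case zero
    show ?case using assms(2)[of 0] by simp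
  next
    case (add p q)
    then show ?case using assms(3)[of p q] vars_add[of p q] by auto
  qed (use sing in auto)
  then show ?thesis ..
qed

section \<open>The Chow ideal and the degree functional\<close>

lemma carrier_S_ring: "p \<in> carrier (S_ring M) \<longleftrightarrow> vars p \<subseteq> nonempty_proper_flats M"
  by (simp add: S_ring_def)

lemma S_ring_simps [simp]:
  "(\<otimes>\<^bsub>S_ring M\<^esub>) = (*)" "one (S_ring M) = 1" "zero (S_ring M) = 0" "add (S_ring M) = (+)"
  by (simp_all add: S_ring_def)

lemma carrier_S_ring_intros:
  "0 \<in> carrier (S_ring M)" "1 \<in> carrier (S_ring M)" "Const c \<in> carrier (S_ring M)"
  "p \<in> carrier (S_ring M) \<Longrightarrow> q \<in> carrier (S_ring M) \<Longrightarrow> p + q \<in> carrier (S_ring M)"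
  "p \<in> carrier (S_ring M) \<Longrightarrow> q \<in> carrier (S_ring M) \<Longrightarrow> p - q \<in> carrier (S_ring M)"
  "p \<in> carrier (S_ring M) \<Longrightarrow> q \<in> carrier (S_ring M) \<Longrightarrow> p * q \<in> carrier (S_ring M)"
  "p \<in> carrier (S_ring M) \<Longrightarrow> - p \<in> carrier (S_ring M)"
  "x_poly M F \<in> carrier (S_ring M)"
  using vars_add[of p q] vars_diff[of p q] vars_mult[of p q]
  by (auto simp: carrier_S_ring x_poly_def)

lemma cring_S_ring: "cring (S_ring M)"
proof (intro cringI abelian_groupI comm_monoidI)
  fix p assume "p \<in> carrier (S_ring M)"
  then show "\<exists>q\<in>carrier (S_ring M). q \<oplus>\<^bsub>S_ring M\<^esub> p = \<zero>\<^bsub>S_ring M\<^esub>"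
    by (intro bexI[of _ "- p"]) (auto intro: carrier_S_ring_intros)
qed (auto intro: carrier_S_ring_intros simp: algebra_simps)

lemma S_ring_a_inv: "p \<in> carrier (S_ring M) \<Longrightarrow> \<ominus>\<^bsub>S_ring M\<^esub> p = - p"
proof -
  interpret cring "S_ring M" by (rule cring_S_ring)
  assume "p \<in> carrier (S_ring M)"
  then show ?thesis by (intro minus_equality) (auto intro: carrier_S_ring_intros)
qed

lemma I_gens_carrier: "I_gens M \<subseteq> carrier (S_ring M)"
  unfolding I_gens_def by (auto simp: carrier_S_ring dest!: subsetD[OF vars_diff] subsetD[OF vars_sum, rotated])

lemma J_gens_carrier: "J_gens M \<subseteq> carrier (S_ring M)"
  unfolding J_gens_def by (auto simp: carrier_S_ring dest!: subsetD[OF vars_mult])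

lemma ideal_CH_ideal: "ideal (CH_ideal M) (S_ring M)"
proof -
  interpret cring "S_ring M" by (rule cring_S_ring)
  show ?thesis unfolding CH_ideal_def
    by (intro add_ideals genideal_ideal I_gens_carrier J_gens_carrier)
qed

lemma CH_ideal_least:
  assumes "ideal X (S_ring M)" "I_gens M \<subseteq> X" "J_gens M \<subseteq> X"
  shows "CH_ideal M \<subseteq> X"
proof -
  interpret cring "S_ring M" by (rule cring_S_ring)

  have sub: "Idl\<^bsub>S_ring M\<^esub> (I_gens M) \<subseteq> X" "Idl\<^bsub>S_ring M\<^esub> (J_gens M) \<subseteq> X"
    by (rule genideal_minimal[OF assms(1,2)], rule genideal_minimal[OF assms(1,3)])
  show ?thesis
  proof
    fix p assume "p \<in> CH_ideal M"
    then obtain h k where "h \<in> Idl\<^bsub>S_ring M\<^esub> (I_gens M)" "k \<in> Idl\<^bsub>S_ring M\<^esub> (J_gens M)" "p = h + k"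
      by (auto simp: CH_ideal_def set_add_def set_mult_def)
    then show "p \<in> X" using sub additive_subgroup.a_closed[OF ideal.axioms(1)[OF assms(1)], of h k] by auto
  qed
qed

lemma gens_CH_ideal: "I_gens M \<subseteq> CH_ideal M" "J_gens M \<subseteq> CH_ideal M"
proof -
  interpret cring "S_ring M" by (rule cring_S_ring)
  have I: "I_gens M \<subseteq> Idl\<^bsub>S_ring M\<^esub> (I_gens M)" "0 \<in> Idl\<^bsub>S_ring M\<^esub> (I_gens M)"
    using genideal_self[OF I_gens_carrier] additive_subgroup.zero_closed[OF ideal.axioms(1)[OF genideal_ideal[OF I_gens_carrier]]] by auto
  have J: "J_gens M \<subseteq> Idl\<^bsub>S_ring M\<^esub> (J_gens M)" "0 \<in> Idl\<^bsub>S_ring M\<^esub> (J_gens M)"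
    using genideal_self[OF J_gens_carrier] additive_subgroup.zero_closed[OF ideal.axioms(1)[OF genideal_ideal[OF J_gens_carrier]]] by auto
  show "I_gens M \<subseteq> CH_ideal M"
  proof
    fix p assume "p \<in> I_gens M"
    then have "\<exists>h\<in>Idl\<^bsub>S_ring M\<^esub> (I_gens M). \<exists>k\<in>Idl\<^bsub>S_ring M\<^esub> (J_gens M). p = h + k"
      using I J by (intro bexI[of _ p] bexI[of _ 0]) auto
    then show "p \<in> CH_ideal M" by (auto simp: CH_ideal_def set_add_def set_mult_def)
  qed
  show "J_gens M \<subseteq> CH_ideal M"
  proof
    fix p assume "p \<in> J_gens M"
    then have "\<exists>h\<in>Idl\<^bsub>S_ring M\<^esub> (I_gens M). \<exists>k\<in>Idl\<^bsub>S_ring M\<^esub> (J_gens M). p = h + k"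
      using I J by (intro bexI[of _ 0] bexI[of _ p]) auto
    then show "p \<in> CH_ideal M" by (auto simp: CH_ideal_def set_add_def set_mult_def)
  qed
qed

lemma CH_ideal_closed:
  "p \<in> CH_ideal M \<Longrightarrow> p \<in> carrier (S_ring M)"
  "0 \<in> CH_ideal M"
  "p \<in> CH_ideal M \<Longrightarrow> q \<in> CH_ideal M \<Longrightarrow> p + q \<in> CH_ideal M"
  "p \<in> CH_ideal M \<Longrightarrow> q \<in> carrier (S_ring M) \<Longrightarrow> q * p \<in> CH_ideal M"
proof -
  interpret ideal "CH_ideal M" "S_ring M" by (rule ideal_CH_ideal)
  show "p \<in> CH_ideal M \<Longrightarrow> p \<in> carrier (S_ring M)" by (rule a_Hcarr)
  show "0 \<in> CH_ideal M" using additive_subgroup.zero_closed[OF ideal.axioms(1)[OF ideal_CH_ideal]] by simp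
  show "p \<in> CH_ideal M \<Longrightarrow> q \<in> CH_ideal M \<Longrightarrow> p + q \<in> CH_ideal M"
    using additive_subgroup.a_closed[OF ideal.axioms(1)[OF ideal_CH_ideal], of p M q] by simp
  show "p \<in> CH_ideal M \<Longrightarrow> q \<in> carrier (S_ring M) \<Longrightarrow> q * p \<in> CH_ideal M" using I_l_closed by simp
qed

lemma ideal_S_ringI:
  assumes "X \<subseteq> carrier (S_ring M)" "0 \<in> X" "\<And>p q. p \<in> X \<Longrightarrow> q \<in> X \<Longrightarrow> p + q \<in> X"
    "\<And>p q. p \<in> X \<Longrightarrow> q \<in> carrier (S_ring M) \<Longrightarrow> q * p \<in> X"
  shows "ideal X (S_ring M)"
proof -
  interpret cring "S_ring M" by (rule cring_S_ring)
  show ?thesis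
  proof (rule idealI)
    show "ring (S_ring M)" by (rule ring_axioms)
    show "subgroup X (add_monoid (S_ring M))"
    proof (rule add.subgroupI)
      show "\<ominus>\<^bsub>S_ring M\<^esub> p \<in> X" if "p \<in> X" for p
        using assms(1) assms(4)[OF that, of "- 1"] that by (auto simp: S_ring_a_inv carrier_S_ring)
    qed (use assms in auto)
  qed (use assms in \<open>auto simp: mult.commute\<close>)
qed

text \<open>The kernel of the map from the polynomial ring in all sets to the Chow ring that kills the
  variables whose label is not a nonempty proper flat; working with it avoids carrier conditions.\<close>

definition chow_null :: "'a matroid \<Rightarrow> 'a set_poly set" where
  "chow_null M = {p. substitute (x_poly M) p \<in> CH_ideal M}"

lemma retract_carrier: "substitute (x_poly M) p \<in> carrier (S_ring M)"
  unfolding carrier_S_ring by (rule vars_substitute) (simp add: x_poly_def)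

lemma retract_id: "p \<in> carrier (S_ring M) \<Longrightarrow> substitute (x_poly M) p = p"
proof -
  assume "p \<in> carrier (S_ring M)"
  then have "x_poly M F = Var F" if "F \<in> vars p" for F using that by (auto simp: carrier_S_ring x_poly_def)
  then show ?thesis using substitute_cong[of p "x_poly M" Var] substitute_Var_id[of p] by simp
qed

lemma chow_null_carrier: "p \<in> carrier (S_ring M) \<Longrightarrow> p \<in> chow_null M \<longleftrightarrow> p \<in> CH_ideal M"
  by (simp add: chow_null_def retract_id)

lemma chow_null_0 [simp]: "0 \<in> chow_null M"
  by (simp add: chow_null_def CH_ideal_closed)

lemma chow_null_add: "p \<in> chow_null M \<Longrightarrow> q \<in> chow_null M \<Longrightarrow> p + q \<in> chow_null M"
  by (simp add: chow_null_def CH_ideal_closed substitute_add)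

lemma chow_null_mult: "p \<in> chow_null M \<Longrightarrow> q * p \<in> chow_null M"
  by (simp add: chow_null_def CH_ideal_closed substitute_mult retract_carrier)

lemma chow_null_mult2: "p \<in> chow_null M \<Longrightarrow> p * q \<in> chow_null M"
  using chow_null_mult[of p M q] by (simp add: mult.commute)

lemma chow_null_minus: "p \<in> chow_null M \<Longrightarrow> - p \<in> chow_null M"
  using chow_null_mult[of p M "- 1"] by simp

lemma chow_null_diff: "p \<in> chow_null M \<Longrightarrow> q \<in> chow_null M \<Longrightarrow> p - q \<in> chow_null M"
  using chow_null_add[of p M "- q"] chow_null_minus[of q M] by simp

lemma chow_null_sum: "(\<And>x. x \<in> A \<Longrightarrow> f x \<in> chow_null M) \<Longrightarrow> (\<Sum>x\<in>A. f x) \<in> chow_null M"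
  by (induction A rule: infinite_finite_induct) (auto intro: chow_null_add)

lemma chow_null_diff_iff: "p - q \<in> chow_null M \<Longrightarrow> p \<in> chow_null M \<longleftrightarrow> q \<in> chow_null M"
  using chow_null_diff[of p M "p - q"] chow_null_add[of "p - q" M q] by auto

lemma Var_null: "F \<notin> nonempty_proper_flats M \<Longrightarrow> Var F \<in> chow_null M"
  by (simp add: chow_null_def x_poly_def CH_ideal_closed)

lemma Var_x_poly_null: "Var F - x_poly M F \<in> chow_null M"
  using Var_null[of F M] by (auto simp: x_poly_def)

lemma incomparable_null:
  assumes "\<not> F \<subseteq> G" "\<not> G \<subseteq> F"
  shows "Var F * Var G \<in> chow_null M"
proof (cases "F \<in> nonempty_proper_flats M \<and> G \<in> nonempty_proper_flats M")
  case True
  then have "Var F * Var G \<in> J_gens M" using assms by (auto simp: J_gens_def)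
  then show ?thesis using gens_CH_ideal(2) J_gens_carrier chow_null_carrier by blast
next
  case False
  then show ?thesis using Var_null chow_null_mult chow_null_mult2 by blast
qed

lemma linear_null:
  assumes "i \<in> ground M" "j \<in> ground M"
  shows "(\<Sum>F\<in>{F \<in> nonempty_proper_flats M. i \<in> F}. Var F) -
      (\<Sum>F\<in>{F \<in> nonempty_proper_flats M. j \<in> F}. Var F) \<in> chow_null M"
proof (cases "i = j")
  case False
  then have "(\<Sum>F\<in>{F \<in> nonempty_proper_flats M. i \<in> F}. Var F) -
      (\<Sum>F\<in>{F \<in> nonempty_proper_flats M. j \<in> F}. Var F) \<in> I_gens M" using assms by (auto simp: I_gens_def)
  then show ?thesis using gens_CH_ideal(1) I_gens_carrier chow_null_carrier by blast
qed simp

section \<open>Flag monomials and their degree\<close>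

definition list_exponents :: "('a set \<times> nat) list \<Rightarrow> 'a set \<Rightarrow>\<^sub>0 nat" where
  "list_exponents l = (\<Sum>p\<leftarrow>l. Poly_Mapping.single (fst p) (snd p))"

text \<open>The definite description is legitimate by \<open>flag_list_unique\<close>. The degree
  condition is written with \<open>Suc\<close> to keep truncated subtraction out.\<close>

definition degree_coeff :: "'a matroid \<Rightarrow> ('a set \<Rightarrow>\<^sub>0 nat) \<Rightarrow> rat" where
  "degree_coeff M m =
     (if (\<exists>l. flag_list M {} l \<and> m = list_exponents l) \<and> Suc (mon_degree m) = rk M (ground M)
      then flag_degree M {} 0 (THE l. flag_list M {} l \<and> m = list_exponents l) else 0)"

definition chow_degree :: "'a matroid \<Rightarrow> 'a set_poly \<Rightarrow> rat" where
  "chow_degree M = lin_ext (degree_coeff M)"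

text \<open>Giving the ground set a variable turns each linear relation into a single vanishing sum
  over all flats through \<open>j\<close>; see \<open>chow_var_linear\<close>. Modulo the ideal the
  chosen \<open>j\<close> does not matter.\<close>

definition chow_var :: "'a matroid \<Rightarrow> 'a set \<Rightarrow> 'a set_poly" where
  "chow_var M F =
     (if F = ground M
      then - (\<Sum>G\<in>{G \<in> nonempty_proper_flats M. (SOME j. j \<in> ground M) \<in> G}. Var G)
      else Var F)"

lemma list_exponents_simps [simp]:
  "list_exponents [] = 0"
  "list_exponents (p # l) = Poly_Mapping.single (fst p) (snd p) + list_exponents l"
  by (simp_all add: list_exponents_def)

lemma mon_degree_list_exponents: "mon_degree (list_exponents l) = sum_list (map snd l)"
  by (induction l) (simp_all add: mon_degree_add)

lemma keys_list_exponents: "flag_list M F l \<Longrightarrow> Poly_Mapping.keys (list_exponents l) = fst ` set l"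
  by (induction M F l rule: flag_list.induct) (auto simp: keys_add_nat)

lemma list_exponents_flag_insert: "list_exponents (flag_insert H l) = list_exponents l + Poly_Mapping.single H 1"
proof (induction H l rule: flag_insert.induct)
  case (2 H G e l)
  have "Poly_Mapping.single G (Suc e) = Poly_Mapping.single G e + Poly_Mapping.single G 1"
    using single_add[of G e 1] by simp
  then show ?case using 2 by (auto simp: ac_simps)
qed simp

lemma flag_list_unique:
  "flag_list M F l \<Longrightarrow> flag_list M F l' \<Longrightarrow> list_exponents l = list_exponents l' \<Longrightarrow> l = l'"
proof (induction l arbitrary: F l')
  case Nil
  then have "fst ` set l' = {}" using keys_list_exponents[of M F l'] by simp
  then show ?case by simp
next
  case (Cons p l)
  obtain G e where p: "p = (G, e)" by (cases p)
  have keys: "fst ` set (p # l) = fst ` set l'"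
    using keys_list_exponents[OF Cons.prems(1)] keys_list_exponents[OF Cons.prems(2)] Cons.prems(3) by simp
  then obtain G' e' r where l': "l' = (G', e') # r" by (cases l') auto
  have l: "flag_list M G l" "0 < e" and r: "flag_list M G' r" "0 < e'" using Cons.prems p l' by auto
  have above: "G \<subset> fst q" if "q \<in> set l" for q using flag_list_above[OF l(1) that] .
  have above': "G' \<subset> fst q" if "q \<in> set r" for q using flag_list_above[OF r(1) that] .
  have "G \<in> fst ` set l'" "G' \<in> fst ` set (p # l)" using keys p l' by auto
  then have "G = G' \<or> (\<exists>q\<in>set r. G = fst q)" "G' = G \<or> (\<exists>q\<in>set l. G' = fst q)" using p l' by auto
  then have G: "G' = G" using above above' by blast
  have "G \<notin> fst ` set l" "G \<notin> fst ` set r" using above above' G by blast+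
  then have "Poly_Mapping.lookup (list_exponents l) G = 0" "Poly_Mapping.lookup (list_exponents r) G = 0"
    using keys_list_exponents[OF l(1)] keys_list_exponents[OF r(1)] by (metis not_in_keys_iff_lookup_eq_zero)+
  moreover have "Poly_Mapping.lookup (list_exponents (p # l)) G = Poly_Mapping.lookup (list_exponents l') G"
    using Cons.prems(3) by simp
  ultimately have "e = e'" using p l' G by (simp add: lookup_add)
  moreover from this have "list_exponents l = list_exponents r" using Cons.prems(3) p l' G by simp
  ultimately show ?case using Cons.IH[OF l(1), of r] r(1) G p l' by simp
qed

lemma flag_list_chain: "flag_list M F l \<Longrightarrow> p \<in> set l \<Longrightarrow> q \<in> set l \<Longrightarrow> fst p \<subseteq> fst q \<or> fst q \<subseteq> fst p"
proof (induction M F l rule: flag_list.induct)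
  case (2 M F G e l)
  have "G \<subset> fst r" if "r \<in> set l" for r using 2(2) flag_list_above[of M G l r] that by simp
  moreover have "flag_list M G l" using 2(2) by simp
  moreover have "fst p = G \<or> p \<in> set l" "fst q = G \<or> q \<in> set l" using 2(3,4) by auto
  ultimately show ?case using 2(1) by blast
qed simp

lemma flag_list_insert:
  "flag_list M F l \<Longrightarrow> H \<in> compatible M F l \<Longrightarrow> flag_list M F (flag_insert H l)"
proof (induction M F l rule: flag_list.induct)
  case (2 M F G e l)
  have "H \<in> flats M" "F \<subset> H" "H \<subset> ground M" "H \<subseteq> G \<or> G \<subseteq> H" "\<forall>p\<in>set l. H \<subseteq> fst p \<or> fst p \<subseteq> H"
    using 2(3) by (auto simp: compatible_def)
  moreover from this have "H \<in> compatible M G l" if "H \<noteq> G" "\<not> H \<subset> G" using that by (auto simp: compatible_def)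
  ultimately show ?case using 2(1,2) by auto
qed (auto simp: compatible_def)

lemma flag_list_of_multiset:
  assumes "set_mset U \<subseteq> nonempty_proper_flats M" "\<And>F G. F \<in># U \<Longrightarrow> G \<in># U \<Longrightarrow> F \<subseteq> G \<or> G \<subseteq> F"
    and "\<And>F. F \<in> flats M \<Longrightarrow> F \<subseteq> ground M"
  shows "\<exists>l. flag_list M {} l \<and> list_exponents l = exponents U"
  using assms(1,2)
proof (induction U)
  case empty
  show ?case by (rule exI[of _ "[]"]) simp
next
  case (add H U)
  then obtain l where l: "flag_list M {} l" "list_exponents l = exponents U" by auto
  have "fst ` set l = set_mset U" using keys_list_exponents[OF l(1)] l(2) keys_exponents[of U] by simp
  then have "H \<subseteq> fst p \<or> fst p \<subseteq> H" if "p \<in> set l" for p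
    using that add.prems(2)[of H "fst p"] by auto
  moreover have "H \<in> flats M" "H \<noteq> {}" "H \<noteq> ground M" "H \<subseteq> ground M"
    using add.prems(1) assms(3)[of H] by (auto simp: nonempty_proper_flats_def proper_flats_def)
  ultimately have "H \<in> compatible M {} l" by (auto simp: compatible_def)
  then show ?case using flag_list_insert[OF l(1)] l(2) list_exponents_flag_insert[of H l]
    by (intro exI[of _ "flag_insert H l"]) (simp add: exponents_add add.commute)
qed

lemma degree_coeff_flag:
  assumes "flag_list M {} l" "Suc (sum_list (map snd l)) = rk M (ground M)"
  shows "degree_coeff M (list_exponents l) = flag_degree M {} 0 l"
proof -
  have "(THE l'. flag_list M {} l' \<and> list_exponents l = list_exponents l') = l"
  proof (rule the_equality)
    show "flag_list M {} l \<and> list_exponents l = list_exponents l" using assms(1) by simp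
    show "\<And>l'. flag_list M {} l' \<and> list_exponents l = list_exponents l' \<Longrightarrow> l' = l"
      using assms(1) flag_list_unique[of M "{}" l] by metis
  qed
  moreover have "\<exists>l'. flag_list M {} l' \<and> list_exponents l = list_exponents l'" using assms(1) by blast
  ultimately show ?thesis using assms(2) by (simp add: degree_coeff_def mon_degree_list_exponents)
qed

lemma degree_coeff_nonzero:
  assumes "degree_coeff M m \<noteq> 0"
  obtains l where "flag_list M {} l" "m = list_exponents l" "Suc (mon_degree m) = rk M (ground M)"
proof -
  have "(\<exists>l. flag_list M {} l \<and> m = list_exponents l) \<and> Suc (mon_degree m) = rk M (ground M)"
    using assms unfolding degree_coeff_def by presburger
  then show ?thesis using that by blast
qed

lemma degree_coeff_nonzero_keys:
  assumes "degree_coeff M m \<noteq> 0" "F \<in> Poly_Mapping.keys m" "G \<in> Poly_Mapping.keys m"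
  shows "F \<in> nonempty_proper_flats M" "F \<subseteq> G \<or> G \<subseteq> F"
proof -
  obtain l where l: "flag_list M {} l" "m = list_exponents l" using degree_coeff_nonzero[OF assms(1)] by blast
  have k: "F \<in> fst ` set l" "G \<in> fst ` set l" using assms(2,3) keys_list_exponents[OF l(1)] l(2) by auto
  then show "F \<subseteq> G \<or> G \<subseteq> F" using flag_list_chain[OF l(1)] by blast
  from k obtain p where p: "p \<in> set l" "F = fst p" by blast
  show "F \<in> nonempty_proper_flats M"
    using flag_list_flats[OF l(1) p(1)] flag_list_above[OF l(1) p(1)] p(2)
    by (auto simp: nonempty_proper_flats_def proper_flats_def)
qed

lemma chow_degree_add: "chow_degree M (p + q) = chow_degree M p + chow_degree M q"
  by (simp add: chow_degree_def lin_ext_add)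
lemma chow_degree_diff: "chow_degree M (p - q) = chow_degree M p - chow_degree M q"
  by (simp add: chow_degree_def lin_ext_diff)
lemma chow_degree_minus: "chow_degree M (- p) = - chow_degree M p"
  by (simp add: chow_degree_def lin_ext_minus)
lemma chow_degree_0 [simp]: "chow_degree M 0 = 0"
  by (simp add: chow_degree_def)
lemma chow_degree_sum: "chow_degree M (\<Sum>x\<in>A. f x) = (\<Sum>x\<in>A. chow_degree M (f x))"
  by (simp add: chow_degree_def lin_ext_sum)
lemma chow_degree_Const_mult: "chow_degree M (Const c * p) = c * chow_degree M p"
  by (simp add: chow_degree_def lin_ext_Const_mult)
lemma chow_degree_single: "chow_degree M (Poly_Mapping.single m c) = c * degree_coeff M m"
  by (simp add: chow_degree_def)

lemma chow_degree_homogeneous: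
  assumes "homogeneous k p" "Suc k \<noteq> rk M (ground M)"
  shows "chow_degree M p = 0"
  unfolding chow_degree_def lin_ext_def
proof (rule sum.neutral, rule ballI)
  fix m assume "m \<in> Poly_Mapping.keys p"
  then have "mon_degree m = k" using assms(1) by (simp add: homogeneous_iff)
  then have "degree_coeff M m = 0" using assms(2) degree_coeff_nonzero[of M m] by metis
  then show "Poly_Mapping.lookup p m * degree_coeff M m = 0" by simp
qed

text \<open>Both sides ignore monomials with a label that is not a nonempty proper flat. This makes
  the functional compatible with \<open>chow_null\<close>.\<close>

lemma chow_degree_retract: "chow_degree M (substitute (x_poly M) p) = chow_degree M p"
proof (induction p rule: poly_add_induct)
  case (single m c)
  show ?case
  proof (cases "Poly_Mapping.keys m \<subseteq> nonempty_proper_flats M")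
    case True
    have "vars (Poly_Mapping.single m c) \<subseteq> nonempty_proper_flats M" using True by (cases "c = 0") (auto simp: vars_def)
    then have "substitute (x_poly M) (Poly_Mapping.single m c) = Poly_Mapping.single m c"
      by (intro retract_id) (simp add: carrier_S_ring)
    then show ?thesis by (simp only:)
  next
    case False
    then obtain F where F: "F \<in> Poly_Mapping.keys m" "F \<notin> nonempty_proper_flats M" by blast
    have "degree_coeff M m = 0" using degree_coeff_nonzero_keys(1)[OF _ F(1) F(1)] F(2) by blast
    moreover have "x_poly M F ^ Poly_Mapping.lookup m F = 0" using F by (simp add: x_poly_def in_keys_iff zero_power)
    then have "mon_subst (x_poly M) m = 0" unfolding mon_subst_def using F(1) by (intro prod_zero) auto
    ultimately show ?thesis by (simp add: chow_degree_single)
  qed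
qed (simp_all add: substitute_add chow_degree_add)

context loopless_matroid
begin

text \<open>Either both sums equal the degree of the flag of \<open>m\<close>, because incomparable
  flats contribute zero and compatible ones are evaluated by
  \<open>flag_degree_insert_containing\<close>; or \<open>m\<close> is no flag monomial of degree
  \<open>d - 2\<close> and every term is zero.\<close>

lemma degree_coeff_linear:
  assumes "j \<in> E" "k \<in> E"
  shows "(\<Sum>F\<in>{F \<in> nonempty_proper_flats M. j \<in> F}. degree_coeff M (m + Poly_Mapping.single F 1)) =
    (\<Sum>F\<in>{F \<in> nonempty_proper_flats M. k \<in> F}. degree_coeff M (m + Poly_Mapping.single F 1))"
proof (cases "(\<exists>l. flag_list M {} l \<and> m = list_exponents l) \<and> mon_degree m + 2 = rk M E")
  case True
  then obtain l where l: "flag_list M {} l" "m = list_exponents l" by blast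
  have tot: "sum_list (map snd l) + 2 = rk M E" using True l by (simp add: mon_degree_list_exponents)
  have "E \<noteq> {}" using assms by blast
  have "(\<Sum>F\<in>{F \<in> nonempty_proper_flats M. i \<in> F}. degree_coeff M (m + Poly_Mapping.single F 1)) = flag_degree M {} 0 l"
    if "i \<in> E" for i
  proof -
    have "(\<Sum>F\<in>{F \<in> nonempty_proper_flats M. i \<in> F}. degree_coeff M (m + Poly_Mapping.single F 1)) =
      (\<Sum>F\<in>{F \<in> compatible M {} l. i \<in> F}. degree_coeff M (m + Poly_Mapping.single F 1))"
    proof (rule sum.mono_neutral_right)
      show "{F \<in> compatible M {} l. i \<in> F} \<subseteq> {F \<in> nonempty_proper_flats M. i \<in> F}"
        by (auto simp: compatible_def npf_iff)
      show "\<forall>F\<in>{F \<in> nonempty_proper_flats M. i \<in> F} - {F \<in> compatible M {} l. i \<in> F}.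
          degree_coeff M (m + Poly_Mapping.single F 1) = 0"
      proof
        fix F assume F: "F \<in> {F \<in> nonempty_proper_flats M. i \<in> F} - {F \<in> compatible M {} l. i \<in> F}"
        then obtain p where p: "p \<in> set l" "\<not> F \<subseteq> fst p" "\<not> fst p \<subseteq> F"
          by (auto simp: compatible_def npf_iff)
        have "F \<in> Poly_Mapping.keys (m + Poly_Mapping.single F 1)" "fst p \<in> Poly_Mapping.keys (m + Poly_Mapping.single F 1)"
          using p(1) keys_list_exponents[OF l(1)] l(2) by (auto simp: keys_add_nat)
        then show "degree_coeff M (m + Poly_Mapping.single F 1) = 0"
          using degree_coeff_nonzero_keys(2)[of M "m + Poly_Mapping.single F 1" F "fst p"] p by blast
      qed
    qed (use finite_npf in simp)
    also have "\<dots> = (\<Sum>F\<in>{F \<in> compatible M {} l. i \<in> F}. flag_degree M {} 0 (flag_insert F l))"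
    proof (rule sum.cong)
      fix F assume F: "F \<in> {F \<in> compatible M {} l. i \<in> F}"
      have ins: "flag_list M {} (flag_insert F l)" using flag_list_insert l F by blast
      have e: "list_exponents (flag_insert F l) = m + Poly_Mapping.single F 1"
        by (simp add: list_exponents_flag_insert l)
      have "sum_list (map snd (flag_insert F l)) = Suc (mon_degree m)"
        using mon_degree_list_exponents[of "flag_insert F l"] e by (simp add: mon_degree_add)
      then show "degree_coeff M (m + Poly_Mapping.single F 1) = flag_degree M {} 0 (flag_insert F l)"
        using degree_coeff_flag[OF ins] e True by simp
    qed simp
    also have "\<dots> = flag_degree M {} 0 l"
      using \<open>E \<noteq> {}\<close> that l tot by (intro flag_degree_insert_containing empty_flat) auto
    finally show ?thesis .
  qed
  then show ?thesis using assms by simp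
next
  case False
  have "degree_coeff M (m + Poly_Mapping.single F 1) = 0" for F
  proof (rule ccontr)
    assume nz: "degree_coeff M (m + Poly_Mapping.single F 1) \<noteq> 0"
    obtain U where U: "m = exponents U" using exponents_surj by blast
    have sub: "Poly_Mapping.keys m \<subseteq> Poly_Mapping.keys (m + Poly_Mapping.single F 1)" unfolding keys_add_nat by blast
    have "\<exists>l. flag_list M {} l \<and> list_exponents l = exponents U"
    proof (rule flag_list_of_multiset)
      show "set_mset U \<subseteq> nonempty_proper_flats M"
        using degree_coeff_nonzero_keys(1)[OF nz] sub U keys_exponents[of U] by blast
      show "F \<subseteq> G \<or> G \<subseteq> F" if "F \<in># U" "G \<in># U" for F G
        using degree_coeff_nonzero_keys(2)[OF nz, of F G] sub U keys_exponents[of U] that by blast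
    qed (rule flat_subset)
    moreover have "mon_degree m + 2 = rk M E" using degree_coeff_nonzero[OF nz] by (metis mon_degree_add mon_degree_single add_Suc_right add_2_eq_Suc' One_nat_def add.right_neutral)
    ultimately show False using False U by metis
  qed
  then show ?thesis by simp
qed

lemma chow_degree_CH_ideal:
  assumes "p \<in> CH_ideal M"
  shows "chow_degree M (q * p) = 0"
proof -
  \<comment> \<open>Quantifying over all multiples turns the kernel of a linear functional into an
    ideal, so that only the generators have to be tested.\<close>
  let ?X = "{p \<in> carrier (S_ring M). \<forall>q. chow_degree M (q * p) = 0}"
  have "ideal ?X (S_ring M)"
  proof (rule ideal_S_ringI)
    fix p q assume "p \<in> ?X" "q \<in> carrier (S_ring M)"
    moreover have "chow_degree M (r * (q * p)) = 0" if "\<forall>q. chow_degree M (q * p) = 0" for r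
      using that[rule_format, of "r * q"] by (simp add: mult.assoc)
    ultimately show "q * p \<in> ?X" by (auto intro: carrier_S_ring_intros)
  qed (auto intro: carrier_S_ring_intros simp: distrib_left chow_degree_add)
  moreover have "I_gens M \<subseteq> ?X"
  proof
    fix p assume p: "p \<in> I_gens M"
    then obtain j k where jk: "j \<in> E" "k \<in> E" and p': "p = (\<Sum>F\<in>{F \<in> nonempty_proper_flats M. j \<in> F}. Var F) -
        (\<Sum>F\<in>{F \<in> nonempty_proper_flats M. k \<in> F}. Var F)" by (auto simp: I_gens_def)
    have "chow_degree M (q * p) = 0" for q
    proof (induction q rule: poly_add_induct)
      case (single m c)
      have "chow_degree M (Poly_Mapping.single m c * (\<Sum>F\<in>A. Var F)) = c * (\<Sum>F\<in>A. degree_coeff M (m + Poly_Mapping.single F 1))" for A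
        by (simp add: sum_distrib_left chow_degree_sum Var_def mult_single chow_degree_single)
      then show ?case unfolding p' right_diff_distrib chow_degree_diff using degree_coeff_linear[OF jk, of m] by simp
    qed (simp_all add: distrib_right chow_degree_add)
    then show "p \<in> ?X" using p I_gens_carrier by auto
  qed
  moreover have "J_gens M \<subseteq> ?X"
  proof
    fix p assume p: "p \<in> J_gens M"
    then obtain F G where FG: "\<not> F \<subseteq> G" "\<not> G \<subseteq> F" and p': "p = Var F * Var G" by (auto simp: J_gens_def)
    have "chow_degree M (q * p) = 0" for q
    proof (induction q rule: poly_add_induct)
      case (single m c)
      let ?m = "m + (Poly_Mapping.single F 1 + Poly_Mapping.single G 1)"
      have "F \<in> Poly_Mapping.keys ?m" "G \<in> Poly_Mapping.keys ?m" by (auto simp: keys_add_nat)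
      then have "degree_coeff M ?m = 0" using degree_coeff_nonzero_keys(2)[of M ?m F G] FG by blast
      then show ?case unfolding p' by (simp add: Var_def mult_single chow_degree_single)
    qed (simp_all add: distrib_right chow_degree_add)
    then show "p \<in> ?X" using p J_gens_carrier by auto
  qed
  ultimately have "CH_ideal M \<subseteq> ?X" by (rule CH_ideal_least)
  then show ?thesis using assms by blast
qed

lemma chow_degree_null:
  assumes "p \<in> chow_null M"
  shows "chow_degree M (q * p) = 0" "chow_degree M (p * q) = 0" "chow_degree M p = 0"
proof -
  have *: "chow_degree M (q * p) = 0" for q
    using chow_degree_CH_ideal[of "substitute (x_poly M) p" "substitute (x_poly M) q"] assms
      chow_degree_retract[of M "q * p"] by (simp add: chow_null_def substitute_mult)
  from *[of q] *[of 1] show "chow_degree M (q * p) = 0" "chow_degree M (p * q) = 0" "chow_degree M p = 0"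
    by (simp_all add: mult.commute)
qed

lemma chow_degree_cong: "p - q \<in> chow_null M \<Longrightarrow> chow_degree M p = chow_degree M q"
  using chow_degree_null(3)[of "p - q"] by (simp add: chow_degree_diff)

end

section \<open>Vanishing above the rank\<close>

context loopless_matroid
begin

definition interval :: "'a set \<Rightarrow> 'a set \<Rightarrow> 'a set set" where
  "interval A B = {F \<in> flats M. A \<subset> F \<and> F \<subseteq> B}"

lemma finite_interval [simp]: "finite (interval A B)"
  by (simp add: interval_def)

lemma interval_mono: "A \<subseteq> A' \<Longrightarrow> B' \<subseteq> B \<Longrightarrow> interval A' B' \<subseteq> interval A B"
  by (auto simp: interval_def)

text \<open>In the interval above a flat \<open>F\<close> and in the interval below it the same relations hold after
  multiplication by the variable of \<open>F\<close>, the latter up to monomials with more factors above \<open>F\<close>;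
  this is the induction step.\<close>

lemma top_vanishing:
  fixes y :: "'a set \<Rightarrow> 'r :: comm_ring_1"
  assumes K: "0 \<in> K" "\<And>a b. a \<in> K \<Longrightarrow> b \<in> K \<Longrightarrow> a + b \<in> K" "\<And>a. a \<in> K \<Longrightarrow> - a \<in> K"
    and AB: "A \<in> flats M" "B \<in> flats M" "A \<subset> B"
    and incomparable: "\<And>m G H. set_mset m \<subseteq> interval A B \<Longrightarrow> size m + 2 = n \<Longrightarrow> G \<in> interval A B \<Longrightarrow>
       H \<in> interval A B \<Longrightarrow> \<not> G \<subseteq> H \<Longrightarrow> \<not> H \<subseteq> G \<Longrightarrow> (\<Prod>F\<in>#m. y F) * (y G * y H) \<in> K"
    and linear: "\<And>m j. set_mset m \<subseteq> interval A B \<Longrightarrow> size m + 1 = n \<Longrightarrow> j \<in> B \<Longrightarrow> j \<notin> A \<Longrightarrow>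
       (\<Prod>F\<in>#m. y F) * (\<Sum>G\<in>{G \<in> interval A B. j \<in> G}. y G) \<in> K"
    and U: "set_mset U \<subseteq> interval A B" "size U = n" "rk M B \<le> rk M A + n"
  shows "(\<Prod>F\<in>#U. y F) \<in> K"
  using assms
proof (induction "rk M B - rk M A" arbitrary: A B n K U rule: less_induct)
  case less
  note IH = less.hyps and K = less.prems(1-3) and AB = less.prems(4-6) and inc = less.prems(7) and lin = less.prems(8)
  have Ksum: "(\<Sum>x\<in>X. f x) \<in> K" if "\<And>x. x \<in> X \<Longrightarrow> f x \<in> K" for X :: "'a set set" and f
    using that by (induction X rule: infinite_finite_induct) (auto intro: K)
  \<comment> \<open>\<open>F\<close> is one factor different from \<open>B\<close>; the others are
    sorted into those contained in \<open>F\<close> and those strictly above it. Induction on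
    \<open>size P\<close> allows factors to move from below to above.\<close>
  have claim: "y F * (\<Prod>x\<in>#P. y x) * (\<Prod>x\<in>#Q. y x) \<in> K"
    if F: "F \<in> interval A B" "F \<noteq> B" and "set_mset P \<subseteq> interval A F" "set_mset Q \<subseteq> interval F B"
      "size P + size Q + 1 = n" for F P Q
    using that(3-5)
  proof (induction "size P" arbitrary: P Q rule: less_induct)
    case (less P Q)
    have Ff: "F \<in> flats M" "A \<subset> F" "F \<subset> B" using F by (auto simp: interval_def)
    have rkF: "rk M A < rk M F" "rk M F < rk M B" using rk_less AB Ff by auto
    have subA: "interval A F \<subseteq> interval A B" and subB: "interval F B \<subseteq> interval A B"
      using Ff by (auto simp: interval_def)
    show ?case
    \<comment> \<open>Pigeonhole: the intervals below and above \<open>F\<close> have total length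
      \<open>rk M B - rk M A \<le> n\<close>, and \<open>n - 1\<close> factors are distributed over
      them, so one of the two is filled and the outer induction applies to it.\<close>
    proof (cases "rk M B \<le> rk M F + size Q")
      case True
      let ?K = "{z. y F * (\<Prod>x\<in>#P. y x) * z \<in> K}"
      have "(\<Prod>x\<in>#Q. y x) \<in> ?K"
      proof (rule IH[of B F])
        show "rk M B - rk M F < rk M B - rk M A" using rkF by simp
        show "0 \<in> ?K" using K by simp
        show "\<And>a b. a \<in> ?K \<Longrightarrow> b \<in> ?K \<Longrightarrow> a + b \<in> ?K" using K by (simp add: distrib_left)
        show "\<And>a. a \<in> ?K \<Longrightarrow> - a \<in> ?K" using K by simp
        show "F \<in> flats M" "B \<in> flats M" "F \<subset> B" using Ff AB by auto
        show "set_mset Q \<subseteq> interval F B" "size Q = size Q" "rk M B \<le> rk M F + size Q" using less.prems True by auto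
      next
        fix m G H assume *: "set_mset m \<subseteq> interval F B" "size m + 2 = size Q" "G \<in> interval F B" "H \<in> interval F B"
          "\<not> G \<subseteq> H" "\<not> H \<subseteq> G"
        have "(\<Prod>x\<in>#add_mset F (P + m). y x) * (y G * y H) \<in> K"
          using * less.prems subA subB F by (intro inc) auto
        then show "(\<Prod>x\<in>#m. y x) * (y G * y H) \<in> ?K" by (simp add: mult_ac)
      next
        fix m j assume *: "set_mset m \<subseteq> interval F B" "size m + 1 = size Q" "j \<in> B" "j \<notin> F"
        let ?p = "\<Prod>x\<in>#add_mset F (P + m). y x"
        have 1: "?p * (\<Sum>G\<in>{G \<in> interval A B. j \<in> G}. y G) \<in> K"
          using * less.prems subA subB F Ff by (intro lin) auto
        have 2: "(\<Sum>G\<in>{G \<in> interval A B. j \<in> G \<and> \<not> F \<subset> G}. ?p * y G) \<in> K"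
        proof (rule Ksum)
          fix G assume G: "G \<in> {G \<in> interval A B. j \<in> G \<and> \<not> F \<subset> G}"
          then have "\<not> F \<subseteq> G" "\<not> G \<subseteq> F" using *(4) by auto
          then have "(\<Prod>x\<in>#P + m. y x) * (y F * y G) \<in> K"
            using * less.prems subA subB F G by (intro inc) auto
          then show "?p * y G \<in> K" by (simp add: mult_ac)
        qed
        have "{G \<in> interval A B. j \<in> G} = {G \<in> interval F B. j \<in> G} \<union> {G \<in> interval A B. j \<in> G \<and> \<not> F \<subset> G}"
          using subB by (auto simp: interval_def)
        then have "(\<Sum>G\<in>{G \<in> interval A B. j \<in> G}. y G) =
            (\<Sum>G\<in>{G \<in> interval F B. j \<in> G}. y G) + (\<Sum>G\<in>{G \<in> interval A B. j \<in> G \<and> \<not> F \<subset> G}. y G)"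
          by (simp only:) (rule sum.union_disjoint, auto simp: interval_def)
        then have "?p * (\<Sum>G\<in>{G \<in> interval F B. j \<in> G}. y G) =
            ?p * (\<Sum>G\<in>{G \<in> interval A B. j \<in> G}. y G) + - (\<Sum>G\<in>{G \<in> interval A B. j \<in> G \<and> \<not> F \<subset> G}. ?p * y G)"
          by (simp add: distrib_left sum_distrib_left)
        then have "?p * (\<Sum>G\<in>{G \<in> interval F B. j \<in> G}. y G) \<in> K" using K(2)[OF 1 K(3)[OF 2]] by (simp only:)
        then show "(\<Prod>x\<in>#m. y x) * (\<Sum>G\<in>{G \<in> interval F B. j \<in> G}. y G) \<in> ?K" by (simp add: mult_ac)
      qed
      then show ?thesis by simp
    next
      case False
      then have szP: "rk M F \<le> rk M A + size P" using less.prems(3) \<open>rk M B \<le> rk M A + n\<close> by simp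
      let ?K = "{z. y F * (\<Prod>x\<in>#Q. y x) * z \<in> K}"
      have "(\<Prod>x\<in>#P. y x) \<in> ?K"
      proof (rule IH[of F A])
        show "rk M F - rk M A < rk M B - rk M A" using rkF by simp
        show "0 \<in> ?K" using K by simp
        show "\<And>a b. a \<in> ?K \<Longrightarrow> b \<in> ?K \<Longrightarrow> a + b \<in> ?K" using K by (simp add: distrib_left)
        show "\<And>a. a \<in> ?K \<Longrightarrow> - a \<in> ?K" using K by simp
        show "A \<in> flats M" "F \<in> flats M" "A \<subset> F" using Ff AB by auto
        show "set_mset P \<subseteq> interval A F" "size P = size P" "rk M F \<le> rk M A + size P" using less.prems szP by auto
      next
        fix m G H assume *: "set_mset m \<subseteq> interval A F" "size m + 2 = size P" "G \<in> interval A F" "H \<in> interval A F"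
          "\<not> G \<subseteq> H" "\<not> H \<subseteq> G"
        have "(\<Prod>x\<in>#add_mset F (Q + m). y x) * (y G * y H) \<in> K"
          using * less.prems subA subB F by (intro inc) auto
        then show "(\<Prod>x\<in>#m. y x) * (y G * y H) \<in> ?K" by (simp add: mult_ac)
      next
        fix m j assume *: "set_mset m \<subseteq> interval A F" "size m + 1 = size P" "j \<in> F" "j \<notin> A"
        let ?p = "\<Prod>x\<in>#add_mset F (Q + m). y x"
        have 1: "?p * (\<Sum>G\<in>{G \<in> interval A B. j \<in> G}. y G) \<in> K"
          using * less.prems subA subB F Ff by (intro lin) auto
        have 2: "(\<Sum>G\<in>{G \<in> interval A B. j \<in> G \<and> \<not> G \<subseteq> F}. ?p * y G) \<in> K"
        proof (rule Ksum)
          fix G assume G: "G \<in> {G \<in> interval A B. j \<in> G \<and> \<not> G \<subseteq> F}"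
          show "?p * y G \<in> K"
          \<comment> \<open>A flat strictly above \<open>F\<close> joins \<open>Q\<close> and leaves
            one factor fewer in \<open>P\<close>; an incomparable flat is killed together with
            \<open>y F\<close>.\<close>
          proof (cases "F \<subseteq> G")
            case True
            have "G \<in> interval F B" using G True by (auto simp: interval_def)
            then have "y F * (\<Prod>x\<in>#m. y x) * (\<Prod>x\<in>#add_mset G Q. y x) \<in> K"
              using * less.prems by (intro less.hyps) auto
            then show ?thesis by (simp add: mult_ac)
          next
            case False
            then have "(\<Prod>x\<in>#Q + m. y x) * (y F * y G) \<in> K"
              using * less.prems subA subB F G by (intro inc) auto
            then show ?thesis by (simp add: mult_ac)
          qed
        qed
        have "{G \<in> interval A B. j \<in> G} = {G \<in> interval A F. j \<in> G} \<union> {G \<in> interval A B. j \<in> G \<and> \<not> G \<subseteq> F}"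
          using subA by (auto simp: interval_def)
        then have "(\<Sum>G\<in>{G \<in> interval A B. j \<in> G}. y G) =
            (\<Sum>G\<in>{G \<in> interval A F. j \<in> G}. y G) + (\<Sum>G\<in>{G \<in> interval A B. j \<in> G \<and> \<not> G \<subseteq> F}. y G)"
          by (simp only:) (rule sum.union_disjoint, auto simp: interval_def)
        then have "?p * (\<Sum>G\<in>{G \<in> interval A F. j \<in> G}. y G) =
            ?p * (\<Sum>G\<in>{G \<in> interval A B. j \<in> G}. y G) + - (\<Sum>G\<in>{G \<in> interval A B. j \<in> G \<and> \<not> G \<subseteq> F}. ?p * y G)"
          by (simp add: distrib_left sum_distrib_left)
        then have "?p * (\<Sum>G\<in>{G \<in> interval A F. j \<in> G}. y G) \<in> K" using K(2)[OF 1 K(3)[OF 2]] by (simp only:)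
        then show "(\<Prod>x\<in>#m. y x) * (\<Sum>G\<in>{G \<in> interval A F. j \<in> G}. y G) \<in> ?K" by (simp add: mult_ac)
      qed
      then show ?thesis by (simp add: mult_ac)
    qed
  qed
  have proper: "(\<Prod>x\<in>#V. y x) \<in> K"
    if V: "set_mset V \<subseteq> interval A B" "size V = n" and F: "F \<in># V" "F \<noteq> B" for V F
  proof (cases "\<exists>G\<in>#V. \<not> G \<subseteq> F \<and> \<not> F \<subseteq> G")
    case True
    then obtain G where G: "G \<in># V" "\<not> G \<subseteq> F" "\<not> F \<subseteq> G" by blast
    obtain W where W: "V = add_mset F W" using multi_member_split[OF F(1)] by blast
    have "G \<noteq> F" using G(2) by blast
    then have "G \<in># W" using G(1) W by simp
    from multi_member_split[OF this] obtain m where "W = add_mset G m" by blast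
    with W have m: "V = add_mset F (add_mset G m)" by simp
    have "(\<Prod>x\<in>#m. y x) * (y F * y G) \<in> K" using V G m by (intro inc) auto
    then show ?thesis using m by (simp add: mult_ac)
  next
    case False
    obtain W where W: "V = add_mset F W" using F(1) by (metis insert_DiffM)
    let ?P = "filter_mset (\<lambda>G. G \<subseteq> F) W" and ?Q = "filter_mset (\<lambda>G. \<not> G \<subseteq> F) W"
    have PQ: "W = ?P + ?Q" by (rule multiset_partition)
    have "size V = Suc (size ?P + size ?Q)" using W PQ by (metis size_add_mset size_union)
    moreover have "set_mset ?P \<subseteq> interval A F" using V W by (auto simp: interval_def)
    moreover have "set_mset ?Q \<subseteq> interval F B"
    proof
      fix G assume "G \<in># ?Q"
      then have "G \<in># V" "\<not> G \<subseteq> F" using W by auto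
      then show "G \<in> interval F B" using V(1) False by (auto simp: interval_def)
    qed
    moreover have "F \<in> interval A B" using V F by auto
    ultimately have "y F * (\<Prod>x\<in>#?P. y x) * (\<Prod>x\<in>#?Q. y x) \<in> K" using F(2) V(2) by (intro claim) auto
    moreover have "(\<Prod>x\<in>#V. y x) = y F * ((\<Prod>x\<in>#?P. y x) * (\<Prod>x\<in>#?Q. y x))"
      using W PQ by (metis image_mset_add_mset image_mset_union prod_mset.add_mset prod_mset.union)
    ultimately show ?thesis by (simp add: mult.assoc)
  qed
  show ?case
  proof (cases "\<exists>F\<in>#U. F \<noteq> B")
    case True
    then show ?thesis using proper less.prems by blast
  next
    case False
    have "n \<noteq> 0" using rk_less[OF AB] less.prems(11) by simp
    then obtain B' m where "U = add_mset B' m" using less.prems(10) by (cases U) auto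
    then have m: "U = add_mset B m" using False by auto
    have szm: "size m + 1 = n" "set_mset m \<subseteq> interval A B" using m less.prems(9,10) by auto
    \<comment> \<open>Only a power of \<open>y B\<close> is left. The linear relation for
      \<open>j\<close> trades one factor for variables of proper flats, which \<open>proper\<close>
      has settled.\<close>
    obtain j where j: "j \<in> B" "j \<notin> A" using AB by blast
    have 1: "(\<Prod>x\<in>#m. y x) * (\<Sum>G\<in>{G \<in> interval A B. j \<in> G}. y G) \<in> K" using szm j by (intro lin) auto
    have 2: "(\<Sum>G\<in>{G \<in> interval A B. j \<in> G} - {B}. (\<Prod>x\<in>#m. y x) * y G) \<in> K"
    proof (rule Ksum)
      fix G assume G: "G \<in> {G \<in> interval A B. j \<in> G} - {B}"
      have "(\<Prod>x\<in>#add_mset G m. y x) \<in> K" using G szm by (intro proper[of _ G]) auto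
      then show "(\<Prod>x\<in>#m. y x) * y G \<in> K" by (simp add: mult_ac)
    qed
    have "B \<in> {G \<in> interval A B. j \<in> G}" using AB j by (auto simp: interval_def)
    then have "(\<Sum>G\<in>{G \<in> interval A B. j \<in> G}. y G) = y B + (\<Sum>G\<in>{G \<in> interval A B. j \<in> G} - {B}. y G)"
      by (intro sum.remove) auto
    then have "(\<Prod>x\<in>#U. y x) = (\<Prod>x\<in>#m. y x) * (\<Sum>G\<in>{G \<in> interval A B. j \<in> G}. y G)
        + - (\<Sum>G\<in>{G \<in> interval A B. j \<in> G} - {B}. (\<Prod>x\<in>#m. y x) * y G)"
      using m by (simp add: distrib_left sum_distrib_left mult.commute)
    then show ?thesis using K(2)[OF 1 K(3)[OF 2]] by (simp only:)
  qed
qed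

end

section \<open>The variable of the ground set\<close>

locale nonempty_matroid = loopless_matroid +
  assumes E_nonempty: "ground M \<noteq> {}"
begin

lemma empty_psubset_E: "{} \<subset> E" using E_nonempty by auto

lemma rk_E_pos: "0 < rk M E" using rk_pos[OF E_flat E_nonempty] .

lemma chow_var_proper: "F \<noteq> E \<Longrightarrow> chow_var M F = Var F"
  by (simp add: chow_var_def)

lemma homogeneous_chow_var: "homogeneous 1 (chow_var M F)"
proof (cases "F = E")
  case True
  have "chow_var M E = - (\<Sum>G\<in>{G \<in> nonempty_proper_flats M. (SOME j. j \<in> E) \<in> G}. Var G)"
    by (simp add: chow_var_def)
  then show ?thesis unfolding True by (simp only:) (intro homogeneous_minus homogeneous_sum homogeneous_Var)
next
  case False
  then show ?thesis by (simp only: chow_var_def if_False homogeneous_Var)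
qed

lemma chow_var_incomparable:
  assumes "F \<in> flats M" "G \<in> flats M" "\<not> F \<subseteq> G" "\<not> G \<subseteq> F"
  shows "chow_var M F * chow_var M G \<in> chow_null M"
proof -
  have "F \<noteq> E" "G \<noteq> E" using assms flat_subset by auto
  then show ?thesis using incomparable_null assms by (simp add: chow_var_proper)
qed

lemma chow_var_linear:
  assumes "j \<in> E"
  shows "(\<Sum>F\<in>{F \<in> flats M. j \<in> F}. chow_var M F) \<in> chow_null M"
proof -
  let ?j = "SOME j. j \<in> E"
  have "?j \<in> E" using E_nonempty some_in_eq by blast
  have "{F \<in> flats M. j \<in> F} = insert E {F \<in> nonempty_proper_flats M. j \<in> F}"
    using E_flat assms flat_subset by (auto simp: nonempty_proper_flats_def proper_flats_def)
  moreover have "E \<notin> {F \<in> nonempty_proper_flats M. j \<in> F}" by (simp add: npf_iff)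
  ultimately have "(\<Sum>F\<in>{F \<in> flats M. j \<in> F}. chow_var M F)
      = chow_var M E + (\<Sum>F\<in>{F \<in> nonempty_proper_flats M. j \<in> F}. chow_var M F)"
    using finite_npf by simp
  also have "(\<Sum>F\<in>{F \<in> nonempty_proper_flats M. j \<in> F}. chow_var M F)
      = (\<Sum>F\<in>{F \<in> nonempty_proper_flats M. j \<in> F}. Var F)"
    by (intro sum.cong) (auto simp: npf_iff chow_var_def)
  finally show ?thesis using linear_null[OF assms \<open>?j \<in> E\<close>] by (simp add: chow_var_def)
qed

text \<open>A flat containing \<open>j\<close> is not contained in \<open>A\<close>; so it lies
  strictly above \<open>A\<close> or is incomparable with \<open>A\<close> and killed by its
  variable.\<close>

lemma chow_var_linear_above:
  assumes "j \<in> E" "j \<notin> A" "A \<in> flats M"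
    and w: "w = 1 \<and> A = {} \<or> w = chow_var M A"
  shows "w * (\<Sum>F\<in>{F \<in> interval A E. j \<in> F}. chow_var M F) \<in> chow_null M"
proof -
  have "{F \<in> flats M. j \<in> F} = {F \<in> interval A E. j \<in> F} \<union> {F \<in> flats M. j \<in> F \<and> \<not> A \<subset> F}"
    using flat_subset by (auto simp: interval_def)
  then have "(\<Sum>F\<in>{F \<in> flats M. j \<in> F}. chow_var M F) =
      (\<Sum>F\<in>{F \<in> interval A E. j \<in> F}. chow_var M F) + (\<Sum>F\<in>{F \<in> flats M. j \<in> F \<and> \<not> A \<subset> F}. chow_var M F)"
    by (simp only:) (rule sum.union_disjoint, auto simp: interval_def)
  then have "w * (\<Sum>F\<in>{F \<in> interval A E. j \<in> F}. chow_var M F) =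
      w * (\<Sum>F\<in>{F \<in> flats M. j \<in> F}. chow_var M F) - (\<Sum>F\<in>{F \<in> flats M. j \<in> F \<and> \<not> A \<subset> F}. w * chow_var M F)"
    by (simp add: distrib_left sum_distrib_left)
  moreover have "(\<Sum>F\<in>{F \<in> flats M. j \<in> F \<and> \<not> A \<subset> F}. w * chow_var M F) \<in> chow_null M"
  proof (rule chow_null_sum)
    fix F assume F: "F \<in> {F \<in> flats M. j \<in> F \<and> \<not> A \<subset> F}"
    then have "\<not> F \<subseteq> A" "\<not> A \<subseteq> F" "A \<noteq> {}" using assms(2) by auto
    then show "w * chow_var M F \<in> chow_null M" using w F assms(3) chow_var_incomparable by auto
  qed
  ultimately show ?thesis using chow_var_linear[OF assms(1)] by (auto intro: chow_null_diff chow_null_mult)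
qed

lemma flag_list_Var_factor:
  assumes "p \<in> set l" "0 < snd p"
  shows "\<exists>q. Poly_Mapping.single (list_exponents l) 1 = Var (fst p) * q"
  using assms(1)
proof (induction l)
  case (Cons a l)
  have split: "Poly_Mapping.single (list_exponents (a # l)) (1 :: rat) =
      Poly_Mapping.single (Poly_Mapping.single (fst a) (snd a)) 1 * Poly_Mapping.single (list_exponents l) 1"
    by (simp add: mult_single)
  show ?case
  proof (cases "p = a")
    case True
    have "Poly_Mapping.single (fst p) (snd p) = Poly_Mapping.single (fst p) 1 + Poly_Mapping.single (fst p) (snd p - 1)"
      using assms(2) by (simp flip: single_add)
    then have "Poly_Mapping.single (Poly_Mapping.single (fst p) (snd p)) 1 =
        Var (fst p) * Poly_Mapping.single (Poly_Mapping.single (fst p) (snd p - 1)) 1"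
      by (simp add: Var_def mult_single)
    then show ?thesis using split True by (intro exI) (simp add: mult.assoc)
  next
    case False
    then obtain q where "Poly_Mapping.single (list_exponents l) 1 = Var (fst p) * q" using Cons by auto
    then have "Poly_Mapping.single (list_exponents (a # l)) 1 =
        Var (fst p) * (Poly_Mapping.single (Poly_Mapping.single (fst a) (snd a)) 1 * q)"
      unfolding split by (simp add: mult.left_commute)
    then show ?thesis by blast
  qed
qed simp

lemma flag_list_positive: "flag_list M F l \<Longrightarrow> p \<in> set l \<Longrightarrow> 0 < snd p"
  by (induction M F l rule: flag_list.induct) auto

text \<open>The variable of \<open>E\<close> is minus the sum over the flats through a chosen
  \<open>j\<close>, and by \<open>flag_degree_insert_containing\<close> such a sum returns the
  degree of the flag unchanged. Thus Eur's formula extends to powers of this variable, each factor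
  costing a sign.\<close>

lemma chow_degree_flag_power:
  assumes "flag_list M {} l" "e + sum_list (map snd l) + 1 = rk M E"
  shows "chow_degree M (chow_var M E ^ e * Poly_Mapping.single (list_exponents l) 1)
    = (-1) ^ e * flag_degree M {} 0 l"
  using assms
proof (induction e arbitrary: l)
  case 0
  then show ?case by (simp add: chow_degree_single degree_coeff_flag)
next
  case (Suc e)
  let ?j = "SOME j. j \<in> E"
  let ?X = "{F \<in> nonempty_proper_flats M. ?j \<in> F}" and ?Y = "{F \<in> compatible M {} l. ?j \<in> F}"
  let ?m = "Poly_Mapping.single (list_exponents l) 1"
  have j: "?j \<in> E" using E_nonempty some_in_eq by blast
  have "chow_degree M (chow_var M E ^ Suc e * ?m) = - (\<Sum>F\<in>?X. chow_degree M (chow_var M E ^ e * (Var F * ?m)))"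
  proof -
    have "chow_var M E * ?m = - (\<Sum>F\<in>?X. Var F * ?m)"
      by (simp add: chow_var_def sum_distrib_right)
    moreover have "chow_var M E ^ Suc e * ?m = chow_var M E ^ e * (chow_var M E * ?m)" by (simp add: mult_ac)
    ultimately have "chow_var M E ^ Suc e * ?m = chow_var M E ^ e * - (\<Sum>F\<in>?X. Var F * ?m)" by (simp only:)
    then show ?thesis by (simp add: sum_distrib_left chow_degree_minus chow_degree_sum)
  qed
  also have "(\<Sum>F\<in>?X. chow_degree M (chow_var M E ^ e * (Var F * ?m)))
      = (\<Sum>F\<in>?Y. chow_degree M (chow_var M E ^ e * (Var F * ?m)))"
  proof (rule sum.mono_neutral_right)
    show "?Y \<subseteq> ?X" by (auto simp: compatible_def npf_iff)
    show "\<forall>F\<in>?X - ?Y. chow_degree M (chow_var M E ^ e * (Var F * ?m)) = 0"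
    proof
      fix F assume F: "F \<in> ?X - ?Y"
      then obtain p where p: "p \<in> set l" "\<not> F \<subseteq> fst p" "\<not> fst p \<subseteq> F"
        by (auto simp: compatible_def npf_iff)
      obtain q where "?m = Var (fst p) * q" using flag_list_Var_factor[OF p(1)] flag_list_positive[OF Suc.prems(1) p(1)] by blast
      then have "Var F * ?m \<in> chow_null M" using incomparable_null[OF p(2,3)] by (simp add: chow_null_mult2 flip: mult.assoc)
      then show "chow_degree M (chow_var M E ^ e * (Var F * ?m)) = 0" using chow_degree_null by blast
    qed
  qed (use finite_npf in simp)
  also have "\<dots> = (\<Sum>F\<in>?Y. (-1) ^ e * flag_degree M {} 0 (flag_insert F l))"
  proof (rule sum.cong)
    fix F assume F: "F \<in> ?Y"
    have e: "Var F * ?m = Poly_Mapping.single (list_exponents (flag_insert F l)) 1"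
      by (simp add: Var_def mult_single list_exponents_flag_insert add.commute)
    have "sum_list (map snd (flag_insert F l)) = Suc (sum_list (map snd l))"
      using mon_degree_list_exponents[of "flag_insert F l"] mon_degree_list_exponents[of l]
      by (simp add: list_exponents_flag_insert mon_degree_add)
    then show "chow_degree M (chow_var M E ^ e * (Var F * ?m)) = (-1) ^ e * flag_degree M {} 0 (flag_insert F l)"
      unfolding e using F flag_list_insert[OF Suc.prems(1)] Suc.prems(2) by (intro Suc.IH) auto
  qed simp
  also have "\<dots> = (-1) ^ e * flag_degree M {} 0 l"
    using flag_degree_insert_containing[OF empty_flat empty_psubset_E Suc.prems(1), of 0 ?j] Suc.prems(2) j
    by (simp flip: sum_distrib_left)
  finally show ?case by simp
qed

text \<open>The empty flat has no variable; with 1 in its place, statements about the part above a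
  flat include the whole ring as the case \<open>A = {}\<close>.\<close>

definition flat_var :: "'a set \<Rightarrow> 'a set_poly" where
  "flat_var A = (if A = {} then 1 else chow_var M A)"

section \<open>Polynomials supported strictly above a flat\<close>

definition above_span :: "'a set \<Rightarrow> nat \<Rightarrow> 'a set_poly set" where
  "above_span A n = rat_span {\<Prod>F\<in>#U. chow_var M F | U. set_mset U \<subseteq> interval A E \<and> size U = n}"

lemma above_spanI: "set_mset U \<subseteq> interval A E \<Longrightarrow> size U = n \<Longrightarrow> (\<Prod>F\<in>#U. chow_var M F) \<in> above_span A n"
  unfolding above_span_def by (rule rat_span_base) auto

lemma above_span_add: "p \<in> above_span A n \<Longrightarrow> q \<in> above_span A n \<Longrightarrow> p + q \<in> above_span A n"
  unfolding above_span_def by (rule rat_span_add)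

lemma above_span_0: "0 \<in> above_span A n"
  unfolding above_span_def by (rule rat_span.zero)

lemma above_span_Const_mult: "p \<in> above_span A n \<Longrightarrow> Const c * p \<in> above_span A n"
  unfolding above_span_def by (rule rat_span_Const_mult)

lemma above_span_sum: "(\<And>x. x \<in> X \<Longrightarrow> f x \<in> above_span A n) \<Longrightarrow> (\<Sum>x\<in>X. f x) \<in> above_span A n"
  unfolding above_span_def by (rule rat_span_sum)

lemma above_span_mult:
  assumes "p \<in> above_span A m" "q \<in> above_span A n"
  shows "p * q \<in> above_span A (m + n)"
  using assms unfolding above_span_def
proof (rule rat_span_mult)
  fix b c assume "b \<in> {\<Prod>F\<in>#U. chow_var M F | U. set_mset U \<subseteq> interval A E \<and> size U = m}"
    "c \<in> {\<Prod>F\<in>#U. chow_var M F | U. set_mset U \<subseteq> interval A E \<and> size U = n}"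
  then obtain U V where "b = (\<Prod>F\<in>#U. chow_var M F)" "set_mset U \<subseteq> interval A E" "size U = m"
    "c = (\<Prod>F\<in>#V. chow_var M F)" "set_mset V \<subseteq> interval A E" "size V = n" by blast
  then show "b * c \<in> rat_span {\<Prod>F\<in>#U. chow_var M F | U. set_mset U \<subseteq> interval A E \<and> size U = m + n}"
    by (intro rat_span_base) (auto intro!: exI[of _ "U + V"])
qed

lemma above_span_mono: "A \<subseteq> B \<Longrightarrow> above_span B n \<subseteq> above_span A n"
  unfolding above_span_def by (rule rat_span_mono) (use interval_mono[of A B E E] in auto)

lemma above_span_1: "1 \<in> above_span A 0"
  using above_spanI[of "{#}" A 0] by simp

lemma above_span_var: "F \<in> interval A E \<Longrightarrow> chow_var M F \<in> above_span A 1"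
  using above_spanI[of "{#F#}" A 1] by simp

lemma above_span_power: "p \<in> above_span A 1 \<Longrightarrow> p ^ n \<in> above_span A n"
proof (induction n)
  case (Suc n)
  then show ?case using above_span_mult[of p A 1 "p ^ n" n] by simp
qed (simp add: above_span_1)

text \<open>No flat lies strictly above \<open>E\<close>, so the span is the constants for
  \<open>n = 0\<close> and zero otherwise. The form with a power of \<open>chow_var M E\<close>
  matches the last term of a normal form.\<close>

lemma above_span_E:
  assumes "p \<in> above_span E n"
  shows "\<exists>c. p = Const c * chow_var M E ^ n \<and> (n \<noteq> 0 \<longrightarrow> c = 0)"
proof -
  have int: "interval E E = {}" by (auto simp: interval_def)
  from assms show ?thesis unfolding above_span_def
  proof (induction rule: rat_span.induct)
    case zero
    show ?case by (rule exI[of _ 0]) simp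
  next
    case (step b p c)
    from step.IH obtain c' where c': "p = Const c' * chow_var M E ^ n" "n \<noteq> 0 \<longrightarrow> c' = 0" by blast
    obtain U where U: "b = (\<Prod>F\<in>#U. chow_var M F)" "set_mset U \<subseteq> interval E E" "size U = n" using step(1) by auto
    have "U = {#}" using U(2) int by simp
    have "n = 0" "b = 1" using \<open>U = {#}\<close> U(3) U(1) by (simp, simp only: image_mset_empty prod_mset.empty)
    then show ?case using c' by (intro exI[of _ "c + c'"]) (simp add: Const_add)
  qed
qed

text \<open>This is \<open>top_vanishing\<close> on the interval from \<open>A\<close> to
  \<open>E\<close>, with the annihilator of \<open>flat_var A\<close> modulo the relations as
  \<open>K\<close>.\<close>

lemma above_span_vanish:
  assumes "A \<in> flats M" "A \<noteq> E" "p \<in> above_span A n" "rk M E \<le> rk M A + n"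
  shows "flat_var A * p \<in> chow_null M"
  using assms(3) unfolding above_span_def
proof (induction rule: rat_span.induct)
  case (step b p c)
  then obtain U where U: "b = (\<Prod>F\<in>#U. chow_var M F)" "set_mset U \<subseteq> interval A E" "size U = n" by blast
  have "(\<Prod>F\<in>#U. chow_var M F) \<in> {z. flat_var A * z \<in> chow_null M}"
  proof (rule top_vanishing[OF _ _ _ assms(1) E_flat])
    show "A \<subset> E" using assms flat_subset by auto
  next
    fix m G H assume *: "G \<in> interval A E" "H \<in> interval A E" "\<not> G \<subseteq> H" "\<not> H \<subseteq> G"
    then have "chow_var M G * chow_var M H \<in> chow_null M" by (intro chow_var_incomparable) (auto simp: interval_def)
    then show "(\<Prod>F\<in>#m. chow_var M F) * (chow_var M G * chow_var M H) \<in> {z. flat_var A * z \<in> chow_null M}"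
      by (simp add: chow_null_mult)
  next
    fix m j assume j: "j \<in> E" "j \<notin> A"
    have "flat_var A * (\<Sum>G\<in>{G \<in> interval A E. j \<in> G}. chow_var M G) \<in> chow_null M"
      using chow_var_linear_above[OF j assms(1)] by (simp add: flat_var_def)
    from chow_null_mult[OF this, of "\<Prod>F\<in>#m. chow_var M F"]
    show "(\<Prod>F\<in>#m. chow_var M F) * (\<Sum>G\<in>{G \<in> interval A E. j \<in> G}. chow_var M G) \<in> {z. flat_var A * z \<in> chow_null M}"
      by (simp add: mult.left_commute)
  qed (use U assms in \<open>auto simp: distrib_left chow_null_add chow_null_minus\<close>)
  then have "flat_var A * (Const c * b) \<in> chow_null M" using U(1) chow_null_mult by (simp add: mult.left_commute)
  then show ?case using step.IH by (simp add: distrib_left chow_null_add)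
qed simp

end

section \<open>Poincare duality\<close>

lemma diff_power_factor: "\<exists>q. a ^ n - b ^ n = (a - b) * (q :: 'r :: comm_ring_1)"
proof (induction n)
  case 0
  show ?case by (rule exI[of _ 0]) simp
next
  case (Suc n)
  then obtain q where q: "a ^ n - b ^ n = (a - b) * q" by blast
  have "a ^ Suc n - b ^ Suc n = (a - b) * a ^ n + b * (a ^ n - b ^ n)" by (simp add: algebra_simps)
  also have "\<dots> = (a - b) * (a ^ n + b * q)" unfolding q by (simp add: algebra_simps)
  finally show ?case by blast
qed

lemma of_nat_Const: "of_nat n = Const (of_nat n)"
  by (induction n) (simp_all add: Const_add)

context nonempty_matroid
begin

text \<open>Up to sign, the generator attached to \<open>G\<close> in the simplicial presentation of
  the Chow ring.\<close>

definition upper_sum :: "'a set \<Rightarrow> 'a set_poly" where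
  "upper_sum G = (\<Sum>H\<in>{H \<in> flats M. G \<subseteq> H}. chow_var M H)"

text \<open>A flat above \<open>G\<close> but not above \<open>H\<close> cannot lie below
  \<open>H\<close>, since \<open>G\<close> does not. So the variable of \<open>H\<close> kills it,
  and the flats above the join remain.\<close>

lemma upper_sum_incomparable:
  assumes "G \<in> flats M" "H \<in> flats M" "\<not> G \<subseteq> H" "\<not> H \<subseteq> G"
  shows "chow_var M H * (upper_sum G - upper_sum (flat_closure M (G \<union> H))) \<in> chow_null M"
proof -
  let ?J = "flat_closure M (G \<union> H)"
  have GH: "G \<union> H \<subseteq> E" using assms flat_subset by blast
  have J: "?J \<subseteq> K \<longleftrightarrow> G \<subseteq> K \<and> H \<subseteq> K" if "K \<in> flats M" for K
    using that closure_least[of K "G \<union> H"] closure_superset[of "G \<union> H"] by blast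
  have "{K \<in> flats M. G \<subseteq> K} = {K \<in> flats M. ?J \<subseteq> K} \<union> {K \<in> flats M. G \<subseteq> K \<and> \<not> H \<subseteq> K}"
    using J by blast
  then have "upper_sum G = upper_sum ?J + (\<Sum>K\<in>{K \<in> flats M. G \<subseteq> K \<and> \<not> H \<subseteq> K}. chow_var M K)"
    unfolding upper_sum_def by (simp only:) (rule sum.union_disjoint, use J in auto)
  moreover have "(\<Sum>K\<in>{K \<in> flats M. G \<subseteq> K \<and> \<not> H \<subseteq> K}. chow_var M H * chow_var M K) \<in> chow_null M"
    using assms by (intro chow_null_sum chow_var_incomparable) auto
  ultimately show ?thesis by (simp add: sum_distrib_left)
qed

text \<open>A Groebner basis relation of Feichtner and Yuzvinsky. For \<open>j \<in> G - A\<close>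
  the linear relation rewrites one factor as minus the sum of the variables of those
  \<open>H\<close> through \<open>j\<close> that do not contain \<open>G\<close>. If
  \<open>H \<subset> G\<close>, the induction applies to \<open>H\<close> and \<open>G\<close>.
  Otherwise the variable of \<open>H\<close> allows \<open>G\<close> to be replaced by its join with
  \<open>H\<close>, whose rank over \<open>H\<close> semimodularity bounds.\<close>

lemma upper_sum_power:
  assumes "A \<in> flats M" "G \<in> flats M" "A \<subset> G" "rk M G \<le> rk M A + r"
  shows "flat_var A * upper_sum G ^ r \<in> chow_null M"
  using assms
proof (induction r arbitrary: A G)
  case 0
  then show ?case using rk_less[of A G] by simp
next
  case (Suc r)
  obtain j where j: "j \<in> G" "j \<notin> A" using Suc.prems(3) by blast
  have jE: "j \<in> E" using j flat_subset[OF Suc.prems(2)] by blast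
  let ?R = "{H \<in> interval A E. j \<in> H \<and> \<not> G \<subseteq> H}"
  have "{H \<in> interval A E. j \<in> H} = {H \<in> flats M. G \<subseteq> H} \<union> ?R"
    using Suc.prems(3) j flat_subset by (auto simp: interval_def)
  then have "(\<Sum>H\<in>{H \<in> interval A E. j \<in> H}. chow_var M H) = upper_sum G + (\<Sum>H\<in>?R. chow_var M H)"
    unfolding upper_sum_def by (simp only:) (rule sum.union_disjoint, auto)
  then have eq: "flat_var A * upper_sum G ^ Suc r = upper_sum G ^ r * (flat_var A * (\<Sum>H\<in>{H \<in> interval A E. j \<in> H}. chow_var M H))
      - (\<Sum>H\<in>?R. flat_var A * (chow_var M H * upper_sum G ^ r))"
    by (simp add: algebra_simps sum_distrib_left)
  have lin: "flat_var A * (\<Sum>H\<in>{H \<in> interval A E. j \<in> H}. chow_var M H) \<in> chow_null M"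
    using chow_var_linear_above[OF jE j(2) Suc.prems(1)] by (simp add: flat_var_def)
  have rest: "(\<Sum>H\<in>?R. flat_var A * (chow_var M H * upper_sum G ^ r)) \<in> chow_null M"
  proof (rule chow_null_sum, rule chow_null_mult)
    fix H assume H: "H \<in> ?R"
    then have Hf: "H \<in> flats M" "A \<subset> H" "j \<in> H" "\<not> G \<subseteq> H" by (auto simp: interval_def)
    then have w: "flat_var H = chow_var M H" by (auto simp: flat_var_def)
    show "chow_var M H * upper_sum G ^ r \<in> chow_null M"
    proof (cases "H \<subseteq> G")
      case True
      then have "H \<subset> G" using Hf by blast
      moreover have "rk M A < rk M H" using rk_less Suc.prems(1) Hf by blast
      ultimately show ?thesis using Suc.IH[OF Hf(1) Suc.prems(2)] Suc.prems(4) w by simp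
    next
      case False
      let ?J = "flat_closure M (G \<union> H)"
      have GH: "G \<union> H \<subseteq> E" using Suc.prems(2) Hf flat_subset by blast
      have K: "G \<inter> H \<in> flats M" using flat_Int Suc.prems(2) Hf by blast
      \<comment> \<open>The element \<open>j\<close> makes the meet strictly larger than
        \<open>A\<close>; this is the one rank gained in passing from \<open>Suc r\<close> to
        \<open>r\<close>.\<close>
      have "A \<subset> G \<inter> H" using Suc.prems(3) Hf j by blast
      then have "rk M A < rk M (G \<inter> H)" using rk_less Suc.prems(1) K by blast
      moreover have "rk M ?J + rk M (G \<inter> H) \<le> rk M H + rk M G"
        using rk_semimodular[OF Suc.prems(2) Hf(1) K] by blast
      ultimately have "rk M ?J \<le> rk M H + r" using Suc.prems(4) by linarith
      moreover have "H \<subset> ?J" using closure_superset[of "G \<union> H"] Hf(4) by blast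
      ultimately have J: "chow_var M H * upper_sum ?J ^ r \<in> chow_null M"
        using Suc.IH[OF Hf(1) closure_flat[OF GH]] w by simp
      obtain q where q: "upper_sum G ^ r - upper_sum ?J ^ r = (upper_sum G - upper_sum ?J) * q"
        using diff_power_factor by blast
      have eq: "chow_var M H * upper_sum G ^ r
          = chow_var M H * (upper_sum G - upper_sum ?J) * q + chow_var M H * upper_sum ?J ^ r"
        unfolding mult.assoc q[symmetric] by (simp add: algebra_simps)
      show ?thesis unfolding eq
        by (rule chow_null_add[OF chow_null_mult2[OF upper_sum_incomparable[OF Suc.prems(2) Hf(1,4) False]] J])
    qed
  qed
  show ?case unfolding eq by (rule chow_null_diff[OF chow_null_mult[OF lin] rest])
qed

text \<open>The Feichtner-Yuzvinsky normal forms, with only the lowest flat of each monomial made explicit.\<close>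

definition normal_forms :: "'a set \<Rightarrow> nat \<Rightarrow> 'a set_poly set" where
  "normal_forms A k =
     {(\<Sum>F\<in>{F \<in> flats M. A \<subset> F \<and> F \<subset> E}. \<Sum>a\<in>{a \<in> {1..k}. rk M A + a < rk M F}. chow_var M F ^ a * g F a)
       + Const c * chow_var M E ^ k | g c. \<forall>F a. g F a \<in> above_span F (k - a)}"

text \<open>Congruence is modulo the annihilator of \<open>flat_var A\<close>, because the relations
  of the interval above \<open>A\<close> hold only after multiplication by that variable.\<close>

definition reducible :: "'a set \<Rightarrow> nat \<Rightarrow> 'a set_poly \<Rightarrow> bool" where
  "reducible A k p \<longleftrightarrow> (\<exists>q\<in>normal_forms A k. flat_var A * (p - q) \<in> chow_null M)"

lemma normal_formsI:
  assumes "\<And>F a. g F a \<in> above_span F (k - a)"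
    and "q = (\<Sum>F\<in>{F \<in> flats M. A \<subset> F \<and> F \<subset> E}. \<Sum>a\<in>{a \<in> {1..k}. rk M A + a < rk M F}. chow_var M F ^ a * g F a)
       + Const c * chow_var M E ^ k"
  shows "q \<in> normal_forms A k"
  unfolding normal_forms_def using assms by blast

lemma normal_forms_add:
  assumes "p \<in> normal_forms A k" "q \<in> normal_forms A k"
  shows "p + q \<in> normal_forms A k"
proof -
  from assms(1) obtain g c where g: "\<forall>F a. g F a \<in> above_span F (k - a)" and p: "p = (\<Sum>F\<in>{F \<in> flats M. A \<subset> F \<and> F \<subset> E}. \<Sum>a\<in>{a \<in> {1..k}. rk M A + a < rk M F}. chow_var M F ^ a * g F a)
       + Const c * chow_var M E ^ k" unfolding normal_forms_def by blast
  from assms(2) obtain h c' where h: "\<forall>F a. h F a \<in> above_span F (k - a)" and q: "q = (\<Sum>F\<in>{F \<in> flats M. A \<subset> F \<and> F \<subset> E}. \<Sum>a\<in>{a \<in> {1..k}. rk M A + a < rk M F}. chow_var M F ^ a * h F a)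
       + Const c' * chow_var M E ^ k" unfolding normal_forms_def by blast
  show ?thesis
  proof (rule normal_formsI)
    show "g F a + h F a \<in> above_span F (k - a)" for F a using g h above_span_add by blast
    show "p + q = (\<Sum>F\<in>{F \<in> flats M. A \<subset> F \<and> F \<subset> E}. \<Sum>a\<in>{a \<in> {1..k}. rk M A + a < rk M F}. chow_var M F ^ a * (g F a + h F a))
       + Const (c + c') * chow_var M E ^ k"
      by (simp add: p q Const_add distrib_left distrib_right sum.distrib)
  qed
qed

lemma normal_forms_Const_mult:
  assumes "p \<in> normal_forms A k"
  shows "Const b * p \<in> normal_forms A k"
proof -
  from assms obtain g c where g: "\<forall>F a. g F a \<in> above_span F (k - a)" and p: "p = (\<Sum>F\<in>{F \<in> flats M. A \<subset> F \<and> F \<subset> E}. \<Sum>a\<in>{a \<in> {1..k}. rk M A + a < rk M F}. chow_var M F ^ a * g F a)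
       + Const c * chow_var M E ^ k" unfolding normal_forms_def by blast
  show ?thesis
  proof (rule normal_formsI)
    show "Const b * g F a \<in> above_span F (k - a)" for F a using g above_span_Const_mult by blast
    show "Const b * p = (\<Sum>F\<in>{F \<in> flats M. A \<subset> F \<and> F \<subset> E}. \<Sum>a\<in>{a \<in> {1..k}. rk M A + a < rk M F}. chow_var M F ^ a * (Const b * g F a))
       + Const (b * c) * chow_var M E ^ k"
      by (simp add: p Const_mult distrib_left sum_distrib_left mult_ac)
  qed
qed

lemma normal_forms_top: "Const c * chow_var M E ^ k \<in> normal_forms A k"
  by (rule normal_formsI[where g = "\<lambda>_ _. 0" and c = c]) (simp_all add: above_span_0)

lemma normal_forms_single:
  assumes "F \<in> flats M" "A \<subset> F" "F \<subset> E" "1 \<le> a" "a \<le> k" "rk M A + a < rk M F" "z \<in> above_span F (k - a)"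
  shows "chow_var M F ^ a * z \<in> normal_forms A k"
proof (rule normal_formsI[where g = "\<lambda>G b. if G = F then if b = a then z else 0 else 0" and c = 0])
  show "(if G = F then if b = a then z else 0 else 0) \<in> above_span G (k - b)" for G b
    using assms(7) by (simp add: above_span_0)
  have "(\<Sum>G\<in>{G \<in> flats M. A \<subset> G \<and> G \<subset> E}. \<Sum>b\<in>{b \<in> {1..k}. rk M A + b < rk M G}. chow_var M G ^ b * (if G = F then if b = a then z else 0 else 0))
      = (\<Sum>G\<in>{G \<in> flats M. A \<subset> G \<and> G \<subset> E}. if G = F then \<Sum>b\<in>{b \<in> {1..k}. rk M A + b < rk M G}. chow_var M G ^ b * (if b = a then z else 0) else 0)"
    by (intro sum.cong) auto
  also have "\<dots> = (\<Sum>b\<in>{b \<in> {1..k}. rk M A + b < rk M F}. chow_var M F ^ b * (if b = a then z else 0))"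
    using assms by simp
  also have "\<dots> = (\<Sum>b\<in>{b \<in> {1..k}. rk M A + b < rk M F}. if b = a then chow_var M F ^ b * z else 0)"
    by (intro sum.cong) auto
  also have "\<dots> = chow_var M F ^ a * z" using assms by simp
  finally show "chow_var M F ^ a * z = (\<Sum>G\<in>{G \<in> flats M. A \<subset> G \<and> G \<subset> E}. \<Sum>b\<in>{b \<in> {1..k}. rk M A + b < rk M G}. chow_var M G ^ b * (if G = F then if b = a then z else 0 else 0))
       + Const 0 * chow_var M E ^ k" by simp
qed

section \<open>Reduction to normal form\<close>

lemma reducible_normal: "q \<in> normal_forms A k \<Longrightarrow> reducible A k q"
  unfolding reducible_def by (rule bexI[of _ q]) auto

lemma reducible_add:
  assumes "reducible A k p" "reducible A k q" shows "reducible A k (p + q)"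
proof -
  obtain p' q' where "p' \<in> normal_forms A k" "flat_var A * (p - p') \<in> chow_null M"
    "q' \<in> normal_forms A k" "flat_var A * (q - q') \<in> chow_null M" using assms unfolding reducible_def by blast
  moreover have "flat_var A * (p + q - (p' + q')) = flat_var A * (p - p') + flat_var A * (q - q')"
    by (simp add: algebra_simps)
  ultimately show ?thesis unfolding reducible_def
    by (intro bexI[of _ "p' + q'"]) (auto intro: normal_forms_add chow_null_add)
qed

lemma reducible_Const_mult:
  assumes "reducible A k p" shows "reducible A k (Const c * p)"
proof -
  obtain p' where "p' \<in> normal_forms A k" "flat_var A * (p - p') \<in> chow_null M"
    using assms unfolding reducible_def by blast
  moreover have "flat_var A * (Const c * p - Const c * p') = Const c * (flat_var A * (p - p'))"
    by (simp add: algebra_simps)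
  ultimately show ?thesis unfolding reducible_def
    by (intro bexI[of _ "Const c * p'"]) (auto intro: normal_forms_Const_mult chow_null_mult)
qed

lemma reducible_0: "reducible A k 0"
  using reducible_normal[OF normal_forms_top[of 0]] by simp

lemma reducible_sum: "(\<And>x. x \<in> X \<Longrightarrow> reducible A k (f x)) \<Longrightarrow> reducible A k (\<Sum>x\<in>X. f x)"
  by (induction X rule: infinite_finite_induct) (auto intro: reducible_0 reducible_add)

lemma reducible_cong:
  assumes "reducible A k p" "flat_var A * (q - p) \<in> chow_null M" shows "reducible A k q"
proof -
  obtain p' where "p' \<in> normal_forms A k" "flat_var A * (p - p') \<in> chow_null M"
    using assms unfolding reducible_def by blast
  moreover have "flat_var A * (q - p') = flat_var A * (q - p) + flat_var A * (p - p')" by (simp add: algebra_simps)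
  ultimately show ?thesis unfolding reducible_def using assms(2) by (metis chow_null_add)
qed

lemma reducible_null: "flat_var A * q \<in> chow_null M \<Longrightarrow> reducible A k q"
  using reducible_cong[OF reducible_0] by simp

lemma mset_prod_incomparable:
  assumes "F \<in># U" "G \<in># U" "F \<in> flats M" "G \<in> flats M" "\<not> F \<subseteq> G" "\<not> G \<subseteq> F"
  shows "(\<Prod>F\<in>#U. chow_var M F) \<in> chow_null M"
proof -
  obtain V where V: "U = add_mset F V" using multi_member_split[OF assms(1)] by blast
  have "G \<noteq> F" using assms(5) by blast
  then have "G \<in># V" using assms(2) V by simp
  from multi_member_split[OF this] obtain W where "V = add_mset G W" by blast
  then have "(\<Prod>F\<in>#U. chow_var M F) = (\<Prod>F\<in>#W. chow_var M F) * (chow_var M F * chow_var M G)"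
    using V by (simp add: mult_ac)
  then show ?thesis using chow_var_incomparable[OF assms(3-6)] by (simp add: chow_null_mult)
qed

text \<open>Monomials are sorted by their least flat. A monomial on a chain has one, whose full
  power splits off; a monomial with incomparable factors is null.\<close>

lemma reducible_span:
  assumes "A \<subseteq> B"
    and step: "\<And>F a z. F \<in> interval B E \<Longrightarrow> a \<le> k \<Longrightarrow> z \<in> above_span F (k - a) \<Longrightarrow> reducible A k (chow_var M F ^ a * z)"
    and p: "p \<in> above_span B k"
  shows "reducible A k p"
  using p unfolding above_span_def
proof (induction rule: rat_span.induct)
  case zero
  show ?case by (rule reducible_0)
next
  case (step b p c)
  from step(1) obtain U where U: "b = (\<Prod>F\<in>#U. chow_var M F)" "set_mset U \<subseteq> interval B E" "size U = k" by auto
  have "reducible A k b"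
  proof (cases "U = {#}")
    case True
    then show ?thesis using U reducible_normal[OF normal_forms_top[of 1 0 A]] by simp
  next
    case False
    show ?thesis
    proof (cases "\<exists>F\<in>#U. \<exists>G\<in>#U. \<not> F \<subseteq> G \<and> \<not> G \<subseteq> F")
      case True
      then obtain F G where FG: "F \<in># U" "G \<in># U" "\<not> F \<subseteq> G" "\<not> G \<subseteq> F" by blast
      then have "F \<in> flats M" "G \<in> flats M" using U(2) by (auto simp: interval_def)
      then have "b \<in> chow_null M" using mset_prod_incomparable FG U(1) by simp
      then show ?thesis by (intro reducible_null chow_null_mult)
    next
      case chain: False
      obtain F where F: "F \<in># U" "\<And>G. G \<in># U \<Longrightarrow> G \<subseteq> F \<Longrightarrow> F = G"
        using finite_has_minimal[of "set_mset U"] False by auto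
      have FG: "F \<subseteq> G" if "G \<in># U" for G
      proof -
        have "F \<subseteq> G \<or> G \<subseteq> F" using chain F(1) that by blast
        then show ?thesis using F(2)[OF that] by auto
      qed
      let ?V = "filter_mset (\<lambda>G. G \<noteq> F) U"
      have split: "U = replicate_mset (count U F) F + ?V"
        by (rule multiset_eqI) auto
      have "set_mset ?V \<subseteq> interval F E"
        using U(2) FG by (auto simp: interval_def)
      moreover have "size U = count U F + size ?V" using split by (metis size_replicate_mset size_union)
      ultimately have V: "(\<Prod>G\<in>#?V. chow_var M G) \<in> above_span F (k - count U F)" "count U F \<le> k"
        using U(3) above_spanI[of ?V F "size ?V"] by simp_all
      have "b = chow_var M F ^ count U F * (\<Prod>G\<in>#?V. chow_var M G)"
        unfolding U(1) by (subst split) simp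
      moreover have "F \<in> interval B E" using F(1) U(2) by blast
      ultimately show ?thesis using assms(2) V by simp
    qed
  qed
  then show ?case using step.IH by (intro reducible_add reducible_Const_mult)
qed

text \<open>Double induction, on the corank of \<open>F\<close> and then on the exponent. From
  \<open>rk M F - rk M A\<close> on, \<open>upper_sum_power\<close> replaces the power of the
  variable of \<open>F\<close> by lower powers times elements above \<open>F\<close>. Exponent 0
  leaves an element above \<open>F\<close>, whose least flats have smaller corank.\<close>

lemma reducible_power:
  assumes "A \<in> flats M" "A \<subset> E" "F \<in> interval A E" "a \<le> k" "z \<in> above_span F (k - a)"
  shows "reducible A k (chow_var M F ^ a * z)"
  using assms(3-5)
proof (induction "rk M E - rk M F" arbitrary: F a z rule: less_induct)
  case outer: (less F)
  have F: "F \<in> flats M" "A \<subset> F" "F \<subseteq> E" using outer.prems(1) by (auto simp: interval_def)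
  show ?case
  proof (cases "F = E")
    case True
    obtain c where c: "z = Const c * chow_var M E ^ (k - a)" "k - a \<noteq> 0 \<longrightarrow> c = 0"
      using above_span_E outer.prems(3) True by blast
    have "chow_var M F ^ a * z = Const c * chow_var M E ^ k"
      using c True outer.prems(2) by (simp add: mult.left_commute flip: power_add)
    then show ?thesis using reducible_normal[OF normal_forms_top] by simp
  next
    case False
    then have FE: "F \<subset> E" using F by blast
    have zero: "reducible A k p" if "p \<in> above_span F k" for p
    proof (rule reducible_span[OF _ _ that])
      fix G b q assume G: "G \<in> interval F E" "b \<le> k" "q \<in> above_span G (k - b)"
      then have "rk M F < rk M G" "rk M G \<le> rk M E" using rk_less[OF F(1)] rk_le by (auto simp: interval_def)
      then show "reducible A k (chow_var M G ^ b * q)"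
        using G F by (intro outer.hyps) (auto simp: interval_def)
    qed (use F in auto)
    from outer.prems(2,3) show ?thesis
    proof (induction a arbitrary: z rule: less_induct)
      case (less a)
      consider "a = 0" | "1 \<le> a" "rk M A + a < rk M F" | "1 \<le> a" "rk M F \<le> rk M A + a" by linarith
      then show ?case
      proof cases
        case 1
        then show ?thesis using zero[of z] less.prems by simp
      next
        case 2
        then show ?thesis using normal_forms_single[OF F(1,2) FE] less.prems by (intro reducible_normal) auto
      next
        case 3
        define r where "r = rk M F - rk M A"
        have r: "r \<le> a" "rk M F \<le> rk M A + r" using 3 by (auto simp: r_def)
        \<comment> \<open>\<open>upper_sum F\<close> is \<open>chow_var M F + v\<close> with
          \<open>v\<close> strictly above \<open>F\<close>, so in the binomial expansion the top
          power of the variable of \<open>F\<close> stands alone.\<close>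
        define v where "v = (\<Sum>H\<in>interval F E. chow_var M H)"
        have vs: "v \<in> above_span F 1" unfolding v_def by (intro above_span_sum above_span_var)
        have "{H \<in> flats M. F \<subseteq> H} = insert F (interval F E)" using F flat_subset by (auto simp: interval_def)
        moreover have "F \<notin> interval F E" by (simp add: interval_def)
        ultimately have s: "upper_sum F = chow_var M F + v" unfolding upper_sum_def v_def by simp
        let ?t = "\<lambda>c. chow_var M F ^ (a - r + c) * (Const (of_nat (r choose c)) * v ^ (r - c) * z)"
        have binom: "upper_sum F ^ r = (\<Sum>c<r. of_nat (r choose c) * chow_var M F ^ c * v ^ (r - c)) + chow_var M F ^ r"
          unfolding s binomial_ring by (simp add: lessThan_Suc_atMost[symmetric])
        have "chow_var M F ^ a = chow_var M F ^ (a - r) * chow_var M F ^ r"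
          using r(1) by (simp flip: power_add)
        then have eq: "chow_var M F ^ a * z - (\<Sum>c<r. - ?t c) = chow_var M F ^ (a - r) * z * upper_sum F ^ r"
          unfolding binom by (simp add: distrib_left sum_distrib_left sum_negf power_add of_nat_Const mult_ac)
        have "flat_var A * upper_sum F ^ r \<in> chow_null M"
          by (rule upper_sum_power[OF assms(1) F(1,2) r(2)])
        from chow_null_mult[OF this, of "chow_var M F ^ (a - r) * z"]
        have "flat_var A * (chow_var M F ^ a * z - (\<Sum>c<r. - ?t c)) \<in> chow_null M"
          unfolding eq by (simp only: mult_ac)
        moreover have "reducible A k (\<Sum>c<r. - ?t c)"
        proof (rule reducible_sum)
          fix c assume c: "c \<in> {..<r}"
          have "Const (of_nat (r choose c)) * v ^ (r - c) * z \<in> above_span F (r - c + (k - a))"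
            using above_span_mult[OF above_span_Const_mult[OF above_span_power[OF vs]] less.prems(2)] .
          moreover have "r - c + (k - a) = k - (a - r + c)" using c r(1) less.prems(1) by auto
          ultimately have "reducible A k (?t c)"
            using c r(1) less.prems(1) by (intro less.IH) auto
          then have "reducible A k (Const (- 1) * ?t c)" by (rule reducible_Const_mult)
          then show "reducible A k (- ?t c)" by (simp add: Const_minus)
        qed
        ultimately show ?thesis by (rule reducible_cong[rotated])
      qed
    qed
  qed
qed

lemma reducible_above_span:
  assumes "A \<in> flats M" "A \<subset> E" "p \<in> above_span A k"
  shows "reducible A k p"
  using reducible_span[OF order_refl _ assms(3)] reducible_power[OF assms(1,2)] by blast

text \<open>All binomials and reduced Whitney numbers in Eur's formula are 1 here, so the degree is
  a sign.\<close>

lemma chow_degree_flat_power: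
  assumes "A \<in> flats M" "A \<subset> E"
  shows "chow_degree M (flat_var A ^ rk M A * chow_var M E ^ (rk M E - rk M A - 1)) \<noteq> 0"
proof (cases "A = {}")
  case True
  show ?thesis using True chow_degree_flag_power[of "[]" "rk M E - 1"] rk_E_pos
    by (simp add: flat_var_def)
next
  case False
  have rk: "0 < rk M A" "rk M A < rk M E" using rk_pos[OF assms(1) False] rk_less[OF assms(1) E_flat assms(2)] by auto
  let ?e = "rk M E - rk M A - 1"
  have l: "flag_list M {} [(A, rk M A)]" using assms False rk by auto
  have "Poly_Mapping.single (list_exponents [(A, rk M A)]) 1 = Var A ^ rk M A"
    using mon_subst_Var[of "Poly_Mapping.single A (rk M A)"] by simp
  also have "\<dots> = flat_var A ^ rk M A" using False assms chow_var_proper[of A] by (auto simp: flat_var_def)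
  finally have "chow_degree M (flat_var A ^ rk M A * chow_var M E ^ ?e) = (-1) ^ ?e * flag_degree M {} 0 [(A, rk M A)]"
    using chow_degree_flag_power[OF l, of ?e] rk by (simp add: mult.commute)
  then show ?thesis by simp
qed

lemma flag_list_restart:
  assumes "flag_list M F l" "\<And>p. p \<in> set l \<Longrightarrow> G \<subset> fst p"
  shows "flag_list M G l"
proof (cases l)
  case (Cons p l')
  obtain H e where p: "p = (H, e)" by (cases p)
  have "G \<subset> H" using assms(2)[of p] Cons p by simp
  then show ?thesis using assms(1) Cons p by simp
qed simp

text \<open>At \<open>A\<close> and at \<open>F\<close> the accumulated degree equals the rank, so
  the binomials there and the Whitney numbers directly above have lower index 0 and are 1. Splitting
  \<open>rk M F\<close> over two flats instead of one only changes how often an exponent is reduced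
  by one, hence the sign.\<close>

lemma chow_degree_power_shift:
  assumes "A \<in> flats M" "F \<in> flats M" "A \<subset> F" "F \<subset> E" "z \<in> above_span F n" "rk M F + n + 1 = rk M E"
  shows "chow_degree M (flat_var A ^ rk M A * (chow_var M F ^ (rk M F - rk M A) * z))
    = (if A = {} then 1 else - 1) * chow_degree M (chow_var M F ^ rk M F * z)"
  using assms(5) unfolding above_span_def
proof (induction rule: rat_span.induct)
  case (step b p c)
  let ?s = "if A = {} then 1 else - 1 :: rat"
  from step(1) obtain U where U: "b = (\<Prod>F\<in>#U. chow_var M F)" "set_mset U \<subseteq> interval F E" "size U = n" by auto
  have "chow_degree M (flat_var A ^ rk M A * (chow_var M F ^ (rk M F - rk M A) * b)) = ?s * chow_degree M (chow_var M F ^ rk M F * b)"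
  proof (cases "A = {}")
    case True
    then show ?thesis by (simp add: flat_var_def)
  next
    case False
    show ?thesis
    proof (cases "\<exists>G\<in>#U. \<exists>H\<in>#U. \<not> G \<subseteq> H \<and> \<not> H \<subseteq> G")
      case True
      then obtain G H where "G \<in># U" "H \<in># U" "\<not> G \<subseteq> H" "\<not> H \<subseteq> G" by blast
      moreover from this have "G \<in> flats M" "H \<in> flats M" using U(2) by (auto simp: interval_def)
      ultimately have "b \<in> chow_null M" using mset_prod_incomparable U(1) by simp
      then show ?thesis using chow_degree_null(1)[of b] by (simp flip: mult.assoc)
    next
      case chain: False
      let ?V = "filter_mset (\<lambda>G. G \<noteq> E) U" and ?e = "count U E"
      have split: "U = replicate_mset ?e E + ?V" by (rule multiset_eqI) auto
      have V: "set_mset ?V \<subseteq> nonempty_proper_flats M" "\<And>G. G \<in># ?V \<Longrightarrow> F \<subset> G"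
        using U(2) by (auto simp: interval_def npf_iff)
      have "\<exists>l. flag_list M {} l \<and> list_exponents l = exponents ?V"
        by (rule flag_list_of_multiset[OF V(1) _ flat_subset]) (use chain in auto)
      then obtain l where l: "flag_list M {} l" "list_exponents l = exponents ?V" by blast
      have "F \<subset> fst p" if "p \<in> set l" for p
        using keys_list_exponents[OF l(1)] l(2) keys_exponents[of ?V] that V(2) by auto
      then have lF: "flag_list M F l" using flag_list_restart[OF l(1)] by blast
      have szV: "sum_list (map snd l) = size ?V"
        using mon_degree_list_exponents[of l] l(2) mon_degree_exponents[of ?V] by simp
      have n: "n = ?e + size ?V" using split U(3) by (metis size_replicate_mset size_union)
      have prodV: "(\<Prod>G\<in>#?V. chow_var M G) = Poly_Mapping.single (list_exponents l) 1"
      proof -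
        have "image_mset (chow_var M) ?V = image_mset Var ?V" by (intro image_mset_cong) (simp add: chow_var_proper)
        then show ?thesis using prod_Var_mset[of ?V] l(2) by simp
      qed
      have b: "b = chow_var M E ^ ?e * Poly_Mapping.single (list_exponents l) 1"
        unfolding U(1) by (subst split) (simp add: prodV)
      have rkA: "0 < rk M A" "rk M A < rk M F" using rk_pos[OF assms(1) False] rk_less[OF assms(1-3)] by auto
      have F0: "F \<noteq> {}" "F \<noteq> E" "A \<noteq> E" using assms by auto
      have l1: "flag_list M {} ((A, rk M A) # (F, rk M F - rk M A) # l)" using lF assms rkA False by auto
      have l2: "flag_list M {} ((F, rk M F) # l)" using lF assms F0 rkA by auto
      have pow: "Poly_Mapping.single (Poly_Mapping.single G m + e) (1 :: rat) = Var G ^ m * Poly_Mapping.single e 1" for G :: "'a set" and m e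
        using mon_subst_Var[of "Poly_Mapping.single G m"] by (simp add: mult_single)
      have e1: "flat_var A ^ rk M A * (chow_var M F ^ (rk M F - rk M A) * b)
          = chow_var M E ^ ?e * Poly_Mapping.single (list_exponents ((A, rk M A) # (F, rk M F - rk M A) # l)) 1"
        using b F0 False by (simp add: flat_var_def chow_var_proper pow mult_ac)
      have e2: "chow_var M F ^ rk M F * b = chow_var M E ^ ?e * Poly_Mapping.single (list_exponents ((F, rk M F) # l)) 1"
        using b F0 by (simp add: chow_var_proper pow mult_ac)
      have d1: "chow_degree M (flat_var A ^ rk M A * (chow_var M F ^ (rk M F - rk M A) * b)) =
          (-1) ^ ?e * flag_degree M {} 0 ((A, rk M A) # (F, rk M F - rk M A) # l)"
        unfolding e1 using szV n assms(6) rkA by (intro chow_degree_flag_power[OF l1]) simp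
      have d2: "chow_degree M (chow_var M F ^ rk M F * b) = (-1) ^ ?e * flag_degree M {} 0 ((F, rk M F) # l)"
        unfolding e2 using szV n assms(6) by (intro chow_degree_flag_power[OF l2]) simp
      have sign: "(-1 :: rat) ^ n = - ((-1) ^ m * (-1) ^ k)" if "n = Suc (m + k)" for n m k
        using that by (simp add: power_add)
      have "rk M F - 1 = Suc ((rk M A - 1) + (rk M F - rk M A - 1))" using rkA by simp
      from sign[OF this] show ?thesis unfolding d1 d2 using False rkA by simp
    qed
  qed
  then show ?case using step.IH
    by (simp add: distrib_left chow_degree_add mult.left_commute[of _ "Const c"] chow_degree_Const_mult)
qed simp

lemma above_span_interval: "F \<in> interval A E \<Longrightarrow> p \<in> above_span F n \<Longrightarrow> p \<in> above_span A n"
  using above_span_mono[of A F n] by (auto simp: interval_def)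

text \<open>Pairing a normal form with \<open>chow_var M F ^ (r - a) * q\<close>, where \<open>r\<close> is the rank jump, isolates
  the coefficient of \<open>chow_var M F ^ a\<close>, provided that those with a smaller flat, or with the
  same flat and a larger exponent, are already known to vanish.\<close>

lemma nondegenerate_above:
  assumes "A \<in> flats M" "A \<subset> E" "p \<in> above_span A k" "k + rk M A < rk M E"
    and "\<And>q. q \<in> above_span A (rk M E - rk M A - 1 - k) \<Longrightarrow> chow_degree M (flat_var A ^ rk M A * (p * q)) = 0"
  shows "flat_var A * p \<in> chow_null M"
  using assms
proof (induction "rk M E - rk M A" arbitrary: A p k rule: less_induct)
  case (less A p k)
  note A = less.prems(1,2)
  let ?I = "{F \<in> flats M. A \<subset> F \<and> F \<subset> E}"
  let ?J = "\<lambda>F. {a \<in> {1..k}. rk M A + a < rk M F}"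
  let ?w = "flat_var A ^ rk M A"
  obtain g c where g: "\<And>F a. g F a \<in> above_span F (k - a)"
    and null: "flat_var A * (p - ((\<Sum>F\<in>?I. \<Sum>a\<in>?J F. chow_var M F ^ a * g F a) + Const c * chow_var M E ^ k)) \<in> chow_null M"
    using reducible_above_span[OF A less.prems(3)] unfolding reducible_def normal_forms_def by blast
  define nf where "nf = (\<Sum>F\<in>?I. \<Sum>a\<in>?J F. chow_var M F ^ a * g F a) + Const c * chow_var M E ^ k"
  have null': "flat_var A * (p - nf) \<in> chow_null M" using null by (simp add: nf_def)
  have wnull: "?w * (p - nf) \<in> chow_null M"
  proof (cases "A = {}")
    case True
    then show ?thesis using null' by (simp add: flat_var_def)
  next
    case False
    then obtain n where "rk M A = Suc n" using rk_pos[OF A(1)] by (cases "rk M A") auto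
    then have "?w * (p - nf) = flat_var A ^ n * (flat_var A * (p - nf))" by (simp add: mult_ac)
    then show ?thesis using chow_null_mult[OF null'] by (simp only:)
  qed
  have nf0: "chow_degree M (?w * (nf * q)) = 0" if "q \<in> above_span A (rk M E - rk M A - 1 - k)" for q
  proof -
    have "?w * (p * q) - ?w * (nf * q) = ?w * (p - nf) * q" by (simp add: algebra_simps)
    then have "?w * (p * q) - ?w * (nf * q) \<in> chow_null M" using chow_null_mult2[OF wnull] by (simp only:)
    then show ?thesis using chow_degree_cong less.prems(5)[OF that] by fastforce
  qed
  have expand: "chow_degree M (?w * (nf * q)) =
      (\<Sum>F\<in>?I. \<Sum>a\<in>?J F. chow_degree M (?w * (chow_var M F ^ a * g F a * q))) + chow_degree M (?w * (Const c * chow_var M E ^ k * q))" for q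
    by (simp add: nf_def distrib_left distrib_right chow_degree_add sum_distrib_left sum_distrib_right chow_degree_sum)
  have Epow: "chow_var M E ^ n \<in> above_span F n" if "F \<subset> E" for F n
    using that E_flat by (intro above_span_power above_span_var) (auto simp: interval_def)
  have coeff: "chow_var M F * g F a \<in> chow_null M" if "F \<in> ?I" "a \<in> ?J F" for F a
    using that
  \<comment> \<open>The measure encodes a lexicographic order, rank first and then decreasing
    exponent; \<open>k - a\<close> stays below \<open>Suc k\<close>.\<close>
  proof (induction "rk M F * Suc k + (k - a)" arbitrary: F a rule: less_induct)
    case inner: (less F a)
    have F: "F \<in> flats M" "A \<subset> F" "F \<subset> E" "1 \<le> a" "a \<le> k" "rk M A + a < rk M F" using inner.prems by auto
    have Fw: "flat_var F = chow_var M F" "F \<noteq> E" using F by (auto simp: flat_var_def)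
    have rkF: "rk M A < rk M F" "rk M F < rk M E" using rk_less[OF A(1) F(1,2)] rk_less[OF F(1) E_flat F(3)] by auto
    have good: "chow_var M H * g H b \<in> chow_null M"
      if "H \<in> ?I" "b \<in> ?J H" "rk M H < rk M F \<or> H = F \<and> a < b" for H b
    proof (rule inner.hyps)
      have "b \<le> k" using that(2) by simp
      show "rk M H * Suc k + (k - b) < rk M F * Suc k + (k - a)"
      proof (cases "rk M H < rk M F")
        case True
        then have "Suc (rk M H) * Suc k \<le> rk M F * Suc k" by (intro mult_le_mono1) simp
        then show ?thesis by simp
      next
        case False
        then show ?thesis using that(3) \<open>b \<le> k\<close> by auto
      qed
    qed (use that in auto)
    show ?case
    \<comment> \<open>Once the degree of the coefficient reaches the corank of \<open>F\<close>, it
      vanishes without any pairing. In the other case the complementary degree below is not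
      truncated.\<close>
    proof (cases "rk M E \<le> rk M F + (k - a)")
      case True
      then show ?thesis using above_span_vanish[OF F(1) Fw(2) g[of F a]] Fw by simp
    next
      case False
      have "flat_var F * g F a \<in> chow_null M"
      proof (rule less.hyps[OF _ F(1,3) g])
        show "rk M E - rk M F < rk M E - rk M A" using rkF by simp
        show "k - a + rk M F < rk M E" using False by simp
        fix q assume q: "q \<in> above_span F (rk M E - rk M F - 1 - (k - a))"
        define r where "r = rk M F - rk M A"
        have r: "a < r" "rk M A + r = rk M F" using F by (auto simp: r_def)
        define q' where "q' = chow_var M F ^ (r - a) * q"
        have FA: "F \<in> interval A E" using F by (auto simp: interval_def)
        have "q' \<in> above_span A (r - a + (rk M E - rk M F - 1 - (k - a)))"
          unfolding q'_def using above_span_interval[OF FA q]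
          by (intro above_span_mult above_span_power above_span_var FA)
        moreover have "r - a + (rk M E - rk M F - 1 - (k - a)) = rk M E - rk M A - 1 - k"
          using r False F(5) rkF by simp
        ultimately have "chow_degree M (?w * (nf * q')) = 0" using nf0 by simp
        have Fr: "chow_var M F ^ (r - a) = chow_var M F * chow_var M F ^ (r - a - 1)"
        proof -
          have "r - a = Suc (r - a - 1)" using r(1) by simp
          then show ?thesis by (metis power_Suc)
        qed
        \<comment> \<open>Together with \<open>q\<close> such an \<open>s\<close> reaches the corank
          of \<open>F\<close> because \<open>a \<ge> 1\<close>, and \<open>q'\<close> still contains
          the variable of \<open>F\<close> because \<open>a < r\<close>.\<close>
        have high: "chow_degree M (?w * (s * q')) = 0" if s: "s \<in> above_span F k" for s
        proof -
          have "s * q \<in> above_span F (k + (rk M E - rk M F - 1 - (k - a)))" using above_span_mult[OF s q] .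
          moreover have "rk M E \<le> rk M F + (k + (rk M E - rk M F - 1 - (k - a)))" using False F(4,5) by simp
          ultimately have "chow_var M F * (s * q) \<in> chow_null M"
            using above_span_vanish[OF F(1) Fw(2)] Fw(1) by metis
          moreover have "?w * (s * q') = ?w * chow_var M F ^ (r - a - 1) * (chow_var M F * (s * q))"
            unfolding q'_def Fr by (simp add: mult_ac)
          ultimately show ?thesis using chow_degree_null(1) by simp
        qed
        have vanish: "chow_degree M (?w * (chow_var M H ^ b * g H b * q')) = 0"
          if H: "H \<in> ?I" "b \<in> ?J H" "\<not> (H = F \<and> b = a)" for H b
        proof -
          have b: "1 \<le> b" "b \<le> k" using H by auto
          have Hb: "chow_var M H ^ b = chow_var M H * chow_var M H ^ (b - 1)" using b(1) power_Suc[of "chow_var M H" "b - 1"] by simp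
          \<comment> \<open>A smaller flat, or the same flat with a larger exponent, is settled by
            induction. The same flat with a smaller exponent, or a larger flat, brings too many
            factors above \<open>F\<close>. Everything else is incomparable.\<close>
          consider "chow_var M H * g H b \<in> chow_null M" | "H = F" "b < a" | "F \<subset> H" | "\<not> H \<subseteq> F" "\<not> F \<subseteq> H"
          proof (cases "H \<subset> F")
            case True
            then have "rk M H < rk M F" using rk_less[OF _ F(1)] H by blast
            then show ?thesis using good[OF H(1,2)] that(1) by blast
          next
            case nsub: False
            show ?thesis
            proof (cases "H = F")
              case True
              then show ?thesis using good[OF H(1,2)] H(3) that(1,2) by (metis linorder_neqE_nat)
            next
              case False
              then show ?thesis using nsub that(3,4) by blast
            qed
          qed
          then show ?thesis
          proof cases
            case 1
            have "?w * (chow_var M H ^ b * g H b * q') = ?w * chow_var M H ^ (b - 1) * q' * (chow_var M H * g H b)"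
              by (simp add: Hb mult_ac)
            then show ?thesis using chow_degree_null(1)[OF 1] by simp
          next
            case 2
            have "g F b * q \<in> above_span F (k - b + (rk M E - rk M F - 1 - (k - a)))" using above_span_mult[OF g q] .
            moreover have "rk M E \<le> rk M F + (k - b + (rk M E - rk M F - 1 - (k - a)))" using False F(5) 2 by simp
            ultimately have "chow_var M F * (g F b * q) \<in> chow_null M"
              using above_span_vanish[OF F(1) Fw(2)] Fw(1) by metis
            moreover have "?w * (chow_var M H ^ b * g H b * q') = ?w * chow_var M F ^ b * chow_var M F ^ (r - a - 1) * (chow_var M F * (g F b * q))"
              by (simp add: 2 q'_def Fr mult_ac)
            ultimately show ?thesis using chow_degree_null(1) by simp
          next
            case 3
            have HF: "H \<in> interval F E" using 3 H(1) by (auto simp: interval_def)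
            have "chow_var M H ^ b * g H b \<in> above_span F (b + (k - b))"
              by (intro above_span_mult above_span_power above_span_var HF above_span_interval[OF HF g])
            then show ?thesis using b by (intro high) simp
          next
            case 4
            have "chow_var M H * chow_var M F \<in> chow_null M" using chow_var_incomparable[of H F] 4 F(1) H(1) by simp
            moreover have "?w * (chow_var M H ^ b * g H b * q') = ?w * chow_var M H ^ (b - 1) * g H b * chow_var M F ^ (r - a - 1) * q * (chow_var M H * chow_var M F)"
              by (simp add: Hb q'_def Fr mult_ac)
            ultimately show ?thesis using chow_degree_null(1) by simp
          qed
        qed
        have "(\<Sum>H\<in>?I. \<Sum>b\<in>?J H. chow_degree M (?w * (chow_var M H ^ b * g H b * q')))
            = (\<Sum>H\<in>{F}. \<Sum>b\<in>?J H. chow_degree M (?w * (chow_var M H ^ b * g H b * q')))"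
        proof (rule sum.mono_neutral_right)
          show "\<forall>H\<in>?I - {F}. (\<Sum>b\<in>?J H. chow_degree M (?w * (chow_var M H ^ b * g H b * q'))) = 0"
          proof (intro ballI sum.neutral)
            fix H b assume "H \<in> ?I - {F}" "b \<in> ?J H"
            then show "chow_degree M (?w * (chow_var M H ^ b * g H b * q')) = 0" by (intro vanish) blast+
          qed
          show "{F} \<subseteq> ?I" using inner.prems by blast
        qed simp
        also have "\<dots> = (\<Sum>b\<in>?J F. chow_degree M (?w * (chow_var M F ^ b * g F b * q')))" by simp
        also have "\<dots> = (\<Sum>b\<in>{a}. chow_degree M (?w * (chow_var M F ^ b * g F b * q')))"
        proof (rule sum.mono_neutral_right)
          show "\<forall>b\<in>?J F - {a}. chow_degree M (?w * (chow_var M F ^ b * g F b * q')) = 0"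
          proof
            fix b assume "b \<in> ?J F - {a}"
            then show "chow_degree M (?w * (chow_var M F ^ b * g F b * q')) = 0"
              by (intro vanish inner.prems(1)) blast+
          qed
          show "{a} \<subseteq> ?J F" using inner.prems by blast
        qed simp
        also have "\<dots> = chow_degree M (?w * (chow_var M F ^ a * g F a * q'))" by simp
        finally have "chow_degree M (?w * (chow_var M F ^ a * g F a * q')) = 0"
          using \<open>chow_degree M (?w * (nf * q')) = 0\<close> expand[of q']
            high[OF above_span_Const_mult[OF Epow[OF F(3)]]] by simp
        moreover have "chow_var M F ^ a * g F a * q' = chow_var M F ^ (rk M F - rk M A) * (g F a * q)"
        proof -
          have "chow_var M F ^ a * chow_var M F ^ (r - a) = chow_var M F ^ r" using r(1) by (simp flip: power_add)
          then have "chow_var M F ^ a * chow_var M F ^ (r - a) * (g F a * q) = chow_var M F ^ r * (g F a * q)" by simp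
          then show ?thesis by (simp add: q'_def r_def mult_ac)
        qed
        moreover have "g F a * q \<in> above_span F (rk M E - rk M F - 1)"
          using above_span_mult[OF g[of F a] q] False F(5) by simp
        \<comment> \<open>The shift turns the pairing relative to \<open>A\<close> into the one
          relative to \<open>F\<close> that the outer induction hypothesis asks for.\<close>
        ultimately have "(if A = {} then 1 else - 1) * chow_degree M (chow_var M F ^ rk M F * (g F a * q)) = 0"
          using chow_degree_power_shift[OF A(1) F(1-3), of "g F a * q" "rk M E - rk M F - 1"] rkF by simp
        then show "chow_degree M (flat_var F ^ rk M F * (g F a * q)) = 0" using Fw by (simp split: if_splits)
      qed
      then show ?thesis using Fw by simp
    qed
  qed
  have vanish: "(\<Sum>F\<in>?I. \<Sum>a\<in>?J F. chow_degree M (?w * (chow_var M F ^ a * g F a * q))) = 0" for q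
  proof (intro sum.neutral ballI)
    fix F a assume Fa: "F \<in> ?I" "a \<in> ?J F"
    have "?w * (chow_var M F ^ a * g F a * q) = ?w * chow_var M F ^ (a - 1) * q * (chow_var M F * g F a)"
      using Fa(2) power_Suc[of "chow_var M F" "a - 1"] by (simp add: mult_ac)
    then show "chow_degree M (?w * (chow_var M F ^ a * g F a * q)) = 0"
      using chow_degree_null(1)[OF coeff[OF Fa]] by simp
  qed
  \<comment> \<open>All coefficients at proper flats are gone; the complementary power of the
    variable of \<open>E\<close> detects the remaining constant.\<close>
  have "chow_degree M (?w * (Const c * chow_var M E ^ k * chow_var M E ^ (rk M E - rk M A - 1 - k))) = 0"
    using nf0[OF Epow[OF A(2)]] unfolding expand vanish by simp
  moreover have "?w * (Const c * chow_var M E ^ k * chow_var M E ^ (rk M E - rk M A - 1 - k))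
      = Const c * (?w * chow_var M E ^ (rk M E - rk M A - 1))"
    using less.prems(4) by (simp add: mult_ac flip: power_add)
  ultimately have "c = 0" using chow_degree_flat_power[OF A] by (simp add: chow_degree_Const_mult)
  moreover have "(\<Sum>F\<in>?I. \<Sum>a\<in>?J F. chow_var M F ^ a * g F a) \<in> chow_null M"
  proof (intro chow_null_sum)
    fix F a assume Fa: "F \<in> ?I" "a \<in> ?J F"
    have "chow_var M F ^ a * g F a = chow_var M F ^ (a - 1) * (chow_var M F * g F a)"
      using Fa(2) power_Suc[of "chow_var M F" "a - 1"] by (simp add: mult_ac)
    then show "chow_var M F ^ a * g F a \<in> chow_null M" using chow_null_mult[OF coeff[OF Fa]] by simp
  qed
  ultimately have "flat_var A * nf \<in> chow_null M" by (simp add: nf_def chow_null_mult)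
  moreover have "flat_var A * p = flat_var A * (p - nf) + flat_var A * nf" by (simp add: algebra_simps)
  ultimately show ?case using chow_null_add[OF null'] by simp
qed

text \<open>Poincare duality on representatives. Test elements of complementary degree isolate each
  homogeneous part; below the rank \<open>nondegenerate_above\<close> applies with the empty flat,
  from the rank on the part vanishes anyway.\<close>

lemma chow_degree_nondegenerate:
  assumes "\<And>q. chow_degree M (p * q) = 0"
  shows "p \<in> chow_null M"
proof -
  let ?p = "substitute (x_poly M) p"
  have eq: "p - ?p \<in> chow_null M"
    by (simp add: chow_null_def substitute_diff retract_id[OF retract_carrier] CH_ideal_closed)
  have deg: "chow_degree M (?p * q) = 0" for q
  proof -
    have "p * q - ?p * q \<in> chow_null M" using chow_null_mult2[OF eq, of q] by (simp add: algebra_simps)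
    then show ?thesis using chow_degree_cong assms by fastforce
  qed
  obtain n f where f: "?p = (\<Sum>k\<le>n. f k)" "\<And>k. homogeneous k (f k)" "\<And>k. vars (f k) \<subseteq> vars ?p"
    using homogeneous_decomposition[of ?p] by metis
  have "f k \<in> chow_null M" if "k \<le> n" for k
  proof -
    have vars: "vars (f k) \<subseteq> nonempty_proper_flats M"
      using f(3) retract_carrier[of M p] unfolding carrier_S_ring by blast
    have "{\<Prod>F\<in>#U. Var F | U. set_mset U \<subseteq> nonempty_proper_flats M \<and> size U = k}
        \<subseteq> {\<Prod>F\<in>#U. chow_var M F | U. set_mset U \<subseteq> interval {} E \<and> size U = k}"
    proof safe
      fix U assume U: "set_mset U \<subseteq> nonempty_proper_flats M" "k = size U"
      have "image_mset Var U = image_mset (chow_var M) U"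
      proof (rule image_mset_cong)
        fix F assume "F \<in># U"
        then have "F \<noteq> E" using U(1) npf_iff by blast
        then show "Var F = chow_var M F" by (simp add: chow_var_proper)
      qed
      moreover have "set_mset U \<subseteq> interval {} E"
      proof
        fix F assume "F \<in># U"
        then have "F \<in> nonempty_proper_flats M" using U(1) by blast
        then show "F \<in> interval {} E" by (auto simp: interval_def npf_iff)
      qed
      ultimately show "\<exists>V. (\<Prod>F\<in>#U. Var F) = (\<Prod>F\<in>#V. chow_var M F) \<and> set_mset V \<subseteq> interval {} E \<and> size V = size U"
        by metis
    qed
    then have span: "f k \<in> above_span {} k"
      unfolding above_span_def using rat_span_mono homogeneous_in_span[OF vars f(2)] by blast
    show ?thesis
    proof (cases "k < rk M E")
      case False
      then show ?thesis using above_span_vanish[OF empty_flat _ span] E_nonempty by (simp add: flat_var_def)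
    next
      case True
      have "flat_var {} * f k \<in> chow_null M"
      proof (rule nondegenerate_above[OF empty_flat empty_psubset_E span])
        show "k + rk M {} < rk M E" using True by simp
        fix q assume "q \<in> above_span {} (rk M E - rk M {} - 1 - k)"
        then have "homogeneous (rk M E - 1 - k) q" unfolding above_span_def
        proof (induction rule: rat_span.induct)
          case (step b p c)
          obtain U where "b = (\<Prod>F\<in>#U. chow_var M F)" "size U = rk M E - 1 - k" using step(1) by auto
          then have "homogeneous (rk M E - 1 - k) b"
            using homogeneous_prod_mset[of U "chow_var M"] homogeneous_chow_var by simp
          then show ?case using step.IH by (intro homogeneous_add homogeneous_Const_mult)
        qed simp
        then have "homogeneous (l + (rk M E - 1 - k)) (f l * q)" for l using homogeneous_mult f(2) by blast
        then have "chow_degree M (f l * q) = 0" if "l \<noteq> k" for l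
          using that True by (intro chow_degree_homogeneous) auto
        then have "chow_degree M (f k * q) = (\<Sum>l\<le>n. chow_degree M (f l * q))"
          using \<open>k \<le> n\<close> by (subst sum.remove[of _ k]) auto
        also have "\<dots> = chow_degree M (?p * q)" unfolding f(1) by (simp add: sum_distrib_right chow_degree_sum)
        finally show "chow_degree M (flat_var {} ^ rk M {} * (f k * q)) = 0" using deg by simp
      qed
      then show ?thesis by (simp add: flat_var_def)
    qed
  qed
  then have "?p \<in> chow_null M" unfolding f(1) by (intro chow_null_sum) auto
  then show ?thesis using chow_null_diff_iff[OF eq] by simp
qed

end

section \<open>Deletion and pullback\<close>

lemma deletion_simps [simp]:
  "ground (deletion M i) = ground M - {i}"
  "flats (deletion M i) = (\<lambda>F. F - {i}) ` flats M"
  by (simp_all add: deletion_def)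

context loopless_matroid
begin

section \<open>The deletion as a matroid; coloops\<close>

lemma deletion_flat_iff:
  "F \<in> flats (deletion M i) \<longleftrightarrow> i \<notin> F \<and> (F \<in> flats M \<or> insert i F \<in> flats M)"
proof
  assume "F \<in> flats (deletion M i)"
  then obtain H where "H \<in> flats M" "F = H - {i}" by auto
  then show "i \<notin> F \<and> (F \<in> flats M \<or> insert i F \<in> flats M)"
    by (cases "i \<in> H") (auto simp: insert_absorb)
next
  assume F: "i \<notin> F \<and> (F \<in> flats M \<or> insert i F \<in> flats M)"
  then have "F = F - {i}" "F = insert i F - {i}" by auto
  then show "F \<in> flats (deletion M i)" using F by (metis deletion_simps(2) imageI)
qed

lemma closure_deletion_flat:
  assumes "F \<in> flats (deletion M i)"
  shows "flat_closure M F \<in> flats M" "flat_closure M F - {i} = F"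
proof -
  have iF: "i \<notin> F" "F \<in> flats M \<or> insert i F \<in> flats M" using assms deletion_flat_iff by auto
  then have "F \<subseteq> E" using flat_subset by blast
  then show "flat_closure M F \<in> flats M" by (rule closure_flat)
  show "flat_closure M F - {i} = F"
  proof
    show "F \<subseteq> flat_closure M F - {i}" using closure_superset[of F] iF by blast
    show "flat_closure M F - {i} \<subseteq> F"
      using iF closure_least[of F F] closure_least[of "insert i F" F] by blast
  qed
qed

text \<open>Closure in \<open>M\<close> followed by removal of \<open>i\<close> is the identity on
  flats of the deletion. Hence covers in the deletion are the traces of covers of the closure, which
  yields both existence and uniqueness.\<close>

lemma deletion_cover:
  assumes F: "F \<in> flats (deletion M i)" and e: "e \<in> E" "e \<noteq> i" "e \<notin> F"
    and G: "covers M (flat_closure M F) G" "e \<in> G"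
  shows "covers (deletion M i) F (G - {i})"
    and "\<And>K. covers (deletion M i) F K \<Longrightarrow> e \<in> K \<Longrightarrow> K = G - {i}"
proof -
  have clF: "flat_closure M F \<in> flats M" "flat_closure M F - {i} = F" using closure_deletion_flat[OF F] .
  have eF: "e \<notin> flat_closure M F" using clF(2) e by blast
  note G' = coversD[OF G(1)]
  show cov: "covers (deletion M i) F (G - {i})"
    unfolding covers_def
  proof (intro conjI)
    show "G - {i} \<in> flats (deletion M i)" using G' by simp
    show "F \<subset> G - {i}" using G'(2) clF e G(2) by blast
    show "\<not> (\<exists>H\<in>flats (deletion M i). F \<subset> H \<and> H \<subset> G - {i})"
    proof
      assume "\<exists>H\<in>flats (deletion M i). F \<subset> H \<and> H \<subset> G - {i}"
      then obtain H where H: "H \<in> flats (deletion M i)" "F \<subset> H" "H \<subset> G - {i}" by blast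
      have clH: "flat_closure M H \<in> flats M" "flat_closure M H - {i} = H" using closure_deletion_flat[OF H(1)] .
      have "flat_closure M F \<subseteq> flat_closure M H"
        using H(2) closure_superset[of H] by (intro closure_least clH) blast
      moreover have "flat_closure M H \<subset> G"
        using H(3) clH(2) closure_least[OF G'(1), of H] by blast
      ultimately have "flat_closure M H = flat_closure M F" using G'(3)[OF clH(1)] by blast
      then show False using H(2) clF(2) clH(2) by auto
    qed
  qed
  fix K assume K: "covers (deletion M i) F K" "e \<in> K"
  have Kf: "K \<in> flats (deletion M i)" "F \<subset> K" using K(1) by (auto simp: covers_def)
  have clK: "flat_closure M K \<in> flats M" "flat_closure M K - {i} = K" using closure_deletion_flat[OF Kf(1)] .
  have "flat_closure M F \<subseteq> flat_closure M K"
    using Kf(2) closure_superset[of K] by (intro closure_least clK) blast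
  then have "G \<subseteq> flat_closure M K"
    using cover_least[OF clF(1) G eF clK(1)] K(2) closure_superset[of K] by blast
  then have "G - {i} \<subseteq> K" using clK(2) by blast
  moreover have "\<not> G - {i} \<subset> K"
    using K(1) cov unfolding covers_def by blast
  ultimately show "K = G - {i}" by blast
qed

lemma deletion_matroid: "matroid (deletion M i)"
  unfolding matroid_def
proof (intro conjI ballI)
  show "finite (ground (deletion M i))" using finite_E by simp
  show "flats (deletion M i) \<subseteq> Pow (ground (deletion M i))" using flat_subset by auto
  show "flats (deletion M i) \<noteq> {}" using E_flat by auto
next
  fix F G assume "F \<in> flats (deletion M i)" "G \<in> flats (deletion M i)"
  then obtain F' G' where "F' \<in> flats M" "F = F' - {i}" "G' \<in> flats M" "G = G' - {i}" by auto
  then have "F \<inter> G = F' \<inter> G' - {i}" "F' \<inter> G' \<in> flats M" using flat_Int by auto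
  then show "F \<inter> G \<in> flats (deletion M i)" by simp
next
  fix F e assume F: "F \<in> flats (deletion M i)" and e: "e \<in> ground (deletion M i) - F"
  have clF: "flat_closure M F \<in> flats M" "flat_closure M F - {i} = F" using closure_deletion_flat[OF F] .
  have e': "e \<in> E" "e \<noteq> i" "e \<notin> F" "e \<notin> flat_closure M F" using e clF by auto
  obtain G where G: "covers M (flat_closure M F) G" "e \<in> G" using unique_cover[OF clF(1) e'(1,4)] by blast
  show "\<exists>!G. covers (deletion M i) F G \<and> e \<in> G"
  proof (rule ex1I[of _ "G - {i}"])
    show "covers (deletion M i) F (G - {i}) \<and> e \<in> G - {i}"
      using deletion_cover(1)[OF F e'(1-3) G] G(2) e'(2) by simp
    show "\<And>K. covers (deletion M i) F K \<and> e \<in> K \<Longrightarrow> K = G - {i}"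
      using deletion_cover(2)[OF F e'(1-3) G] by simp
  qed
qed

lemma deletion_loopless: "loopless (deletion M i)"
  using empty_flat deletion_flat_iff[of "{}" i] by (simp add: loopless_def del: deletion_simps)

text \<open>By \<open>deletion_cover\<close>, closure turns cover steps into cover steps. The rank
  of the deletion can thus be read off in \<open>M\<close>.\<close>

lemma deletion_saturated:
  "saturated (deletion M i) A n B \<Longrightarrow> saturated M (flat_closure M A) n (flat_closure M B)"
proof (induction rule: saturated.induct)
  case (refl A)
  then show ?case using closure_deletion_flat saturated.refl by metis
next
  case (step A A' n B)
  have clA: "flat_closure M A \<in> flats M" "flat_closure M A - {i} = A" using closure_deletion_flat[OF step(1)] .
  have A': "A' \<in> flats (deletion M i)" "A \<subset> A'" using step(2) by (auto simp: covers_def)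
  have clA': "flat_closure M A' \<in> flats M" "flat_closure M A' - {i} = A'" using closure_deletion_flat[OF A'(1)] .
  obtain e where e: "e \<in> A'" "e \<notin> A" using A'(2) by blast
  have e': "e \<in> E" "e \<noteq> i" "e \<notin> flat_closure M A" using e clA clA' flat_subset by blast+
  obtain G where G: "covers M (flat_closure M A) G" "e \<in> G" using unique_cover[OF clA(1) e'(1,3)] by blast
  note G' = coversD[OF G(1)]
  have eq: "A' = G - {i}" using deletion_cover(2)[OF step(1) e'(1,2) e(2) G step(2) e(1)] .
  have "flat_closure M A \<subseteq> flat_closure M A'"
    using A'(2) closure_superset[of A'] by (intro closure_least clA') blast
  then have "G \<subseteq> flat_closure M A'"
    using cover_least[OF clA(1) G e'(3) clA'(1)] e(1) closure_superset[of A'] by blast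
  moreover have "flat_closure M A' \<subseteq> G" using eq by (intro closure_least G'(1)) blast
  ultimately have "flat_closure M A' = G" by blast
  then show ?case using saturated.step[OF clA(1)] G(1) step.IH by simp
qed

lemma rank_deletion: "rank (deletion M i) = rk M (flat_closure M (E - {i}))"
proof -
  interpret N: loopless_matroid "deletion M i"
    using deletion_matroid deletion_loopless by unfold_locales
  have "saturated (deletion M i) {} (rk (deletion M i) (E - {i})) (E - {i})"
    using N.saturated_rk[OF N.E_flat] by simp
  from rk_saturated[OF deletion_saturated[OF this]]
  show ?thesis using N.rank_eq closure_of_flat[OF empty_flat] by simp
qed

text \<open>The closure of \<open>E - {i}\<close> is either \<open>E - {i}\<close> or
  \<open>E\<close>, and only in the first case is its rank smaller.\<close>

lemma coloop_iff:
  assumes "i \<in> E"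
  shows "coloop M i \<longleftrightarrow> E - {i} \<in> flats M"
proof
  assume "coloop M i"
  then have ne: "rk M (flat_closure M (E - {i})) \<noteq> rk M E" by (simp add: coloop_def rank_eq rank_deletion)
  have cl: "flat_closure M (E - {i}) \<in> flats M" "E - {i} \<subseteq> flat_closure M (E - {i})"
    using closure_flat[of "E - {i}"] closure_superset by auto
  have "flat_closure M (E - {i}) \<noteq> E" using ne by auto
  then have "flat_closure M (E - {i}) = E - {i}" using cl flat_subset[OF cl(1)] assms by blast
  then show "E - {i} \<in> flats M" using cl by simp
next
  assume fl: "E - {i} \<in> flats M"
  then have "rk M (E - {i}) < rk M E" using rk_less[OF fl E_flat] assms by blast
  then show "coloop M i" using assms closure_of_flat[OF fl] by (simp add: coloop_def rank_eq rank_deletion)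
qed

end

section \<open>Pullback along the deletion\<close>

locale matroid_element = loopless_matroid +
  fixes i :: 'a
  assumes i_in_E: "i \<in> ground M"
begin

sublocale nonempty_matroid
  using i_in_E by unfold_locales auto

abbreviation N where "N \<equiv> deletion M i"

definition pullback_var :: "'a set \<Rightarrow> 'a set_poly" where
  "pullback_var F = x_poly M F + x_poly M (insert i F)"

abbreviation pullback :: "'a set_poly \<Rightarrow> 'a set_poly" where
  "pullback \<equiv> substitute pullback_var"

lemma npf_deletion_iff:
  "F \<in> nonempty_proper_flats N \<longleftrightarrow>
     F \<noteq> {} \<and> F \<subset> E - {i} \<and> (F \<in> flats M \<or> insert i F \<in> flats M)"
proof -
  have "F \<in> nonempty_proper_flats N \<longleftrightarrow> F \<in> flats N \<and> F \<noteq> E - {i} \<and> F \<noteq> {}"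
    by (auto simp: nonempty_proper_flats_def proper_flats_def)
  also have "\<dots> \<longleftrightarrow> F \<noteq> {} \<and> F \<subset> E - {i} \<and> (F \<in> flats M \<or> insert i F \<in> flats M)"
    unfolding deletion_flat_iff using flat_subset by blast
  finally show ?thesis .
qed

lemma finite_npf_deletion: "finite (nonempty_proper_flats N)"
  using finite_flats by (simp add: nonempty_proper_flats_def proper_flats_def)

lemma pullback_carrier: "pullback p \<in> carrier (S_ring M)"
proof -
  have "vars (pullback_var F) \<subseteq> nonempty_proper_flats M" for F
    using carrier_S_ring_intros(4)[OF carrier_S_ring_intros(8,8)] unfolding carrier_S_ring pullback_var_def by blast
  then show ?thesis unfolding carrier_S_ring by (intro vars_substitute)
qed

lemma homogeneous_pullback: "homogeneous k p \<Longrightarrow> homogeneous k (pullback p)"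
proof (rule homogeneous_substitute)
  have "homogeneous 1 (x_poly M F)" for F
    using homogeneous_Var[of F] by (simp add: x_poly_def)
  then show "homogeneous 1 (pullback_var F)" for F
    unfolding pullback_var_def by (intro homogeneous_add)
qed

lemma pullback_var_null:
  assumes "u * Var F \<in> chow_null M" "u * Var (insert i F) \<in> chow_null M"
  shows "u * pullback_var F \<in> chow_null M"
proof -
  have "u * x_poly M G \<in> chow_null M" if "u * Var G \<in> chow_null M" for G
    using that by (simp add: x_poly_def)
  then show ?thesis using assms by (simp add: pullback_var_def distrib_left chow_null_add)
qed

lemma pullback_var_incomparable:
  assumes "i \<notin> F" "i \<notin> G" "\<not> F \<subseteq> G" "\<not> G \<subseteq> F"
  shows "pullback_var F * pullback_var G \<in> chow_null M"
proof (rule pullback_var_null)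
  have "Var H * pullback_var F \<in> chow_null M" if "H = G \<or> H = insert i G" for H
    using assms that by (intro pullback_var_null incomparable_null) auto
  then show "pullback_var F * Var G \<in> chow_null M" "pullback_var F * Var (insert i G) \<in> chow_null M"
    by (simp_all add: mult.commute)
qed

text \<open>Group the variables by \<open>H - {i}\<close>: the fibre over \<open>G\<close> consists
  of those of \<open>G\<close> and \<open>insert i G\<close> that are nonempty proper flats, and
  they add up to \<open>pullback_var G\<close>. The last two hypotheses make the fibres
  complete.\<close>

lemma sum_pullback_var:
  assumes "finite \<G>" "finite \<H>" "\<H> \<subseteq> nonempty_proper_flats M"
    and "\<And>H. H \<in> \<H> \<Longrightarrow> H - {i} \<in> \<G>" "\<And>G. G \<in> \<G> \<Longrightarrow> i \<notin> G"
    and "\<And>G. G \<in> \<G> \<Longrightarrow> G \<in> nonempty_proper_flats M \<Longrightarrow> G \<in> \<H>"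
    and "\<And>G. G \<in> \<G> \<Longrightarrow> insert i G \<in> nonempty_proper_flats M \<Longrightarrow> insert i G \<in> \<H>"
  shows "(\<Sum>G\<in>\<G>. pullback_var G) = (\<Sum>H\<in>\<H>. Var H)"
proof -
  have "(\<Sum>H\<in>\<H>. Var H) = (\<Sum>G\<in>\<G>. \<Sum>H\<in>{H \<in> \<H>. H - {i} = G}. Var H)"
    using assms(1,2,4) by (subst sum.group) auto
  also have "\<dots> = (\<Sum>G\<in>\<G>. pullback_var G)"
  proof (rule sum.cong)
    fix G assume G: "G \<in> \<G>"
    have "{H \<in> \<H>. H - {i} = G} = {G, insert i G} \<inter> nonempty_proper_flats M"
    proof (intro equalityI subsetI)
      fix H assume "H \<in> {H \<in> \<H>. H - {i} = G}"
      then show "H \<in> {G, insert i G} \<inter> nonempty_proper_flats M" using assms(3) by auto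
    next
      fix H assume H: "H \<in> {G, insert i G} \<inter> nonempty_proper_flats M"
      then have "H - {i} = G" using assms(5)[OF G] by auto
      moreover from H have "H = G \<or> H = insert i G" "H \<in> nonempty_proper_flats M" by simp_all
      then have "H \<in> \<H>" using assms(6,7)[OF G] by (elim disjE) simp_all
      ultimately show "H \<in> {H \<in> \<H>. H - {i} = G}" by simp
    qed
    moreover have "(\<Sum>H\<in>{G, insert i G} \<inter> nonempty_proper_flats M. Var H) = (\<Sum>H\<in>{G, insert i G}. x_poly M H)"
      by (subst sum.inter_restrict) (simp_all add: x_poly_def)
    moreover have "\<dots> = pullback_var G" using assms(5)[OF G] by (subst sum.insert) (auto simp: pullback_var_def)
    ultimately show "(\<Sum>H\<in>{H \<in> \<H>. H - {i} = G}. Var H) = pullback_var G" by simp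
  qed simp
  finally show ?thesis by simp
qed

text \<open>\<open>E - {i}\<close> is the ground set of the deletion and has no variable there,
  hence the exception on the right. It contains every \<open>j \<noteq> i\<close>, so it cancels in
  differences.\<close>

lemma pullback_linear_sum:
  assumes "j \<in> E" "j \<noteq> i"
  shows "(\<Sum>F\<in>{F \<in> nonempty_proper_flats N. j \<in> F}. pullback_var F)
    = (\<Sum>H\<in>{H \<in> nonempty_proper_flats M. j \<in> H} - {E - {i}}. Var H)"
proof (rule sum_pullback_var)
  fix H assume "H \<in> {H \<in> nonempty_proper_flats M. j \<in> H} - {E - {i}}"
  then have H: "H \<in> flats M" "H \<subset> E" "j \<in> H" "H \<noteq> E - {i}" by (auto simp: npf_iff)
  have "H - {i} \<subset> E - {i}" using H i_in_E by blast
  moreover have "H - {i} \<in> flats M \<or> insert i (H - {i}) \<in> flats M" using H by (cases "i \<in> H") (auto simp: insert_absorb)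
  ultimately show "H - {i} \<in> {F \<in> nonempty_proper_flats N. j \<in> F}"
    using H assms unfolding mem_Collect_eq npf_deletion_iff by blast
next
  fix G assume "G \<in> {F \<in> nonempty_proper_flats N. j \<in> F}"
  then have "G \<subset> E - {i}" "j \<in> G" unfolding mem_Collect_eq npf_deletion_iff by auto
  then show "i \<notin> G" "G \<in> nonempty_proper_flats M \<Longrightarrow> G \<in> {H \<in> nonempty_proper_flats M. j \<in> H} - {E - {i}}"
    "insert i G \<in> nonempty_proper_flats M \<Longrightarrow> insert i G \<in> {H \<in> nonempty_proper_flats M. j \<in> H} - {E - {i}}"
    by auto
qed (use finite_npf_deletion finite_npf in auto)

lemma pullback_linear:
  assumes "j \<in> E" "j \<noteq> i" "k \<in> E" "k \<noteq> i"
  shows "(\<Sum>F\<in>{F \<in> nonempty_proper_flats N. j \<in> F}. pullback_var F)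
    - (\<Sum>F\<in>{F \<in> nonempty_proper_flats N. k \<in> F}. pullback_var F) \<in> chow_null M"
proof -
  have "(\<Sum>F\<in>{F \<in> nonempty_proper_flats N. j \<in> F}. pullback_var F)
     = (\<Sum>H\<in>{H \<in> nonempty_proper_flats M. j \<in> H}. Var H) - x_poly M (E - {i})"
    if "j \<in> E" "j \<noteq> i" for j
    unfolding pullback_linear_sum[OF that] using that finite_npf
    by (subst sum_diff1) (auto simp: x_poly_def)
  then show ?thesis using assms linear_null[OF assms(1,3)] by simp
qed

text \<open>This makes \<open>\<theta>_i\<close> well defined on classes: the relations of the
  deletion generate, and their images are relations of \<open>M\<close>.\<close>

lemma pullback_CH_ideal:
  assumes "p \<in> CH_ideal N"
  shows "pullback p \<in> CH_ideal M"
proof -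
  let ?X = "{p \<in> carrier (S_ring N). pullback p \<in> CH_ideal M}"
  have null: "pullback p \<in> CH_ideal M \<longleftrightarrow> pullback p \<in> chow_null M" for p
    using chow_null_carrier[OF pullback_carrier] by simp
  have "CH_ideal N \<subseteq> ?X"
  proof (rule CH_ideal_least)
    show "ideal ?X (S_ring N)"
      by (rule ideal_S_ringI)
        (auto simp: substitute_add substitute_mult intro: carrier_S_ring_intros CH_ideal_closed pullback_carrier)
    show "I_gens N \<subseteq> ?X"
    proof
      fix p assume p: "p \<in> I_gens N"
      then obtain j k where jk: "j \<in> E - {i}" "k \<in> E - {i}" and p': "p = (\<Sum>F\<in>{F \<in> nonempty_proper_flats N. j \<in> F}. Var F) -
          (\<Sum>F\<in>{F \<in> nonempty_proper_flats N. k \<in> F}. Var F)" by (auto simp: I_gens_def)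
      have "pullback p \<in> chow_null M"
        using pullback_linear[of j k] jk unfolding p' by (simp add: substitute_diff substitute_sum)
      then show "p \<in> ?X" using p I_gens_carrier null by blast
    qed
    show "J_gens N \<subseteq> ?X"
    proof
      fix p assume p: "p \<in> J_gens N"
      then obtain F G where FG: "F \<in> nonempty_proper_flats N" "G \<in> nonempty_proper_flats N" "\<not> F \<subseteq> G" "\<not> G \<subseteq> F"
        and p': "p = Var F * Var G" by (auto simp: J_gens_def)
      have "i \<notin> F" "i \<notin> G" using FG unfolding npf_deletion_iff by auto
      then have "pullback p \<in> chow_null M"
        using pullback_var_incomparable FG unfolding p' by (simp add: substitute_mult)
      then show "p \<in> ?X" using p J_gens_carrier null by blast
    qed
  qed
  then show ?thesis using assms by blast
qed

end

section \<open>Decomposition and orthogonality\<close>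

lemma chow_null_shift: "p - q \<in> chow_null M \<Longrightarrow> u * p - u * q \<in> chow_null M"
  using chow_null_mult[of "p - q" M u] by (simp add: right_diff_distrib)

context matroid_element
begin

section \<open>Spanning by the generators\<close>

lemma S_flats_iff: "F \<in> S_flats M i \<longleftrightarrow> F \<noteq> {} \<and> F \<subset> E - {i} \<and> F \<in> flats M \<and> insert i F \<in> flats M"
  by (simp add: S_flats_def)

lemma S_flatsD:
  assumes "F \<in> S_flats M i"
  shows "F \<noteq> {}" "i \<notin> F" "F \<in> nonempty_proper_flats M" "insert i F \<in> nonempty_proper_flats M"
    "F \<in> nonempty_proper_flats N" "pullback_var F = Var F + Var (insert i F)"
proof -
  have F: "F \<noteq> {}" "F \<subset> E - {i}" "F \<in> flats M" "insert i F \<in> flats M" using assms S_flats_iff by auto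
  show "F \<noteq> {}" "i \<notin> F" using F by auto
  show npf: "F \<in> nonempty_proper_flats M" "insert i F \<in> nonempty_proper_flats M" using F i_in_E unfolding npf_iff by auto
  show "F \<in> nonempty_proper_flats N" unfolding npf_deletion_iff using F by simp
  show "pullback_var F = Var F + Var (insert i F)" using npf by (simp add: pullback_var_def x_poly_def)
qed

text \<open>The labels of the generators other than \<open>1\<close>; \<open>E - {i}\<close> occurs only for a coloop.\<close>

definition extra_flats :: "'a set set" where
  "extra_flats = (insert i ` S_flats M i) \<union> (if E - {i} \<in> nonempty_proper_flats M then {E - {i}} else {})"

lemma finite_extra_flats: "finite extra_flats"
proof -
  have "S_flats M i \<subseteq> flats M" by (auto simp: S_flats_def)
  then show ?thesis unfolding extra_flats_def using finite_flats finite_subset by auto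
qed

text \<open>Closed under multiplication by the image of the pullback by construction. Closure under
  multiplication by the generators is what makes it the whole ring.\<close>

definition decomposed :: "'a set_poly set" where
  "decomposed = {w. \<exists>p q. p \<in> carrier (S_ring N) \<and> (\<forall>G. q G \<in> carrier (S_ring N)) \<and>
     w - (pullback p + (\<Sum>G\<in>extra_flats. Var G * pullback (q G))) \<in> chow_null M}"

lemma decomposedI:
  assumes "p \<in> carrier (S_ring N)" "\<And>G. q G \<in> carrier (S_ring N)"
    "w - (pullback p + (\<Sum>G\<in>extra_flats. Var G * pullback (q G))) \<in> chow_null M"
  shows "w \<in> decomposed"
  unfolding decomposed_def using assms by blast

lemma decomposed_cong: "w \<in> decomposed \<Longrightarrow> w' - w \<in> chow_null M \<Longrightarrow> w' \<in> decomposed"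
proof -
  assume "w \<in> decomposed" "w' - w \<in> chow_null M"
  then obtain p q where pq: "p \<in> carrier (S_ring N)" "\<And>G. q G \<in> carrier (S_ring N)"
    "w - (pullback p + (\<Sum>G\<in>extra_flats. Var G * pullback (q G))) \<in> chow_null M" unfolding decomposed_def by blast
  show ?thesis
  proof (rule decomposedI[of p q])
    show "w' - (pullback p + (\<Sum>G\<in>extra_flats. Var G * pullback (q G))) \<in> chow_null M"
      using chow_null_add[OF \<open>w' - w \<in> chow_null M\<close> pq(3)] by (simp add: algebra_simps)
  qed (use pq in auto)
qed

lemma decomposed_add:
  assumes "w \<in> decomposed" "w' \<in> decomposed" shows "w + w' \<in> decomposed"
proof -
  obtain p q where pq: "p \<in> carrier (S_ring N)" "\<And>G. q G \<in> carrier (S_ring N)"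
    "w - (pullback p + (\<Sum>G\<in>extra_flats. Var G * pullback (q G))) \<in> chow_null M" using assms(1) unfolding decomposed_def by blast
  obtain p' q' where pq': "p' \<in> carrier (S_ring N)" "\<And>G. q' G \<in> carrier (S_ring N)"
    "w' - (pullback p' + (\<Sum>G\<in>extra_flats. Var G * pullback (q' G))) \<in> chow_null M" using assms(2) unfolding decomposed_def by blast
  show ?thesis
  proof (rule decomposedI)
    show "p + p' \<in> carrier (S_ring N)" "\<And>G. q G + q' G \<in> carrier (S_ring N)" using pq pq' carrier_S_ring_intros by blast+
    show "w + w' - (pullback (p + p') + (\<Sum>G\<in>extra_flats. Var G * pullback (q G + q' G))) \<in> chow_null M"
      using chow_null_add[OF pq(3) pq'(3)] by (simp add: substitute_add distrib_left sum.distrib algebra_simps)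
  qed
qed

lemma decomposed_mult_pullback:
  assumes "w \<in> decomposed" "r \<in> carrier (S_ring N)" shows "w * pullback r \<in> decomposed"
proof -
  obtain p q where pq: "p \<in> carrier (S_ring N)" "\<And>G. q G \<in> carrier (S_ring N)"
    "w - (pullback p + (\<Sum>G\<in>extra_flats. Var G * pullback (q G))) \<in> chow_null M" using assms(1) unfolding decomposed_def by blast
  show ?thesis
  proof (rule decomposedI)
    show "p * r \<in> carrier (S_ring N)" "\<And>G. q G * r \<in> carrier (S_ring N)" using pq assms(2) carrier_S_ring_intros by blast+
    show "w * pullback r - (pullback (p * r) + (\<Sum>G\<in>extra_flats. Var G * pullback (q G * r))) \<in> chow_null M"
      using chow_null_mult2[OF pq(3), of "pullback r"]
      by (simp add: substitute_mult distrib_right left_diff_distrib sum_distrib_right mult.assoc)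
  qed
qed

lemma decomposed_pullback: "p \<in> carrier (S_ring N) \<Longrightarrow> pullback p \<in> decomposed"
  by (rule decomposedI[of p "\<lambda>_. 0"]) (auto intro: carrier_S_ring_intros)

lemma decomposed_null: "w \<in> chow_null M \<Longrightarrow> w \<in> decomposed"
  by (rule decomposedI[of 0 "\<lambda>_. 0"]) (auto intro: carrier_S_ring_intros)

lemma decomposed_minus: "w \<in> decomposed \<Longrightarrow> - w \<in> decomposed"
  using decomposed_mult_pullback[of w "Const (- 1)"] carrier_S_ring_intros(3)[of "- 1" N] by (simp add: Const_minus substitute_minus)

lemma decomposed_diff: "w \<in> decomposed \<Longrightarrow> w' \<in> decomposed \<Longrightarrow> w - w' \<in> decomposed"
  using decomposed_add[of w "- w'"] decomposed_minus[of w'] by simp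

lemma decomposed_sum: "(\<And>x. x \<in> X \<Longrightarrow> f x \<in> decomposed) \<Longrightarrow> (\<Sum>x\<in>X. f x) \<in> decomposed"
  by (induction X rule: infinite_finite_induct) (auto intro: decomposed_add decomposed_null)

lemma decomposed_extra:
  assumes "G \<in> extra_flats" "q \<in> carrier (S_ring N)" shows "Var G * pullback q \<in> decomposed"
proof (rule decomposedI[of 0 "\<lambda>H. if H = G then q else 0"])
  have "(\<Sum>H\<in>extra_flats. Var H * pullback (if H = G then q else 0)) = (\<Sum>H\<in>extra_flats. if H = G then Var G * pullback q else 0)"
    by (intro sum.cong) auto
  also have "\<dots> = Var G * pullback q" using assms finite_extra_flats by simp
  finally show "Var G * pullback q - (pullback 0 + (\<Sum>H\<in>extra_flats. Var H * pullback (if H = G then q else 0))) \<in> chow_null M"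
    by simp
qed (use assms in \<open>auto intro: carrier_S_ring_intros\<close>)

lemma Var_carrier_N: "F \<in> nonempty_proper_flats N \<Longrightarrow> Var F \<in> carrier (S_ring N)"
  by (simp add: carrier_S_ring)

lemma decomposed_extra_Var:
  assumes "G \<in> extra_flats" shows "Var G \<in> decomposed"
  using decomposed_extra[OF assms, of 1] carrier_S_ring_intros(2)[of N] by simp

lemma decomposed_pullback_var: "F \<in> nonempty_proper_flats N \<Longrightarrow> pullback_var F \<in> decomposed"
  using decomposed_pullback[OF Var_carrier_N] by simp

text \<open>Put \<open>F = H - {i}\<close>. If only one of \<open>F\<close> and
  \<open>insert i F\<close> is a flat, the variable of \<open>H\<close> is \<open>t_F\<close>; if
  both are, it is a generator or \<open>t_F\<close> minus a generator. For \<open>H = {i}\<close>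
  the set \<open>F\<close> would be empty, a label without pullback variable.\<close>

lemma decomposed_Var_nonsingleton:
  assumes H: "H \<in> nonempty_proper_flats M" "H \<noteq> {i}"
  shows "Var H \<in> decomposed"
proof -
  have H': "H \<in> flats M" "H \<noteq> {}" "H \<subset> E" using H npf_iff by auto
  show ?thesis
  proof (cases "H = E - {i} \<or> H \<in> insert i ` S_flats M i")
    case True
    then have "H \<in> extra_flats" using H(1) by (auto simp: extra_flats_def)
    then show ?thesis by (rule decomposed_extra_Var)
  next
    case F: False
    define F where "F = H - {i}"
    have FX: "F \<in> nonempty_proper_flats N"
    proof -
      have "F \<noteq> {}" using H(2) H'(2) by (auto simp: F_def)
      moreover have "F \<subset> E - {i}" using F H'(3) i_in_E by (auto simp: F_def)
      moreover have "F \<in> flats M \<or> insert i F \<in> flats M" using H' by (cases "i \<in> H") (auto simp: F_def insert_absorb)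
      ultimately show ?thesis unfolding npf_deletion_iff by simp
    qed
    have Fp: "F \<noteq> {}" "F \<subset> E - {i}" "i \<notin> F" using FX unfolding npf_deletion_iff by auto
    show ?thesis
    proof (cases "i \<in> H")
      case True
      then have HF: "H = insert i F" by (auto simp: F_def)
      then have "F \<notin> S_flats M i" using F by auto
      then have "F \<notin> flats M" using Fp H' HF S_flats_iff by auto
      then have "pullback_var F = Var H" using H(1) HF by (simp add: pullback_var_def x_poly_def npf_iff)
      then show ?thesis using decomposed_pullback_var[OF FX] by simp
    next
      case False
      then have HF: "H = F" by (auto simp: F_def)
      show ?thesis
      proof (cases "insert i F \<in> flats M")
        case True
        then have S: "F \<in> S_flats M i" using Fp H' HF S_flats_iff by auto
        then have "insert i F \<in> extra_flats" by (simp add: extra_flats_def)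
        then have "pullback_var F - Var (insert i F) \<in> decomposed"
          by (intro decomposed_diff decomposed_pullback_var decomposed_extra_Var FX)
        then show ?thesis using S_flatsD(6)[OF S] HF by simp
      next
        case False
        then have "pullback_var F = Var H" using H(1) HF by (simp add: pullback_var_def x_poly_def npf_iff)
        then show ?thesis using decomposed_pullback_var[OF FX] by simp
      qed
    qed
  qed
qed

lemma singleton_relation:
  assumes "{i} \<in> nonempty_proper_flats M"
  obtains j where "j \<in> E" "j \<noteq> i"
    "Var {i} - ((\<Sum>H\<in>{H \<in> nonempty_proper_flats M. j \<in> H}. Var H)
      - (\<Sum>H\<in>{H \<in> nonempty_proper_flats M. i \<in> H} - {{i}}. Var H)) \<in> chow_null M"
proof -
  obtain j where j: "j \<in> E" "j \<noteq> i" using assms npf_iff by blast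
  have "(\<Sum>H\<in>{H \<in> nonempty_proper_flats M. i \<in> H}. Var H) = Var {i} + (\<Sum>H\<in>{H \<in> nonempty_proper_flats M. i \<in> H} - {{i}}. Var H)"
    using assms finite_npf by (intro sum.remove) auto
  with linear_null[OF i_in_E j(1)] that[OF j] show ?thesis by (simp add: algebra_simps)
qed

text \<open>For \<open>{i}\<close> the linear relation between \<open>i\<close> and some other
  \<open>j\<close> expresses the variable through those already treated.\<close>

lemma decomposed_Var:
  assumes "H \<in> nonempty_proper_flats M" shows "Var H \<in> decomposed"
proof (cases "H = {i}")
  case False
  then show ?thesis using decomposed_Var_nonsingleton assms by blast
next
  case True
  then obtain j where j: "j \<in> E" "j \<noteq> i"
    "Var {i} - ((\<Sum>H\<in>{H \<in> nonempty_proper_flats M. j \<in> H}. Var H)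
      - (\<Sum>H\<in>{H \<in> nonempty_proper_flats M. i \<in> H} - {{i}}. Var H)) \<in> chow_null M"
    using singleton_relation assms by blast
  have "((\<Sum>H\<in>{H \<in> nonempty_proper_flats M. j \<in> H}. Var H)
      - (\<Sum>H\<in>{H \<in> nonempty_proper_flats M. i \<in> H} - {{i}}. Var H)) \<in> decomposed"
    using j(2) by (intro decomposed_diff decomposed_sum decomposed_Var_nonsingleton) auto
  then show ?thesis using decomposed_cong j(3) True by blast
qed

lemma insert_S_flat_incomparable:
  assumes "F \<in> S_flats M i" "i \<notin> G" "\<not> G \<subseteq> F"
  shows "Var (insert i F) * Var G \<in> chow_null M"
  using assms by (intro incomparable_null) auto

text \<open>\<open>G\<close> itself is incomparable with \<open>insert i F\<close>, so only the
  second summand of \<open>t_G\<close> survives.\<close>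

lemma mult_above_S_flat:
  assumes "F \<in> S_flats M i" "F \<subset> G" "i \<notin> G"
  shows "Var (insert i F) * pullback_var G - Var (insert i F) * Var (insert i G) \<in> chow_null M"
proof -
  have "Var (insert i F) * x_poly M G \<in> chow_null M"
    using insert_S_flat_incomparable[OF assms(1,3)] assms(2) by (auto simp: x_poly_def)
  moreover have "Var (insert i F) * (x_poly M (insert i G) - Var (insert i G)) \<in> chow_null M"
    using Var_x_poly_null[of "insert i G" M] chow_null_minus chow_null_mult by (metis minus_diff_eq)
  ultimately show ?thesis
    using chow_null_add by (fastforce simp: pullback_var_def algebra_simps)
qed

lemma extra_extra:
  assumes "F \<in> S_flats M i" "G \<in> S_flats M i" "F \<subset> G"
  shows "Var (insert i F) * Var (insert i G) - Var (insert i F) * pullback (Var G) \<in> chow_null M"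
  using chow_null_minus[OF mult_above_S_flat[OF assms(1,3)]] S_flatsD(2)[OF assms(2)] by simp

lemma coatom_S_flat:
  assumes "F \<in> S_flats M i" shows "Var (E - {i}) * Var (insert i F) \<in> chow_null M"
  using assms unfolding S_flats_iff by (intro incomparable_null) auto

text \<open>The linear relation between \<open>i\<close> and some \<open>j\<close> outside
  \<open>insert i F\<close> expresses the square by products with other flats. Those through
  \<open>j\<close> only are incomparable with \<open>insert i F\<close>, those through both elements
  cancel, and those through \<open>i\<close> only are treated by their position.\<close>

lemma extra_square:
  assumes S: "F \<in> S_flats M i" shows "Var (insert i F) * Var (insert i F) \<in> decomposed"
proof -
  note F = S_flatsD[OF S]
  have FE: "insert i F \<in> flats M" "F \<in> flats M" "insert i F \<subset> E" using F(3,4) npf_iff by auto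
  then obtain j where j: "j \<in> E" "j \<notin> insert i F" by blast
  let ?u = "Var (insert i F)"
  let ?A = "{H \<in> nonempty_proper_flats M. i \<in> H}" and ?B = "{H \<in> nonempty_proper_flats M. j \<in> H}"
  let ?A' = "{H \<in> ?A. j \<notin> H \<and> H \<noteq> insert i F}" and ?B' = "{H \<in> ?B. i \<notin> H}"
  let ?C = "{H \<in> ?A. j \<in> H}"
  have A: "?A = insert (insert i F) (?A' \<union> ?C)" using F j by auto
  have fin: "finite ?A'" "finite ?B'" "finite ?C" using finite_npf by auto
  have sA: "(\<Sum>H\<in>?A. Var H) = ?u + ((\<Sum>H\<in>?A'. Var H) + (\<Sum>H\<in>?C. Var H))"
  proof -
    have "(\<Sum>H\<in>?A. Var H) = (\<Sum>H\<in>insert (insert i F) (?A' \<union> ?C). Var H)"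
      using A by (rule arg_cong)
    also have "\<dots> = ?u + (\<Sum>H\<in>?A' \<union> ?C. Var H)"
      using fin j by (intro sum.insert) auto
    also have "(\<Sum>H\<in>?A' \<union> ?C. Var H) = (\<Sum>H\<in>?A'. Var H) + (\<Sum>H\<in>?C. Var H)"
      using fin by (intro sum.union_disjoint) auto
    finally show ?thesis .
  qed
  have sB: "(\<Sum>H\<in>?B. Var H) = (\<Sum>H\<in>?B'. Var H) + (\<Sum>H\<in>?C. Var H)"
  proof -
    have "?B = ?B' \<union> ?C" by auto
    then have "(\<Sum>H\<in>?B. Var H) = (\<Sum>H\<in>?B' \<union> ?C. Var H)" by (rule arg_cong)
    also have "\<dots> = (\<Sum>H\<in>?B'. Var H) + (\<Sum>H\<in>?C. Var H)" using fin by (intro sum.union_disjoint) auto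
    finally show ?thesis .
  qed
  have "?u * (?u + ((\<Sum>H\<in>?A'. Var H) + (\<Sum>H\<in>?C. Var H)) - ((\<Sum>H\<in>?B'. Var H) + (\<Sum>H\<in>?C. Var H))) \<in> chow_null M"
    using linear_null[OF i_in_E j(1)] unfolding sA sB by (rule chow_null_mult)
  moreover have "?u * (?u + ((\<Sum>H\<in>?A'. Var H) + (\<Sum>H\<in>?C. Var H)) - ((\<Sum>H\<in>?B'. Var H) + (\<Sum>H\<in>?C. Var H)))
      = ?u * ?u - ((\<Sum>H\<in>?B'. ?u * Var H) - (\<Sum>H\<in>?A'. ?u * Var H))"
    by (simp add: algebra_simps sum_distrib_left)
  ultimately have eq: "?u * ?u - ((\<Sum>H\<in>?B'. ?u * Var H) - (\<Sum>H\<in>?A'. ?u * Var H)) \<in> chow_null M" by (simp only:)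
  have "(\<Sum>H\<in>?B'. ?u * Var H) \<in> decomposed"
  proof (rule decomposed_sum, rule decomposed_null)
    fix H assume "H \<in> ?B'"
    then show "?u * Var H \<in> chow_null M" using j by (intro insert_S_flat_incomparable S) auto
  qed
  moreover have "(\<Sum>H\<in>?A'. ?u * Var H) \<in> decomposed"
  proof (rule decomposed_sum)
    fix H assume H: "H \<in> ?A'"
    then have Hf: "H \<in> flats M" "H \<subset> E" "i \<in> H" "j \<notin> H" "H \<noteq> insert i F" "H \<in> nonempty_proper_flats M"
      by (auto simp: npf_iff)
    define H' where "H' = H - {i}"
    have HH: "H = insert i H'" "i \<notin> H'" using Hf by (auto simp: H'_def)
    \<comment> \<open>Above \<open>insert i F\<close> the variable of \<open>H\<close> acts as
      \<open>t_H'\<close>. Below it the roles are exchanged: the variable of \<open>H\<close> kills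
      that of \<open>F\<close>, so \<open>?u\<close> acts on it as \<open>t_F\<close>, and
      \<open>Var H\<close> is decomposed already.\<close>
    consider "\<not> H \<subseteq> insert i F" "\<not> insert i F \<subseteq> H" | "F \<subset> H'" | "H' \<subset> F"
      using Hf(5) HH F(2) by blast
    then show "?u * Var H \<in> decomposed"
    proof cases
      case 1
      show ?thesis using decomposed_null[OF incomparable_null[OF 1(2,1)]] .
    next
      case 2
      have "H' \<in> nonempty_proper_flats N"
        unfolding npf_deletion_iff using 2 Hf HH j by auto
      then have "?u * pullback_var H' \<in> decomposed"
        using decomposed_mult_pullback[OF decomposed_extra_Var Var_carrier_N] S by (simp add: extra_flats_def)
      moreover have "?u * Var H - ?u * pullback_var H' \<in> chow_null M"
        using chow_null_minus[OF mult_above_S_flat[OF S 2 HH(2)]] HH by simp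
      ultimately show ?thesis using decomposed_cong by blast
    next
      case 3
      have "Var H * pullback_var F \<in> decomposed"
        using decomposed_mult_pullback[OF decomposed_Var[OF Hf(6)] Var_carrier_N[OF F(5)]] by simp
      moreover have "Var H * Var F \<in> chow_null M" using 3 HH F(2) by (intro incomparable_null) auto
      then have "?u * Var H - Var H * pullback_var F \<in> chow_null M"
        unfolding F(6) using chow_null_minus by (simp add: algebra_simps)
      ultimately show ?thesis using decomposed_cong by blast
    qed
  qed
  ultimately have "(\<Sum>H\<in>?B'. ?u * Var H) - (\<Sum>H\<in>?A'. ?u * Var H) \<in> decomposed" by (rule decomposed_diff)
  then show ?thesis using decomposed_cong eq by blast
qed

text \<open>Proper flats through \<open>i\<close> are incomparable with \<open>E - {i}\<close>, so
  in the linear relation between \<open>j\<close> and \<open>i\<close> only flats through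
  \<open>j\<close> survive; apart from \<open>E - {i}\<close> they form a pullback.\<close>

lemma coatom_square:
  assumes "E - {i} \<in> nonempty_proper_flats M"
  obtains a where "a \<in> carrier (S_ring N)"
    "Var (E - {i}) * Var (E - {i}) + Var (E - {i}) * pullback a \<in> chow_null M"
proof -
  let ?u = "Var (E - {i})"
  obtain j where j: "j \<in> E" "j \<noteq> i" using assms unfolding npf_iff by blast
  let ?a = "\<Sum>F\<in>{F \<in> nonempty_proper_flats N. j \<in> F}. Var F"
  let ?B = "{H \<in> nonempty_proper_flats M. j \<in> H}"
  have a: "?a \<in> carrier (S_ring N)" unfolding carrier_S_ring by (rule vars_sum) simp
  have pa: "pullback ?a = (\<Sum>H\<in>?B - {E - {i}}. Var H)"
    using pullback_linear_sum[OF j] by (simp add: substitute_sum)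
  have "(\<Sum>H\<in>?B. Var H) = ?u + pullback ?a" unfolding pa using assms j finite_npf by (intro sum.remove) auto
  then have "?u * (?u + pullback ?a - (\<Sum>H\<in>{H \<in> nonempty_proper_flats M. i \<in> H}. Var H)) \<in> chow_null M"
    using linear_null[OF j(1) i_in_E] chow_null_mult by simp
  moreover have "(\<Sum>H\<in>{H \<in> nonempty_proper_flats M. i \<in> H}. ?u * Var H) \<in> chow_null M"
  proof (rule chow_null_sum)
    fix H assume "H \<in> {H \<in> nonempty_proper_flats M. i \<in> H}"
    then have "i \<in> H" "H \<subset> E" by (auto simp: npf_iff)
    then show "?u * Var H \<in> chow_null M" by (intro incomparable_null) auto
  qed
  ultimately have "?u * (?u + pullback ?a) \<in> chow_null M"
    using chow_null_add by (fastforce simp: right_diff_distrib sum_distrib_left)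
  then show ?thesis using that[OF a] by (simp add: distrib_left)
qed

lemma decomposed_extra_mult:
  assumes "G \<in> extra_flats" "H \<in> extra_flats" shows "Var G * Var H \<in> decomposed"
proof -
  have SS: "Var (insert i F) * Var (insert i F') \<in> decomposed" if "F \<in> S_flats M i" "F' \<in> S_flats M i" for F F'
  proof -
    have sub: "Var (insert i F) * Var (insert i F') \<in> decomposed" if "F \<subset> F'" "F \<in> S_flats M i" "F' \<in> S_flats M i" for F F'
    proof -
      have "Var (insert i F) * pullback (Var F') \<in> decomposed"
        using that S_flatsD(5) by (intro decomposed_extra Var_carrier_N) (auto simp: extra_flats_def)
      then show ?thesis using decomposed_cong extra_extra that by blast
    qed
    consider "F = F'" | "F \<subset> F'" | "F' \<subset> F" | "\<not> F \<subseteq> F'" "\<not> F' \<subseteq> F" by blast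
    then show ?thesis
    proof cases
      case 1
      then show ?thesis using extra_square that by simp
    next
      case 2
      then show ?thesis using sub that by blast
    next
      case 3
      then show ?thesis using sub[OF 3] that by (simp add: mult.commute)
    next
      case 4
      then have "Var (insert i F) * Var (insert i F') \<in> chow_null M"
        using S_flatsD(2) that by (intro incomparable_null) blast+
      then show ?thesis by (rule decomposed_null)
    qed
  qed
  have ES: "Var (E - {i}) * Var (insert i F) \<in> decomposed" if "F \<in> S_flats M i" for F
    using coatom_S_flat[OF that] by (rule decomposed_null)
  have EE: "Var (E - {i}) * Var (E - {i}) \<in> decomposed" if coatom: "E - {i} \<in> nonempty_proper_flats M"
  proof -
    obtain a where a: "a \<in> carrier (S_ring N)" "Var (E - {i}) * Var (E - {i}) + Var (E - {i}) * pullback a \<in> chow_null M"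
      using coatom_square[OF coatom] by blast
    have "- (Var (E - {i}) * pullback a) \<in> decomposed"
      using a(1) coatom by (intro decomposed_minus decomposed_extra) (auto simp: extra_flats_def)
    then show ?thesis by (rule decomposed_cong) (use a(2) in simp)
  qed
  from assms show ?thesis using SS ES EE unfolding extra_flats_def
    by (auto split: if_splits) (simp add: mult.commute)
qed

lemma decomposed_mult_extra:
  assumes "w \<in> decomposed" "G \<in> extra_flats" shows "Var G * w \<in> decomposed"
proof -
  obtain p q where pq: "p \<in> carrier (S_ring N)" "\<And>G. q G \<in> carrier (S_ring N)"
    "w - (pullback p + (\<Sum>G\<in>extra_flats. Var G * pullback (q G))) \<in> chow_null M" using assms(1) unfolding decomposed_def by blast
  have "Var G * pullback p + (\<Sum>H\<in>extra_flats. Var G * Var H * pullback (q H)) \<in> decomposed"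
    by (intro decomposed_add decomposed_extra decomposed_sum decomposed_mult_pullback decomposed_extra_mult assms pq)
  then show ?thesis using chow_null_shift[OF pq(3), of "Var G"]
    by (elim decomposed_cong) (simp add: distrib_left sum_distrib_left mult.assoc)
qed

text \<open>The multipliers preserving \<open>decomposed\<close> are closed under sums and products
  and contain the generators, hence all decomposed elements. As every variable is decomposed,
  induction over polynomials gives the whole ring.\<close>

definition stable :: "'a set_poly \<Rightarrow> bool" where
  "stable u \<longleftrightarrow> (\<forall>w\<in>decomposed. u * w \<in> decomposed)"

lemma stable_pullback: "p \<in> carrier (S_ring N) \<Longrightarrow> stable (pullback p)"
  unfolding stable_def using decomposed_mult_pullback by (simp add: mult.commute)

lemma stable_extra: "G \<in> extra_flats \<Longrightarrow> stable (Var G)"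
  unfolding stable_def using decomposed_mult_extra by blast

lemma stable_add: "stable u \<Longrightarrow> stable v \<Longrightarrow> stable (u + v)"
  unfolding stable_def using decomposed_add by (simp add: distrib_right)

lemma stable_mult: "stable u \<Longrightarrow> stable v \<Longrightarrow> stable (u * v)"
  unfolding stable_def by (simp add: mult.assoc)

lemma stable_sum: "(\<And>x. x \<in> X \<Longrightarrow> stable (f x)) \<Longrightarrow> stable (\<Sum>x\<in>X. f x)"
  unfolding stable_def sum_distrib_right by (auto intro: decomposed_sum)

lemma stable_cong: "stable v \<Longrightarrow> u - v \<in> chow_null M \<Longrightarrow> stable u"
  unfolding stable_def using decomposed_cong chow_null_mult2[of "u - v" M] by (metis left_diff_distrib)

lemma decomposed_stable: "w \<in> decomposed \<Longrightarrow> stable w"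
proof -
  assume "w \<in> decomposed"
  then obtain p q where pq: "p \<in> carrier (S_ring N)" "\<And>G. q G \<in> carrier (S_ring N)"
    "w - (pullback p + (\<Sum>G\<in>extra_flats. Var G * pullback (q G))) \<in> chow_null M" unfolding decomposed_def by blast
  show ?thesis
    by (rule stable_cong[OF _ pq(3)]) (intro stable_add stable_sum stable_mult stable_extra stable_pullback pq; assumption)
qed

lemma decomposed_all: "w \<in> decomposed"
proof -
  have carrier: "p \<in> decomposed" if "vars p \<subseteq> nonempty_proper_flats M" for p
    using that
  proof (induction p rule: set_poly_induct)
    case (Const c)
    then show ?case using decomposed_pullback[of "Const c"] carrier_S_ring_intros(3)[of c N] by simp
  next
    case (add p q)
    then show ?case by (intro decomposed_add)
  next
    case (Var F p)
    then show ?case using decomposed_stable[OF decomposed_Var] unfolding stable_def by blast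
  qed
  have "substitute (x_poly M) w \<in> decomposed"
    using carrier retract_carrier[of M w] unfolding carrier_S_ring by blast
  moreover have "w - substitute (x_poly M) w \<in> chow_null M"
    by (simp add: chow_null_def substitute_diff retract_id[OF retract_carrier] CH_ideal_closed)
  ultimately show ?thesis by (rule decomposed_cong)
qed

section \<open>Vanishing in top degree and orthogonality of the generators\<close>

lemma rk_insert_S_flat:
  assumes "F \<in> S_flats M i" shows "rk M (insert i F) = Suc (rk M F)"
proof (rule rk_cover)
  have F: "F \<in> flats M" "insert i F \<in> flats M" "i \<notin> F" using assms S_flats_iff by auto
  then show "covers M F (insert i F)" unfolding covers_def by blast
qed (use assms S_flats_iff in simp)

text \<open>The intervals for \<open>P\<close> and \<open>Q\<close> have lengths
  \<open>rk M F\<close> and \<open>rk M E - rk M F - 1\<close>, adding up to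
  \<open>rk M E - 1\<close>. With at least \<open>rk M E - 2\<close> factors one of them is
  filled.\<close>

lemma S_flat_split_vanishing:
  assumes S: "F \<in> S_flats M i"
    and "set_mset P \<subseteq> interval {} F" "set_mset Q \<subseteq> interval (insert i F) E" "rk M E \<le> size P + size Q + 2"
  shows "Var (insert i F) * (\<Prod>G\<in>#P. pullback_var G) * (\<Prod>G\<in>#Q. chow_var M G) \<in> chow_null M"
  using assms(2-4)
proof (induction "size P" arbitrary: P Q rule: less_induct)
  case (less P Q)
  let ?u = "Var (insert i F)"
  note F = S_flatsD[OF S]
  have FE: "insert i F \<in> flats M" "F \<in> flats M" "insert i F \<noteq> E" "insert i F \<subset> E"
    using F(3,4) by (simp_all add: npf_iff psubset_eq)
  have u: "flat_var (insert i F) = ?u" "chow_var M (insert i F) = ?u" using FE by (auto simp: flat_var_def chow_var_proper)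
  show ?case
  proof (cases "rk M E \<le> rk M (insert i F) + size Q")
    case True
    have "?u * (\<Prod>G\<in>#Q. chow_var M G) \<in> chow_null M"
      using above_span_vanish[OF FE(1,3) above_spanI[OF less.prems(2) HOL.refl] True] u by simp
    from chow_null_mult[OF this, of "\<Prod>G\<in>#P. pullback_var G"] show ?thesis by (simp add: mult_ac)
  next
    case False
    let ?K = "{z. ?u * (\<Prod>G\<in>#Q. chow_var M G) * z \<in> chow_null M}"
    have "(\<Prod>G\<in>#P. pullback_var G) \<in> ?K"
    proof (rule top_vanishing[OF _ _ _ empty_flat FE(2)])
      show "0 \<in> ?K" by simp
      show "\<And>a b. a \<in> ?K \<Longrightarrow> b \<in> ?K \<Longrightarrow> a + b \<in> ?K" by (simp add: distrib_left chow_null_add)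
      show "\<And>a. a \<in> ?K \<Longrightarrow> - a \<in> ?K" by (simp add: chow_null_minus)
      show "{} \<subset> F" using F(1) by blast
      show "set_mset P \<subseteq> interval {} F" "size P = size P" using less.prems by auto
      show "rk M F \<le> rk M {} + size P" using False less.prems(3) rk_insert_S_flat[OF S] by simp
    next
      fix m G H assume "G \<in> interval {} F" "H \<in> interval {} F" "\<not> G \<subseteq> H" "\<not> H \<subseteq> G"
      then have "pullback_var G * pullback_var H \<in> chow_null M"
        using F(2) by (intro pullback_var_incomparable) (auto simp: interval_def)
      then show "(\<Prod>F\<in>#m. pullback_var F) * (pullback_var G * pullback_var H) \<in> ?K"
        by (simp add: chow_null_mult)
    next
      fix m j assume m: "set_mset m \<subseteq> interval {} F" "size m + 1 = size P" and j: "j \<in> F" "j \<notin> {}"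
      have jE: "j \<in> E" "j \<noteq> i" using j FE(2) flat_subset F(2) by auto
      let ?v = "(\<Prod>G\<in>#Q. chow_var M G) * (\<Prod>G\<in>#m. pullback_var G)"
      let ?X = "{H \<in> nonempty_proper_flats M. j \<in> H \<and> H \<subseteq> insert i F}"
      let ?U = "interval (insert i F) E" and ?R = "{H \<in> flats M. j \<in> H \<and> \<not> H \<subseteq> insert i F \<and> \<not> insert i F \<subseteq> H}"
      \<comment> \<open>The lower linear form is the part on flats contained in
        \<open>insert i F\<close> of a linear form of \<open>M\<close>. What is missing either lies
        strictly above, where it enlarges \<open>Q\<close> at the expense of \<open>P\<close>, or is
        incomparable and killed by \<open>?u\<close>.\<close>
      have low: "(\<Sum>G\<in>{G \<in> interval {} F. j \<in> G}. pullback_var G) = (\<Sum>H\<in>?X. chow_var M H)"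
      proof -
        have "(\<Sum>G\<in>{G \<in> interval {} F. j \<in> G}. pullback_var G) = (\<Sum>H\<in>?X. Var H)"
        proof (rule sum_pullback_var)
          fix H assume H: "H \<in> ?X"
          then have "H \<inter> F \<in> flats M" using flat_Int FE(2) npf_iff by auto
          moreover have "H \<inter> F = H - {i}" using H F(2) by auto
          ultimately show "H - {i} \<in> {G \<in> interval {} F. j \<in> G}"
            using H jE(2) j unfolding interval_def by auto
        qed (use finite_npf F(2) in \<open>auto simp: interval_def\<close>)
        also have "\<dots> = (\<Sum>H\<in>?X. chow_var M H)"
        proof (rule sum.cong)
          fix H assume "H \<in> ?X"
          then have "H \<noteq> E" using npf_iff by blast
          then show "Var H = chow_var M H" by (simp add: chow_var_proper)
        qed simp
        finally show ?thesis .
      qed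
      have "{H \<in> flats M. j \<in> H} = ?X \<union> (?U \<union> ?R)"
        using j FE flat_subset by (auto simp: interval_def npf_iff)
      moreover have "(\<Sum>H\<in>?X \<union> (?U \<union> ?R). chow_var M H) = (\<Sum>H\<in>?X. chow_var M H) + ((\<Sum>H\<in>?U. chow_var M H) + (\<Sum>H\<in>?R. chow_var M H))"
      proof -
        have "(\<Sum>H\<in>?X \<union> (?U \<union> ?R). chow_var M H) = (\<Sum>H\<in>?X. chow_var M H) + (\<Sum>H\<in>?U \<union> ?R. chow_var M H)"
          using finite_npf by (intro sum.union_disjoint) (auto simp: interval_def)
        also have "(\<Sum>H\<in>?U \<union> ?R. chow_var M H) = (\<Sum>H\<in>?U. chow_var M H) + (\<Sum>H\<in>?R. chow_var M H)"
          by (intro sum.union_disjoint) (auto simp: interval_def)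
        finally show ?thesis .
      qed
      ultimately have total: "(\<Sum>H\<in>?X. chow_var M H) + ((\<Sum>H\<in>?U. chow_var M H) + (\<Sum>H\<in>?R. chow_var M H)) \<in> chow_null M"
        using chow_var_linear[OF jE(1)] by simp
      have "(\<Sum>H\<in>?R. ?u * ?v * chow_var M H) \<in> chow_null M"
      proof (rule chow_null_sum)
        fix H assume "H \<in> ?R"
        then have "?u * chow_var M H \<in> chow_null M" using chow_var_incomparable[OF FE(1), of H] u(2) by simp
        from chow_null_mult[OF this, of ?v] show "?u * ?v * chow_var M H \<in> chow_null M" by (simp add: mult_ac)
      qed
      moreover have "(\<Sum>H\<in>?U. ?u * ?v * chow_var M H) \<in> chow_null M"
      proof (rule chow_null_sum)
        fix H assume H: "H \<in> ?U"
        have "?u * (\<Prod>G\<in>#m. pullback_var G) * (\<Prod>G\<in>#add_mset H Q. chow_var M G) \<in> chow_null M"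
          using m H less.prems by (intro less.hyps) auto
        then show "?u * ?v * chow_var M H \<in> chow_null M" by (simp add: mult_ac)
      qed
      moreover have "?u * ?v * (\<Sum>H\<in>?X. chow_var M H) =
          ?u * ?v * ((\<Sum>H\<in>?X. chow_var M H) + ((\<Sum>H\<in>?U. chow_var M H) + (\<Sum>H\<in>?R. chow_var M H)))
          - (\<Sum>H\<in>?U. ?u * ?v * chow_var M H) - (\<Sum>H\<in>?R. ?u * ?v * chow_var M H)"
        by (simp only: sum_distrib_left[symmetric] distrib_left) simp
      ultimately have "?u * ?v * (\<Sum>H\<in>?X. chow_var M H) \<in> chow_null M"
        using chow_null_diff[OF chow_null_diff[OF chow_null_mult[OF total, of "?u * ?v"]]] by (simp only:)
      then show "(\<Prod>F\<in>#m. pullback_var F) * (\<Sum>G\<in>{G \<in> interval {} F. j \<in> G}. pullback_var G) \<in> ?K"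
        unfolding low by (simp add: mult_ac)
    qed
    then show ?thesis by (simp add: mult_ac)
  qed
qed

text \<open>Each \<open>t_G\<close> is treated by the position of \<open>G\<close>. Inside
  \<open>F\<close> it is kept, and \<open>G\<close> is then a flat of \<open>M\<close>; strictly
  above \<open>F\<close> it becomes the variable of \<open>insert i G\<close>, or zero if that is no
  flat; incomparable with \<open>F\<close> it is killed.\<close>

lemma S_flat_split:
  assumes S: "F \<in> S_flats M i" and "set_mset U \<subseteq> nonempty_proper_flats N"
  shows "Var (insert i F) * (\<Prod>G\<in>#U. pullback_var G) \<in> chow_null M \<or>
    (\<exists>P Q. set_mset P \<subseteq> interval {} F \<and> set_mset Q \<subseteq> interval (insert i F) E \<and> size P + size Q = size U \<and>
      Var (insert i F) * (\<Prod>G\<in>#U. pullback_var G)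
        - Var (insert i F) * (\<Prod>G\<in>#P. pullback_var G) * (\<Prod>G\<in>#Q. chow_var M G) \<in> chow_null M)"
  using assms(2)
proof (induction U)
  case empty
  show ?case by (rule disjI2, rule exI[of _ "{#}"], rule exI[of _ "{#}"]) simp
next
  case (add G U)
  let ?u = "Var (insert i F)"
  note F = S_flatsD[OF S]
  have FE: "insert i F \<in> flats M" "F \<in> flats M" "insert i F \<noteq> E" using F(3,4) by (simp_all add: npf_iff psubset_eq)
  have G: "G \<noteq> {}" "G \<subset> E - {i}" "G \<in> flats M \<or> insert i G \<in> flats M"
    using add.prems unfolding set_mset_add_mset_insert insert_subset npf_deletion_iff by auto
  have iG: "i \<notin> G" using G by blast
  from add consider "?u * (\<Prod>G\<in>#U. pullback_var G) \<in> chow_null M"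
    | P Q where "set_mset P \<subseteq> interval {} F" "set_mset Q \<subseteq> interval (insert i F) E" "size P + size Q = size U"
      "?u * (\<Prod>G\<in>#U. pullback_var G) - ?u * (\<Prod>G\<in>#P. pullback_var G) * (\<Prod>G\<in>#Q. chow_var M G) \<in> chow_null M"
    by auto
  then show ?case
  proof cases
    case 1
    then have "pullback_var G * (?u * (\<Prod>G\<in>#U. pullback_var G)) \<in> chow_null M" by (rule chow_null_mult)
    then show ?thesis by (simp add: mult_ac)
  next
    case (2 P Q)
    have shift: "?u * (\<Prod>G\<in>#add_mset G U. pullback_var G) - pullback_var G * (?u * (\<Prod>G\<in>#P. pullback_var G) * (\<Prod>G\<in>#Q. chow_var M G)) \<in> chow_null M"
      using chow_null_shift[OF 2(4), of "pullback_var G"] by (simp add: mult_ac)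
    consider "G \<subseteq> F" | "F \<subset> G" | "\<not> G \<subseteq> F" "\<not> F \<subseteq> G" by blast
    then show ?thesis
    proof cases
      case 1
      have "G \<in> flats M"
        using G(3)
      proof
        assume "insert i G \<in> flats M"
        then have "insert i G \<inter> F \<in> flats M" using flat_Int FE(2) by blast
        moreover have "insert i G \<inter> F = G" using 1 F(2) by blast
        ultimately show ?thesis by simp
      qed
      then have "set_mset (add_mset G P) \<subseteq> interval {} F" using 2 1 G(1) by (auto simp: interval_def)
      then show ?thesis using 2(2,3) shift
        by (intro disjI2 exI[of _ "add_mset G P"] exI[of _ Q]) (simp add: mult_ac)
    next
      case sub: 2
      note step = mult_above_S_flat[OF S sub iG]
      show ?thesis
      proof (cases "insert i G \<in> flats M")
        case True
        have GE: "insert i G \<noteq> E" using G(2) iG by auto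
        have "insert i G \<in> interval (insert i F) E" using True sub iG F(2) flat_subset by (auto simp: interval_def insert_ident)
        then have "set_mset (add_mset (insert i G) Q) \<subseteq> interval (insert i F) E" using 2(2) by simp
        moreover have "?u * (\<Prod>G\<in>#add_mset G U. pullback_var G)
            - ?u * (\<Prod>G\<in>#P. pullback_var G) * (\<Prod>G\<in>#add_mset (insert i G) Q. chow_var M G) \<in> chow_null M"
          using chow_null_add[OF shift chow_null_shift[OF step, of "(\<Prod>G\<in>#P. pullback_var G) * (\<Prod>G\<in>#Q. chow_var M G)", unfolded right_diff_distrib]]
            chow_var_proper[OF GE] by (simp add: mult_ac)
        ultimately show ?thesis using 2(1,3)
          by (intro disjI2 exI[of _ P] exI[of _ "add_mset (insert i G) Q"]) simp
      next
        case False
        then have "Var (insert i G) \<in> chow_null M" by (intro Var_null) (simp add: npf_iff)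
        then have "?u * pullback_var G \<in> chow_null M"
          using step chow_null_mult[of "Var (insert i G)" M ?u] chow_null_diff_iff by blast
        from chow_null_mult[OF this, of "\<Prod>G\<in>#U. pullback_var G"] show ?thesis by (simp add: mult_ac)
      qed
    next
      case 3
      have "?u * pullback_var G \<in> chow_null M"
        using 3 iG F(2) by (intro pullback_var_null incomparable_null) auto
      from chow_null_mult[OF this, of "\<Prod>G\<in>#U. pullback_var G"] show ?thesis by (simp add: mult_ac)
    qed
  qed
qed

text \<open>Parts outside top degree contribute nothing, and the top part is spanned by monomials,
  so it suffices that top degree monomials vanish.\<close>

lemma chow_degree_pullback_top:
  assumes "p \<in> carrier (S_ring N)" "homogeneous e u"
    and "\<And>U. set_mset U \<subseteq> nonempty_proper_flats N \<Longrightarrow> size U + e + 1 = rk M E \<Longrightarrow>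
      u * (\<Prod>G\<in>#U. pullback_var G) \<in> chow_null M"
  shows "chow_degree M (u * pullback p) = 0"
proof -
  obtain n f where f: "p = (\<Sum>k\<le>n. f k)" "\<And>k. homogeneous k (f k)" "\<And>k. vars (f k) \<subseteq> vars p"
    using homogeneous_decomposition[of p] by metis
  have "chow_degree M (u * pullback (f k)) = 0" for k
  proof (cases "k + e + 1 = rk M E")
    case False
    have "homogeneous (e + k) (u * pullback (f k))" by (intro homogeneous_mult homogeneous_pullback assms f)
    then show ?thesis using False by (intro chow_degree_homogeneous[of "e + k"]) auto
  next
    case True
    have "vars (f k) \<subseteq> nonempty_proper_flats N" using f(3) assms(1) unfolding carrier_S_ring by blast
    from homogeneous_in_span[OF this f(2)]
    have "u * pullback (f k) \<in> chow_null M"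
    proof (induction rule: rat_span.induct)
      case (step b q c)
      then obtain U where U: "b = (\<Prod>F\<in>#U. Var F)" "set_mset U \<subseteq> nonempty_proper_flats N" "size U = k" by auto
      have "u * pullback b \<in> chow_null M" using assms(3)[OF U(2)] U True by (simp add: substitute_prod_mset)
      from chow_null_add[OF chow_null_mult[OF this, of "Const c"] step.IH]
      show ?case by (simp add: substitute_add substitute_mult distrib_left mult_ac)
    qed simp
    then show ?thesis by (rule chow_degree_null(3))
  qed
  then show ?thesis unfolding f(1) by (simp add: substitute_sum sum_distrib_left chow_degree_sum)
qed

lemma chow_degree_S_flat:
  assumes "F \<in> S_flats M i" "p \<in> carrier (S_ring N)"
  shows "chow_degree M (Var (insert i F) * pullback p) = 0"
proof (rule chow_degree_pullback_top[OF assms(2) homogeneous_Var])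
  fix U assume U: "set_mset U \<subseteq> nonempty_proper_flats N" "size U + 1 + 1 = rk M E"
  from S_flat_split[OF assms(1) U(1)]
  show "Var (insert i F) * (\<Prod>G\<in>#U. pullback_var G) \<in> chow_null M"
  proof
    assume "\<exists>P Q. set_mset P \<subseteq> interval {} F \<and> set_mset Q \<subseteq> interval (insert i F) E \<and> size P + size Q = size U \<and>
      Var (insert i F) * (\<Prod>G\<in>#U. pullback_var G)
        - Var (insert i F) * (\<Prod>G\<in>#P. pullback_var G) * (\<Prod>G\<in>#Q. chow_var M G) \<in> chow_null M"
    then obtain P Q where PQ: "set_mset P \<subseteq> interval {} F" "set_mset Q \<subseteq> interval (insert i F) E" "size P + size Q = size U"
      and diff: "Var (insert i F) * (\<Prod>G\<in>#U. pullback_var G)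
        - Var (insert i F) * (\<Prod>G\<in>#P. pullback_var G) * (\<Prod>G\<in>#Q. chow_var M G) \<in> chow_null M" by blast
    show ?thesis unfolding chow_null_diff_iff[OF diff]
      using PQ U(2) by (intro S_flat_split_vanishing[OF assms(1)]) auto
  qed
qed

text \<open>The deletion has rank one less, so products of \<open>rk M E - 1\<close> pullback
  variables vanish. The proper flats below \<open>E - {i}\<close> in \<open>M\<close> are exactly
  those of the deletion, and \<open>top_vanishing\<close> is applied to this interval.\<close>

lemma chow_degree_coatom:
  assumes coatom: "E - {i} \<in> nonempty_proper_flats M" and p: "p \<in> carrier (S_ring N)"
  shows "chow_degree M (pullback p) = 0"
proof -
  let ?B = "E - {i}"
  obtain j0 where j0: "j0 \<in> E" "j0 \<noteq> i" using coatom unfolding npf_iff by blast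
  let ?S = "\<lambda>j. \<Sum>F\<in>{F \<in> nonempty_proper_flats N. j \<in> F}. pullback_var F"
  \<comment> \<open>The value at \<open>E - {i}\<close> is the pullback of the ground set variable
    of the deletion.\<close>
  define y where "y G = (if G = ?B then - ?S j0 else pullback_var G)" for G
  have B: "?B \<in> flats M" "{} \<subset> ?B" using coatom unfolding npf_iff by blast+
  have int: "interval {} ?B = insert ?B (nonempty_proper_flats N)"
  proof (intro equalityI subsetI)
    fix G assume "G \<in> interval {} ?B"
    then show "G \<in> insert ?B (nonempty_proper_flats N)" unfolding interval_def insert_iff npf_deletion_iff by auto
  next
    fix G assume G: "G \<in> insert ?B (nonempty_proper_flats N)"
    show "G \<in> interval {} ?B"
    proof (cases "G = ?B")
      case True
      then show ?thesis using B by (simp add: interval_def)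
    next
      case False
      then have G': "G \<noteq> {}" "G \<subset> ?B" "G \<in> flats M \<or> insert i G \<in> flats M" using G unfolding insert_iff npf_deletion_iff by auto
      have "G \<in> flats M"
        using G'(3)
      proof
        assume "insert i G \<in> flats M"
        then have "insert i G \<inter> ?B \<in> flats M" using flat_Int B(1) by blast
        moreover have "insert i G \<inter> ?B = G" using G'(2) by blast
        ultimately show ?thesis by simp
      qed
      then show ?thesis using G' by (auto simp: interval_def)
    qed
  qed
  have BN: "?B \<notin> nonempty_proper_flats N" unfolding npf_deletion_iff by blast
  have rk: "rk M E = Suc (rk M ?B)"
  proof (rule rk_cover[OF B(1)])
    show "covers M ?B E" unfolding covers_def using E_flat i_in_E by blast
  qed
  have "chow_degree M (1 * pullback p) = 0"
  proof (rule chow_degree_pullback_top[OF p homogeneous_1])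
    fix U assume U: "set_mset U \<subseteq> nonempty_proper_flats N" "size U + 0 + 1 = rk M E"
    have "(\<Prod>G\<in>#U. y G) \<in> chow_null M"
    proof (rule top_vanishing[OF _ _ _ empty_flat B])
      show "set_mset U \<subseteq> interval {} ?B" using U(1) unfolding int by blast
      show "size U = rk M ?B" using U(2) rk by simp
      show "rk M ?B \<le> rk M {} + rk M ?B" by simp
    next
      fix m G H assume GH: "G \<in> interval {} ?B" "H \<in> interval {} ?B" "\<not> G \<subseteq> H" "\<not> H \<subseteq> G"
      then have "G \<noteq> ?B" "H \<noteq> ?B" by (auto simp: interval_def)
      moreover have "i \<notin> G" "i \<notin> H" using GH by (auto simp: interval_def)
      ultimately have "y G * y H \<in> chow_null M" using pullback_var_incomparable GH by (simp add: y_def)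
      then show "(\<Prod>F\<in>#m. y F) * (y G * y H) \<in> chow_null M" by (rule chow_null_mult)
    next
      fix m j assume j: "j \<in> ?B" "j \<notin> {}"
      have "{G \<in> interval {} ?B. j \<in> G} = insert ?B {G \<in> nonempty_proper_flats N. j \<in> G}"
        unfolding int using j by auto
      then have "(\<Sum>G\<in>{G \<in> interval {} ?B. j \<in> G}. y G) = y ?B + (\<Sum>G\<in>{G \<in> nonempty_proper_flats N. j \<in> G}. y G)"
        using finite_npf_deletion BN by simp
      also have "(\<Sum>G\<in>{G \<in> nonempty_proper_flats N. j \<in> G}. y G) = ?S j"
        using BN by (intro sum.cong) (auto simp: y_def)
      finally have "(\<Sum>G\<in>{G \<in> interval {} ?B. j \<in> G}. y G) \<in> chow_null M"
        using pullback_linear[of j j0] j j0 by (simp add: y_def)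
      then show "(\<Prod>F\<in>#m. y F) * (\<Sum>G\<in>{G \<in> interval {} ?B. j \<in> G}. y G) \<in> chow_null M" by (rule chow_null_mult)
    qed (auto intro: chow_null_add chow_null_minus)
    moreover have "image_mset y U = image_mset pullback_var U"
      using U(1) BN by (intro image_mset_cong) (auto simp: y_def)
    ultimately show "1 * (\<Prod>G\<in>#U. pullback_var G) \<in> chow_null M" by simp
  qed
  then show ?thesis by simp
qed

text \<open>For nested flats the variable of the larger one may be replaced by a pullback variable,
  which leads back to \<open>chow_degree_S_flat\<close>. All other pairs annihilate each
  other.\<close>

lemma chow_degree_extra_extra:
  assumes "F \<in> S_flats M i" "G \<in> extra_flats" "G \<noteq> insert i F" "p \<in> carrier (S_ring N)"
  shows "chow_degree M (Var (insert i F) * Var G * pullback p) = 0"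
proof -
  have sub: "chow_degree M (Var (insert i F) * Var (insert i F') * pullback p) = 0"
    if "F \<in> S_flats M i" "F' \<in> S_flats M i" "F \<subset> F'" for F F'
  proof -
    have "Var (insert i F) * Var (insert i F') * pullback p - Var (insert i F) * pullback (Var F' * p) \<in> chow_null M"
      using chow_null_mult2[OF extra_extra[OF that], of "pullback p"]
      by (simp add: left_diff_distrib substitute_mult mult.assoc)
    moreover have "Var F' * p \<in> carrier (S_ring N)"
      using carrier_S_ring_intros(6)[OF Var_carrier_N[OF S_flatsD(5)[OF that(2)]] assms(4)] .
    ultimately show ?thesis using chow_degree_cong chow_degree_S_flat[OF that(1)] by metis
  qed
  from assms(2) consider F' where "F' \<in> S_flats M i" "G = insert i F'" | "G = E - {i}"
    by (auto simp: extra_flats_def split: if_splits)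
  then show ?thesis
  proof cases
    case (1 F')
    consider "F \<subset> F'" | "F' \<subset> F" | "\<not> F \<subseteq> F'" "\<not> F' \<subseteq> F" using 1 assms(3) by blast
    then show ?thesis
    proof cases
      case 11: 1
      then show ?thesis using sub[OF assms(1) 1(1)] 1 by simp
    next
      case 2
      then show ?thesis using sub[OF 1(1) assms(1) 2] 1 by (simp add: mult_ac)
    next
      case 3
      then have "Var (insert i F) * Var G \<in> chow_null M"
        unfolding 1(2) using S_flatsD(2)[OF assms(1)] S_flatsD(2)[OF 1(1)] by (intro incomparable_null) auto
      then show ?thesis by (rule chow_degree_null(2))
    qed
  next
    case 2
    have "Var (insert i F) * Var G \<in> chow_null M" using coatom_S_flat[OF assms(1)] 2 by (simp add: mult.commute)
    then show ?thesis by (rule chow_degree_null(2))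
  qed
qed

text \<open>Nondegeneracy, tested only on the spanning set provided by
  \<open>decomposed_all\<close>.\<close>

lemma decomposed_induct:
  assumes "\<And>p. p \<in> carrier (S_ring N) \<Longrightarrow> chow_degree M (e * pullback p) = 0"
    and "\<And>G p. G \<in> extra_flats \<Longrightarrow> p \<in> carrier (S_ring N) \<Longrightarrow> chow_degree M (e * (Var G * pullback p)) = 0"
  shows "e \<in> chow_null M"
proof (rule chow_degree_nondegenerate)
  fix w
  obtain p q where pq: "p \<in> carrier (S_ring N)" "\<And>G. q G \<in> carrier (S_ring N)"
    "w - (pullback p + (\<Sum>G\<in>extra_flats. Var G * pullback (q G))) \<in> chow_null M"
    using decomposed_all[of w] unfolding decomposed_def by blast
  have "e * w - e * (pullback p + (\<Sum>G\<in>extra_flats. Var G * pullback (q G))) \<in> chow_null M"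
    using pq(3) by (rule chow_null_shift)
  then have "chow_degree M (e * w) = chow_degree M (e * (pullback p + (\<Sum>G\<in>extra_flats. Var G * pullback (q G))))"
    by (rule chow_degree_cong)
  also have "\<dots> = 0"
    using assms pq by (simp add: distrib_left sum_distrib_left chow_degree_add chow_degree_sum)
  finally show "chow_degree M (e * w) = 0" .
qed

text \<open>A term belonging to an element of \<open>S_flats M i\<close> is orthogonal to all other
  generators; multiplying the relation by its own generator shows that it pairs to zero with that
  one too. The terms of 1 and \<open>E - {i}\<close> are not separated in this way and need the
  isotropy of the pullback image.\<close>

lemma decomposition_unique:
  assumes p: "p \<in> carrier (S_ring N)" and q: "\<And>G. q G \<in> carrier (S_ring N)"
    and null: "pullback p + (\<Sum>G\<in>extra_flats. Var G * pullback (q G)) \<in> chow_null M"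
  shows "pullback p \<in> chow_null M" "\<And>G. G \<in> extra_flats \<Longrightarrow> Var G * pullback (q G) \<in> chow_null M"
proof -
  have S: "Var (insert i F) * pullback (q (insert i F)) \<in> chow_null M" if F: "F \<in> S_flats M i" for F
  proof (rule decomposed_induct)
    let ?G = "insert i F"
    let ?e = "Var ?G * pullback (q ?G)"
    have Gx: "?G \<in> extra_flats" using F by (simp add: extra_flats_def)
    show "chow_degree M (?e * pullback r) = 0" if "r \<in> carrier (S_ring N)" for r
      using chow_degree_S_flat[OF F carrier_S_ring_intros(6)[OF q[of ?G] that]] by (simp add: substitute_mult mult.assoc)
    fix G r assume G: "G \<in> extra_flats" and r: "r \<in> carrier (S_ring N)"
    show "chow_degree M (?e * (Var G * pullback r)) = 0"
    proof (cases "G = ?G")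
      case False
      then show ?thesis
        using chow_degree_extra_extra[OF F G False carrier_S_ring_intros(6)[OF q[of ?G] r]]
        by (simp add: substitute_mult mult_ac)
    next
      case True
      let ?v = "Var G * pullback r"
      have "(\<Sum>H\<in>extra_flats. Var H * pullback (q H)) = ?e + (\<Sum>H\<in>extra_flats - {?G}. Var H * pullback (q H))"
        using Gx finite_extra_flats by (intro sum.remove)
      then have "chow_degree M ((pullback p + (?e + (\<Sum>H\<in>extra_flats - {?G}. Var H * pullback (q H)))) * ?v) = 0"
        using chow_degree_null(2)[OF null] by simp
      moreover have "chow_degree M (pullback p * ?v) = 0"
        using chow_degree_S_flat[OF F carrier_S_ring_intros(6)[OF p r]] True by (simp add: substitute_mult mult_ac)
      moreover have "chow_degree M (Var H * pullback (q H) * ?v) = 0" if "H \<in> extra_flats - {?G}" for H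
        using chow_degree_extra_extra[OF F _ _ carrier_S_ring_intros(6)[OF q[of H] r], of H] that True
        by (simp add: substitute_mult mult_ac)
      ultimately show ?thesis by (simp add: distrib_right sum_distrib_right chow_degree_add chow_degree_sum)
    qed
  qed
  show Vq: "Var G * pullback (q G) \<in> chow_null M" if G: "G \<in> extra_flats" for G
  proof (cases "G \<in> insert i ` S_flats M i")
    case True
    then show ?thesis using S by blast
  next
    case False
    then have G': "G = E - {i}" and coatom: "E - {i} \<in> nonempty_proper_flats M"
      using G by (auto simp: extra_flats_def split: if_splits)
    let ?e = "Var G * pullback (q G)"
    have "(\<Sum>H\<in>extra_flats. Var H * pullback (q H)) = ?e + (\<Sum>H\<in>extra_flats - {G}. Var H * pullback (q H))"
      using G finite_extra_flats by (intro sum.remove)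
    moreover have "(\<Sum>H\<in>extra_flats - {G}. Var H * pullback (q H)) \<in> chow_null M"
      using S G' by (intro chow_null_sum) (auto simp: extra_flats_def split: if_splits)
    ultimately have pe: "pullback p + ?e \<in> chow_null M"
      using chow_null_diff[OF null, of "\<Sum>H\<in>extra_flats - {G}. Var H * pullback (q H)"] by simp
    \<comment> \<open>The pullback image pairs to zero with itself, and the relation passes this on
      to the one remaining term.\<close>
    have base: "chow_degree M (?e * pullback r) = 0" if r: "r \<in> carrier (S_ring N)" for r
    proof -
      have "chow_degree M ((pullback p + ?e) * pullback r) = 0" using pe by (rule chow_degree_null(2))
      moreover have "chow_degree M (pullback p * pullback r) = 0"
        using chow_degree_coatom[OF coatom carrier_S_ring_intros(6)[OF p r]] by (simp add: substitute_mult)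
      ultimately show ?thesis by (simp add: distrib_right chow_degree_add)
    qed
    show ?thesis
    proof (rule decomposed_induct)
      show "chow_degree M (?e * pullback r) = 0" if "r \<in> carrier (S_ring N)" for r using base that .
      fix H r assume H: "H \<in> extra_flats" and r: "r \<in> carrier (S_ring N)"
      show "chow_degree M (?e * (Var H * pullback r)) = 0"
      proof (cases "H = G")
        case False
        then obtain F where F: "F \<in> S_flats M i" "H = insert i F" using H G' by (auto simp: extra_flats_def split: if_splits)
        have "Var G * Var H \<in> chow_null M" using coatom_S_flat[OF F(1)] F(2) G' by simp
        from chow_degree_null(2)[OF this, of "pullback (q G) * pullback r"] show ?thesis by (simp add: mult_ac)
      next
        case True
        \<comment> \<open>The square relation moves the second factor of the generator into the
          pullback, where \<open>base\<close> applies.\<close>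
        obtain a where a: "a \<in> carrier (S_ring N)" "Var G * Var G + Var G * pullback a \<in> chow_null M"
          using coatom_square[OF coatom] G' by blast
        have "chow_degree M ((Var G * Var G + Var G * pullback a) * (pullback (q G) * pullback r)) = 0"
          using a(2) by (rule chow_degree_null(2))
        moreover have "chow_degree M (?e * pullback (a * r)) = 0"
          using base carrier_S_ring_intros(6)[OF a(1) r] .
        moreover have "(Var G * Var G + Var G * pullback a) * (pullback (q G) * pullback r)
            = ?e * (Var G * pullback r) + ?e * pullback (a * r)" by (simp add: substitute_mult algebra_simps)
        ultimately show ?thesis unfolding True by (simp add: chow_degree_add)
      qed
    qed
  qed
  have "(\<Sum>G\<in>extra_flats. Var G * pullback (q G)) \<in> chow_null M" using Vq by (rule chow_null_sum)
  from chow_null_diff[OF null this] show "pullback p \<in> chow_null M" by simp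
qed

end

section \<open>Residue classes and the degree map\<close>

lemma cring_CH: "cring (CH M)"
  unfolding CH_def by (rule ideal.quotient_is_cring[OF ideal_CH_ideal cring_S_ring])

lemma carrier_CH: "carrier (CH M) = CH_class M ` carrier (S_ring M)"
  by (auto simp: CH_def FactRing_def A_RCOSETS_def' CH_class_def)

lemma CH_class_carrier: "p \<in> carrier (S_ring M) \<Longrightarrow> CH_class M p \<in> carrier (CH M)"
  by (simp add: carrier_CH)

lemma CH_class_add:
  assumes "p \<in> carrier (S_ring M)" "q \<in> carrier (S_ring M)"
  shows "CH_class M p \<oplus>\<^bsub>CH M\<^esub> CH_class M q = CH_class M (p + q)"
proof -
  interpret ideal "CH_ideal M" "S_ring M" by (rule ideal_CH_ideal)
  show ?thesis using a_rcos_sum[OF assms] by (simp add: CH_def FactRing_def CH_class_def)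
qed

lemma CH_class_mult:
  assumes "p \<in> carrier (S_ring M)" "q \<in> carrier (S_ring M)"
  shows "CH_class M p \<otimes>\<^bsub>CH M\<^esub> CH_class M q = CH_class M (p * q)"
proof -
  interpret ideal "CH_ideal M" "S_ring M" by (rule ideal_CH_ideal)
  show ?thesis using rcoset_mult_add[OF assms] by (simp add: CH_def FactRing_def CH_class_def)
qed

lemma CH_class_0: "CH_class M 0 = \<zero>\<^bsub>CH M\<^esub>"
proof -
  interpret ideal "CH_ideal M" "S_ring M" by (rule ideal_CH_ideal)
  show ?thesis using a_coset_add_zero[OF a_subset] by (simp add: CH_def FactRing_def CH_class_def)
qed

lemma CH_class_eq_iff:
  assumes "p \<in> carrier (S_ring M)" "q \<in> carrier (S_ring M)"
  shows "CH_class M p = CH_class M q \<longleftrightarrow> p - q \<in> chow_null M"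
proof -
  interpret cring "S_ring M" by (rule cring_S_ring)
  have "p \<ominus>\<^bsub>S_ring M\<^esub> q = p - q" using assms(2) by (simp add: a_minus_def S_ring_a_inv)
  then have "CH_class M p = CH_class M q \<longleftrightarrow> p - q \<in> CH_ideal M"
    using quotient_eq_iff_same_a_r_cos[OF ideal_CH_ideal assms] by (simp add: CH_class_def)
  then show ?thesis using chow_null_carrier[OF carrier_S_ring_intros(5)[OF assms]] by simp
qed

lemma CH_class_eq_0_iff:
  assumes "p \<in> carrier (S_ring M)"
  shows "CH_class M p = \<zero>\<^bsub>CH M\<^esub> \<longleftrightarrow> p \<in> chow_null M"
  using CH_class_eq_iff[OF assms carrier_S_ring_intros(1)] by (simp add: CH_class_0)

lemma carrier_S_ring_sum:
  "(\<And>x. x \<in> A \<Longrightarrow> f x \<in> carrier (S_ring M)) \<Longrightarrow> (\<Sum>x\<in>A. f x) \<in> carrier (S_ring M)"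
  unfolding carrier_S_ring by (rule vars_sum)

lemma CH_class_sum:
  assumes "finite A" "\<And>x. x \<in> A \<Longrightarrow> f x \<in> carrier (S_ring M)"
    "\<And>x. x \<in> A \<Longrightarrow> g x = CH_class M (f x)"
  shows "finsum (CH M) g A = CH_class M (\<Sum>x\<in>A. f x)"
proof -
  interpret cring "CH M" by (rule cring_CH)
  show ?thesis using assms
  proof (induction A rule: finite_induct)
    case empty
    show ?case by (simp add: CH_class_0)
  next
    case (insert x A)
    have "g \<in> A \<rightarrow> carrier (CH M)" "g x \<in> carrier (CH M)"
      using insert.prems by (auto intro!: CH_class_carrier)
    then have "finsum (CH M) g (insert x A) = g x \<oplus>\<^bsub>CH M\<^esub> finsum (CH M) g A"
      using insert.hyps by simp
    also have "\<dots> = CH_class M (f x) \<oplus>\<^bsub>CH M\<^esub> CH_class M (\<Sum>x\<in>A. f x)" using insert by simp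
    also have "\<dots> = CH_class M (f x + (\<Sum>x\<in>A. f x))"
      using insert.prems by (intro CH_class_add carrier_S_ring_sum) auto
    finally show ?case using insert.hyps by simp
  qed
qed

lemma CH_graded_iff:
  "\<eta> \<in> CH_graded M k \<longleftrightarrow> (\<exists>p. p \<in> carrier (S_ring M) \<and> homogeneous k p \<and> \<eta> = CH_class M p)"
  by (auto simp: CH_graded_def)

lemma homogeneous_0_Const:
  assumes "homogeneous 0 p" shows "\<exists>c. p = Const c"
proof -
  have "m = 0" if m: "m \<in> Poly_Mapping.keys p" for m
  proof -
    obtain U where U: "m = exponents U" using exponents_surj by blast
    have "size U = 0" using assms m U mon_degree_exponents[of U] by (simp add: homogeneous_iff)
    then show ?thesis using U by simp
  qed
  then have "p = Const (Poly_Mapping.lookup p 0)"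
    unfolding Const_def by (intro poly_mapping_eqI) (metis in_keys_iff lookup_single_eq lookup_single_not_eq)
  then show ?thesis by blast
qed

context nonempty_matroid
begin

text \<open>Homogeneity of the ideal follows from nondegeneracy: against a test factor of
  complementary degree only \<open>f k\<close> contributes.\<close>

lemma chow_null_homogeneous:
  assumes null: "(\<Sum>k\<le>n. f k) \<in> chow_null M" and f: "\<And>k. homogeneous k (f k)" and "k \<le> n"
  shows "f k \<in> chow_null M"
proof (rule chow_degree_nondegenerate)
  fix w :: "'a set_poly"
  obtain m g where g: "w = (\<Sum>j\<le>m. g j)" "\<And>j. homogeneous j (g j)"
    using homogeneous_decomposition[of w] by metis
  have "chow_degree M (f k * g j) = 0" for j
  proof (cases "k + j + 1 = rk M E")
    case False
    have "homogeneous (k + j) (f k * g j)" by (intro homogeneous_mult f g)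
    then show ?thesis using False by (intro chow_degree_homogeneous) auto
  next
    case True
    have "chow_degree M (f l * g j) = 0" if "l \<noteq> k" for l
    proof -
      have "homogeneous (l + j) (f l * g j)" by (intro homogeneous_mult f g)
      then show ?thesis using that True by (intro chow_degree_homogeneous) auto
    qed
    then have "chow_degree M (f k * g j) = (\<Sum>l\<le>n. chow_degree M (f l * g j))"
      using assms(3) by (subst sum.remove[of _ k]) auto
    also have "\<dots> = chow_degree M ((\<Sum>l\<le>n. f l) * g j)" by (simp add: sum_distrib_right chow_degree_sum)
    also have "\<dots> = 0" using null by (rule chow_degree_null(2))
    finally show ?thesis .
  qed
  then show "chow_degree M (f k * w) = 0" unfolding g(1) by (simp add: sum_distrib_left chow_degree_sum)
qed

text \<open>For reasons of degree only constants pair with an element of top degree.\<close>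

lemma chow_degree_top_injective:
  assumes "homogeneous (rk M E - 1) p" "chow_degree M p = 0"
  shows "p \<in> chow_null M"
proof (rule chow_degree_nondegenerate)
  fix w :: "'a set_poly"
  obtain m g where g: "w = (\<Sum>j\<le>m. g j)" "\<And>j. homogeneous j (g j)"
    using homogeneous_decomposition[of w] by metis
  have "chow_degree M (p * g j) = 0" for j
  proof (cases "j = 0")
    case True
    then obtain c where "g j = Const c" using homogeneous_0_Const g(2) by blast
    then show ?thesis using assms(2) by (simp add: mult.commute[of p] chow_degree_Const_mult)
  next
    case False
    have "homogeneous (rk M E - 1 + j) (p * g j)" by (intro homogeneous_mult assms g)
    then show ?thesis using False rk_E_pos by (intro chow_degree_homogeneous) auto
  qed
  then show "chow_degree M (p * w) = 0" unfolding g(1) by (simp add: sum_distrib_left chow_degree_sum)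
qed

section \<open>Maximal flags and the degree map\<close>

lemma flag_list_length: "flag_list M F l \<Longrightarrow> F \<in> flats M \<Longrightarrow> F \<subset> E \<Longrightarrow> rk M F + length l < rk M E"
proof (induction l arbitrary: F)
  case Nil
  then show ?case using rk_less[OF _ E_flat] by simp
next
  case (Cons p l)
  obtain G e where p: "p = (G, e)" by (cases p)
  have G: "G \<in> flats M" "F \<subset> G" "G \<subset> E" "flag_list M G l" using Cons.prems p by simp_all
  have "rk M F < rk M G" using rk_less Cons.prems(2) G by blast
  then show ?case using Cons.IH[OF G(4,1,3)] by simp
qed

text \<open>The length forces the ranks to rise one by one, so all binomials are 1 and all Whitney
  indices are 0.\<close>

lemma flag_degree_complete:
  "flag_list M F l \<Longrightarrow> F \<in> flats M \<Longrightarrow> F \<subset> E \<Longrightarrow> (\<And>p. p \<in> set l \<Longrightarrow> snd p = 1) \<Longrightarrow>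
    Suc (rk M F + length l) = rk M E \<Longrightarrow> flag_degree M F (rk M F) l = 1"
proof (induction l arbitrary: F)
  case (Cons p l)
  obtain G e where p: "p = (G, e)" by (cases p)
  have G: "G \<in> flats M" "F \<subset> G" "G \<subset> E" "flag_list M G l" "e = 1" using Cons.prems(1) Cons.prems(4)[of p] p by simp_all
  have "rk M F < rk M G" using rk_less Cons.prems(2) G by blast
  moreover have "rk M G + length l < rk M E" using flag_list_length G by blast
  ultimately have "rk M G = Suc (rk M F)" using Cons.prems(5) by simp
  then show ?case using Cons.IH[OF G(4,1,3)] Cons.prems(4,5) p G(5) by simp
qed simp

lemma flag_list_lookup:
  "flag_list M F l \<Longrightarrow> p \<in> set l \<Longrightarrow> Poly_Mapping.lookup (list_exponents l) (fst p) = snd p"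
proof (induction l arbitrary: F)
  case (Cons a l)
  obtain G e where a: "a = (G, e)" by (cases a)
  have l: "flag_list M G l" using Cons.prems a by simp
  have "G \<notin> fst ` set l" using flag_list_above[OF l] by blast
  then have G0: "Poly_Mapping.lookup (list_exponents l) G = 0"
    using keys_list_exponents[OF l] by (metis not_in_keys_iff_lookup_eq_zero)
  show ?case
  proof (cases "p = a")
    case True
    then show ?thesis using G0 a by (simp add: lookup_add)
  next
    case False
    then have p: "p \<in> set l" using Cons.prems by simp
    then have "fst p \<noteq> G" using flag_list_above[OF l p] by blast
    then show ?thesis using Cons.IH[OF l p] a by (simp add: lookup_add lookup_single)
  qed
qed simp

text \<open>Adding the empty flat gives a maximal chain of proper flats, whose cardinality is the
  rank.\<close>

lemma maxchain_npf:
  assumes C: "subset.maxchain (nonempty_proper_flats M) C"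
  shows "finite C" "Suc (card C) = rk M E" "C \<subseteq> nonempty_proper_flats M"
    "\<And>F G. F \<in> C \<Longrightarrow> G \<in> C \<Longrightarrow> F \<subseteq> G \<or> G \<subseteq> F"
proof -
  have ch: "subset.chain (nonempty_proper_flats M) C" using C by (rule subset.maxchain_imp_chain)
  then show sub: "C \<subseteq> nonempty_proper_flats M" and cmp: "\<And>F G. F \<in> C \<Longrightarrow> G \<in> C \<Longrightarrow> F \<subseteq> G \<or> G \<subseteq> F"
    unfolding subset_chain_def by blast+
  show fin: "finite C" using sub finite_npf finite_subset by blast
  have "subset.maxchain (proper_flats M) (insert {} C)"
    unfolding subset.maxchain_def
  proof (intro conjI notI)
    have "{} \<in> proper_flats M" using empty_flat E_nonempty by (simp add: proper_flats_def)
    then show "subset.chain (proper_flats M) (insert {} C)"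
      using sub cmp unfolding subset_chain_def nonempty_proper_flats_def by blast
    assume "\<exists>D. subset.chain (proper_flats M) D \<and> insert {} C \<subset> D"
    then obtain D where D: "subset.chain (proper_flats M) D" "insert {} C \<subset> D" by blast
    have "{} \<notin> C" using sub by (auto simp: nonempty_proper_flats_def)
    then have "C \<subset> D - {{}}" using D(2) by blast
    moreover have "subset.chain (nonempty_proper_flats M) (D - {{}})"
      using D(1) unfolding subset_chain_def nonempty_proper_flats_def by blast
    ultimately show False using C unfolding subset.maxchain_def by blast
  qed
  then have "card (insert {} C) = rk M E" by (rule maxchain_card)
  moreover have "{} \<notin> C" using sub by (auto simp: nonempty_proper_flats_def)
  ultimately show "Suc (card C) = rk M E" using fin by simp
qed

lemma maxchain_prod:
  assumes C: "subset.maxchain (nonempty_proper_flats M) C"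
  shows "(\<Prod>F\<in>C. Var F) \<in> carrier (S_ring M)" "homogeneous (rk M E - 1) (\<Prod>F\<in>C. Var F)"
proof -
  note C' = maxchain_npf[OF C]
  show "(\<Prod>F\<in>C. Var F) \<in> carrier (S_ring M)"
    unfolding carrier_S_ring using C'(3) by (intro vars_prod) auto
  have "homogeneous (size (mset_set C)) (\<Prod>F\<in>#mset_set C. Var F)" by (rule homogeneous_prod_mset) (rule homogeneous_Var)
  then show "homogeneous (rk M E - 1) (\<Prod>F\<in>C. Var F)" using C'(2) by (simp add: prod_unfold_prod_mset flip: C'(2))
qed

lemma chow_degree_maxchain:
  assumes C: "subset.maxchain (nonempty_proper_flats M) C"
  shows "chow_degree M (\<Prod>F\<in>C. Var F) = 1"
proof -
  note C' = maxchain_npf[OF C]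
  have "\<exists>l. flag_list M {} l \<and> list_exponents l = exponents (mset_set C)"
    using C' by (intro flag_list_of_multiset[OF _ _ flat_subset]) auto
  then obtain l where l: "flag_list M {} l" "list_exponents l = exponents (mset_set C)" by blast
  have one: "snd p = 1" if "p \<in> set l" for p
  proof -
    have "fst p \<in> C" using keys_list_exponents[OF l(1)] that l(2) keys_exponents[of "mset_set C"] C'(1) by auto
    then show ?thesis using flag_list_lookup[OF l(1) that] l(2) C'(1) by (simp add: lookup_exponents)
  qed
  have "sum_list (map snd l) = card C"
    using mon_degree_list_exponents[of l] mon_degree_exponents[of "mset_set C"] l(2) by simp
  moreover have "map snd l = replicate (length l) 1" using one by (intro replicate_eqI) auto
  ultimately have len: "length l = card C" "Suc (sum_list (map snd l)) = rk M E" using C'(2) by (simp_all add: sum_list_replicate)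
  have "(\<Prod>F\<in>C. Var F) = Poly_Mapping.single (list_exponents l) 1"
    using prod_Var_mset[of "mset_set C"] l(2) by (simp add: prod_unfold_prod_mset)
  then show ?thesis
    using degree_coeff_flag[OF l(1) len(2)] flag_degree_complete[OF l(1) empty_flat empty_psubset_E one] len(1) C'(2)
    by (simp add: chow_degree_single)
qed

lemma CH_scale_class:
  "p \<in> carrier (S_ring M) \<Longrightarrow> CH_scale M c (CH_class M p) = CH_class M (Const c * p)"
  unfolding CH_scale_def by (rule CH_class_mult[OF carrier_S_ring_intros(3)])

lemma is_degree_map_class:
  assumes f: "\<And>p. p \<in> carrier (S_ring M) \<Longrightarrow> homogeneous (rk M E - 1) p \<Longrightarrow> f (CH_class M p) = chow_degree M p"
    and ext: "f \<in> extensional (CH_graded M (rk M E - 1))"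
  shows "is_degree_map M f"
proof -
  let ?k = "rk M E - 1"
  let ?T = "CH_graded M ?k"
  obtain C where C: "subset.maxchain (nonempty_proper_flats M) C" using subset.Hausdorff by blast
  note flag = maxchain_prod
  show ?thesis unfolding is_degree_map_def rank_eq
  proof (intro conjI ballI allI impI)
    show "bij_betw f ?T UNIV"
      unfolding bij_betw_def
    proof (intro conjI inj_onI)
      fix \<eta> \<xi> assume *: "\<eta> \<in> ?T" "\<xi> \<in> ?T" "f \<eta> = f \<xi>"
      then obtain p q where p: "p \<in> carrier (S_ring M)" "homogeneous ?k p" "\<eta> = CH_class M p"
        and q: "q \<in> carrier (S_ring M)" "homogeneous ?k q" "\<xi> = CH_class M q" unfolding CH_graded_iff by blast
      then have "chow_degree M (p - q) = 0" using *(3) f by (simp add: chow_degree_diff)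
      then have "p - q \<in> chow_null M" by (intro chow_degree_top_injective homogeneous_diff p q)
      then show "\<eta> = \<xi>" using CH_class_eq_iff p q by blast
    next
      have "c \<in> f ` ?T" for c
      proof
        have F: "Const c * (\<Prod>F\<in>C. Var F) \<in> carrier (S_ring M)" "homogeneous ?k (Const c * (\<Prod>F\<in>C. Var F))"
          using flag[OF C] by (auto intro: carrier_S_ring_intros homogeneous_Const_mult)
        then show "c = f (CH_class M (Const c * (\<Prod>F\<in>C. Var F)))"
          using f[OF F] chow_degree_maxchain[OF C] by (simp add: chow_degree_Const_mult)
        show "CH_class M (Const c * (\<Prod>F\<in>C. Var F)) \<in> ?T" using F unfolding CH_graded_iff by blast
      qed
      then show "f ` ?T = UNIV" by blast
    qed
  next
    fix \<eta> \<xi> assume "\<eta> \<in> ?T" "\<xi> \<in> ?T"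
    then obtain p q where p: "p \<in> carrier (S_ring M)" "homogeneous ?k p" "\<eta> = CH_class M p"
      and q: "q \<in> carrier (S_ring M)" "homogeneous ?k q" "\<xi> = CH_class M q" unfolding CH_graded_iff by blast
    then show "f (\<eta> \<oplus>\<^bsub>CH M\<^esub> \<xi>) = f \<eta> + f \<xi>"
      using f[OF carrier_S_ring_intros(4)[OF p(1) q(1)] homogeneous_add[OF p(2) q(2)]] f[OF p(1,2)] f[OF q(1,2)]
      by (simp add: CH_class_add chow_degree_add)
  next
    fix c \<eta> assume "\<eta> \<in> ?T"
    then obtain p where p: "p \<in> carrier (S_ring M)" "homogeneous ?k p" "\<eta> = CH_class M p" unfolding CH_graded_iff by blast
    then show "f (CH_scale M c \<eta>) = c * f \<eta>"
      using f[OF carrier_S_ring_intros(6)[OF carrier_S_ring_intros(3) p(1)] homogeneous_Const_mult[OF p(2)]] f[OF p(1,2)]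
      by (simp add: CH_scale_class chow_degree_Const_mult)
  next
    fix C assume C: "subset.maxchain (nonempty_proper_flats M) C"
    then show "f (CH_class M (\<Prod>F\<in>C. Var F)) = 1" using f[OF flag[OF C]] chow_degree_maxchain[OF C] by simp
  qed (rule ext)
qed

text \<open>Choosing homogeneous representatives turns the functional into a function on classes,
  independent of the choice by \<open>chow_degree_cong\<close>. It is the only degree map because
  every class of top degree is a multiple of the class of one maximal flag, where the value is
  prescribed.\<close>

lemma degree_map_class:
  assumes "p \<in> carrier (S_ring M)" "homogeneous (rk M E - 1) p"
  shows "degree_map M (CH_class M p) = chow_degree M p"
proof -
  let ?k = "rk M E - 1"
  define f where "f \<eta> = (if \<eta> \<in> CH_graded M ?k
    then chow_degree M (SOME p. p \<in> carrier (S_ring M) \<and> homogeneous ?k p \<and> \<eta> = CH_class M p) else undefined)" for \<eta>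
  have f: "f (CH_class M p) = chow_degree M p" if p: "p \<in> carrier (S_ring M)" "homogeneous ?k p" for p
  proof -
    let ?q = "SOME q. q \<in> carrier (S_ring M) \<and> homogeneous ?k q \<and> CH_class M p = CH_class M q"
    have q: "?q \<in> carrier (S_ring M) \<and> homogeneous ?k ?q \<and> CH_class M p = CH_class M ?q"
      by (rule someI[of _ p]) (use p in simp)
    then have "p - ?q \<in> chow_null M" using CH_class_eq_iff p by blast
    then have "chow_degree M p = chow_degree M ?q" by (rule chow_degree_cong)
    moreover have "CH_class M p \<in> CH_graded M ?k" using p unfolding CH_graded_iff by blast
    ultimately show ?thesis by (simp add: f_def)
  qed
  have "f \<in> extensional (CH_graded M ?k)" by (auto simp: f_def extensional_def)
  with f have deg: "is_degree_map M f" by (rule is_degree_map_class)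
  obtain C where C: "subset.maxchain (nonempty_proper_flats M) C" using subset.Hausdorff by blast
  let ?fl = "CH_class M (\<Prod>F\<in>C. Var F)"
  have unique: "g = f" if g: "is_degree_map M g" for g
  proof
    fix \<eta>
    note f' = deg[unfolded is_degree_map_def rank_eq] and g' = g[unfolded is_degree_map_def rank_eq]
    show "g \<eta> = f \<eta>"
    proof (cases "\<eta> \<in> CH_graded M ?k")
      case False
      then show ?thesis using f' g' by (auto simp: extensional_def)
    next
      case True
      note fl = maxchain_prod[OF C]
      then have flT: "?fl \<in> CH_graded M ?k" unfolding CH_graded_iff by blast
      have "CH_scale M (f \<eta>) ?fl \<in> CH_graded M ?k"
        unfolding CH_scale_class[OF fl(1)] CH_graded_iff
        using carrier_S_ring_intros(6)[OF carrier_S_ring_intros(3) fl(1)] homogeneous_Const_mult[OF fl(2)] by blast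
      moreover have "f (CH_scale M (f \<eta>) ?fl) = f \<eta>" using f' flT C by simp
      moreover have "inj_on f (CH_graded M ?k)" using f' by (simp add: bij_betw_def)
      ultimately have eq: "CH_scale M (f \<eta>) ?fl = \<eta>" using True by (simp add: inj_on_eq_iff)
      have "g (CH_scale M (f \<eta>) ?fl) = f \<eta> * g ?fl" using g' flT by simp
      then have "g \<eta> = f \<eta> * g ?fl" unfolding eq .
      then show ?thesis using g' C by simp
    qed
  qed
  have "degree_map M = f" unfolding degree_map_def by (rule the_equality) (rule deg, erule unique)
  then show ?thesis using f assms by simp
qed

end

section \<open>Graded modules over the Chow ring of the deletion\<close>

context matroid_element
begin

text \<open>The image under \<open>the_elem\<close> is a singleton since the pullback maps the ideal
  of the deletion into that of \<open>M\<close>.\<close>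

lemma theta_class:
  assumes "p \<in> carrier (S_ring N)"
  shows "theta M i (CH_class N p) = CH_class M (pullback p)"
proof -
  have sub: "substitute (\<lambda>F. x_poly M F + x_poly M (insert i F)) = pullback"
    by (simp add: pullback_var_def[abs_def])
  have "CH_class M (pullback r) = CH_class M (pullback p)" if r: "r \<in> CH_class N p" for r
  proof -
    obtain h where h: "h \<in> CH_ideal N" "r = h + p"
      using r by (auto simp: CH_class_def a_r_coset_def')
    have "pullback r - pullback p \<in> chow_null M"
      using pullback_CH_ideal[OF h(1)] chow_null_carrier[OF pullback_carrier] h(2) by (simp add: substitute_add)
    then show ?thesis using CH_class_eq_iff[OF pullback_carrier pullback_carrier] by blast
  qed
  moreover have "p \<in> CH_class N p"
    unfolding CH_class_def a_r_coset_def' by (rule UN_I[OF CH_ideal_closed(2)]) simp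
  ultimately have "(\<lambda>r. CH_class M (pullback r)) ` CH_class N p = {CH_class M (pullback p)}"
    by (metis (no_types, lifting) image_cong image_constant)
  then show ?thesis unfolding theta_def sub by simp
qed

text \<open>With \<open>x_poly\<close> the label \<open>{}\<close>, which occurs for a one-element
  ground set, yields zero.\<close>

definition generator :: "'a set option \<Rightarrow> 'a set_poly" where
  "generator a = (case a of None \<Rightarrow> 1 | Some G \<Rightarrow> x_poly M G)"

definition generator_degree :: "'a set option \<Rightarrow> nat" where
  "generator_degree a = (case a of None \<Rightarrow> 0 | Some G \<Rightarrow> 1)"

lemma generator_simps [simp]: "generator None = 1" "generator (Some G) = x_poly M G"
  by (simp_all add: generator_def)

lemma generator_carrier: "generator a \<in> carrier (S_ring M)"
  by (cases a) (auto intro: carrier_S_ring_intros)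

lemma homogeneous_generator: "homogeneous (generator_degree a) (generator a)"
proof (cases a)
  case (Some G)
  then show ?thesis using homogeneous_Var[of G] by (simp add: generator_degree_def x_poly_def)
qed (simp add: generator_degree_def)

lemma generator_pullback_carrier: "generator a * pullback p \<in> carrier (S_ring M)"
  using carrier_S_ring_intros(6)[OF generator_carrier pullback_carrier] .

lemma CH_image_eq: "CH_image M i = {CH_class M (pullback p) | p. p \<in> carrier (S_ring N)}"
  unfolding CH_image_def carrier_CH using theta_class by (auto simp: image_image)

lemma summand_eq: "summand M i a = {CH_class M (generator a * pullback p) | p. p \<in> carrier (S_ring N)}"
proof (cases a)
  case None
  then show ?thesis by (simp add: summand_def CH_image_eq)
next
  case (Some G)
  have "x_CH M G \<otimes>\<^bsub>CH M\<^esub> CH_class M (pullback p) = CH_class M (x_poly M G * pullback p)" for p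
    unfolding x_CH_def by (rule CH_class_mult[OF carrier_S_ring_intros(8) pullback_carrier])
  then show ?thesis using Some by (auto simp: summand_def CH_image_eq)
qed

section \<open>Summands as graded submodules\<close>

lemma abelian_group_CH_module: "abelian_group (CH_module M i)"
proof -
  interpret cring "CH M" by (rule cring_CH)
  show ?thesis
  proof (rule abelian_groupI)
    fix x assume x: "x \<in> carrier (CH_module M i)"
    then show "\<exists>y\<in>carrier (CH_module M i). y \<oplus>\<^bsub>CH_module M i\<^esub> x = \<zero>\<^bsub>CH_module M i\<^esub>"
      by (intro bexI[of _ "\<ominus>\<^bsub>CH M\<^esub> x"]) (simp_all add: CH_module_def l_neg)
  qed (simp_all add: CH_module_def a_ac)
qed

lemma CH_module_simps [simp]:
  "carrier (CH_module M i) = carrier (CH M)" "add (CH_module M i) = add (CH M)" "zero (CH_module M i) = zero (CH M)"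
  "a \<odot>\<^bsub>CH_module M i\<^esub> \<eta> = theta M i a \<otimes>\<^bsub>CH M\<^esub> \<eta>"
  by (simp_all add: CH_module_def)

lemma submodule_CH_iff:
  "submodule X (CH N) (CH_module M i) \<longleftrightarrow>
     X \<subseteq> carrier (CH M) \<and> \<zero>\<^bsub>CH M\<^esub> \<in> X \<and> (\<forall>x\<in>X. \<forall>y\<in>X. x \<oplus>\<^bsub>CH M\<^esub> y \<in> X) \<and>
     (\<forall>p\<in>carrier (S_ring N). \<forall>x\<in>X. CH_class M (pullback p) \<otimes>\<^bsub>CH M\<^esub> x \<in> X)"
  (is "?L \<longleftrightarrow> ?R")
proof
  assume ?L
  then interpret submodule X "CH N" "CH_module M i" .
  have smult: "CH_class M (pullback p) \<otimes>\<^bsub>CH M\<^esub> x \<in> X" if "p \<in> carrier (S_ring N)" "x \<in> X" for p x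
    using smult_closed[OF CH_class_carrier[OF that(1)] that(2)] theta_class[OF that(1)] by simp
  show ?R using subset one_closed m_closed smult by auto
next
  assume R: ?R
  interpret abelian_group "CH_module M i" by (rule abelian_group_CH_module)
  interpret CH: cring "CH M" by (rule cring_CH)
  show ?L
  proof (intro submodule.intro submodule_axioms.intro)
    show "subgroup X (add_monoid (CH_module M i))"
    proof (rule add.subgroupI)
      fix x assume x: "x \<in> X"
      then have xc: "x \<in> carrier (CH M)" using R by blast
      have c: "Const (- 1) \<in> carrier (S_ring N)" by (rule carrier_S_ring_intros(3))
      then have y: "CH_class M (pullback (Const (- 1))) \<otimes>\<^bsub>CH M\<^esub> x \<in> X" using R x by blast
      obtain p where p: "p \<in> carrier (S_ring M)" "x = CH_class M p" using xc unfolding carrier_CH by blast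
      have "CH_class M (Const (- 1)) \<otimes>\<^bsub>CH M\<^esub> x \<oplus>\<^bsub>CH M\<^esub> x = CH_class M (Const (- 1) * p + p)"
        unfolding p(2) using p(1) carrier_S_ring_intros(3)[of "-1" M]
        by (simp add: CH_class_mult CH_class_add carrier_S_ring_intros)
      also have "\<dots> = \<zero>\<^bsub>CH M\<^esub>" by (simp add: Const_minus CH_class_0)
      finally have "\<ominus>\<^bsub>CH_module M i\<^esub> x = CH_class M (Const (- 1)) \<otimes>\<^bsub>CH M\<^esub> x"
        using xc y R by (intro minus_equality) auto
      then show "\<ominus>\<^bsub>CH_module M i\<^esub> x \<in> X" using y by simp
    qed (use R in auto)
    fix a x assume a: "a \<in> carrier (CH N)" and x: "x \<in> X"
    then obtain p where "p \<in> carrier (S_ring N)" "a = CH_class N p" unfolding carrier_CH by blast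
    then show "a \<odot>\<^bsub>CH_module M i\<^esub> x \<in> X" using R x theta_class by simp
  qed
qed

lemma pullback_generator_mult:
  assumes "p \<in> carrier (S_ring N)" "q \<in> carrier (S_ring N)"
  shows "CH_class M (pullback p) \<otimes>\<^bsub>CH M\<^esub> CH_class M (generator a * pullback q)
    = CH_class M (generator a * pullback (p * q))"
  using CH_class_mult[OF pullback_carrier generator_pullback_carrier]
  by (simp add: substitute_mult mult_ac)

lemma submodule_summand: "submodule (summand M i a) (CH N) (CH_module M i)"
  unfolding submodule_CH_iff
proof (intro conjI ballI)
  show "summand M i a \<subseteq> carrier (CH M)"
    unfolding summand_eq using CH_class_carrier[OF generator_pullback_carrier] by auto
  show "\<zero>\<^bsub>CH M\<^esub> \<in> summand M i a"
    unfolding summand_eq using carrier_S_ring_intros(1)[of N]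
    by (auto intro!: exI[of _ 0] simp: CH_class_0)
next
  fix x y assume "x \<in> summand M i a" "y \<in> summand M i a"
  then obtain p q where pq: "p \<in> carrier (S_ring N)" "q \<in> carrier (S_ring N)"
    "x = CH_class M (generator a * pullback p)" "y = CH_class M (generator a * pullback q)" unfolding summand_eq by blast
  then have "x \<oplus>\<^bsub>CH M\<^esub> y = CH_class M (generator a * pullback (p + q))"
    by (simp add: CH_class_add generator_pullback_carrier substitute_add distrib_left)
  then show "x \<oplus>\<^bsub>CH M\<^esub> y \<in> summand M i a"
    unfolding summand_eq using carrier_S_ring_intros(4)[OF pq(1,2)] by blast
next
  fix p x assume p: "p \<in> carrier (S_ring N)" and "x \<in> summand M i a"
  then obtain q where "q \<in> carrier (S_ring N)" "x = CH_class M (generator a * pullback q)" unfolding summand_eq by blast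
  then show "CH_class M (pullback p) \<otimes>\<^bsub>CH M\<^esub> x \<in> summand M i a"
    using pullback_generator_mult[OF p] carrier_S_ring_intros(6)[OF p] unfolding summand_eq by blast
qed

lemma graded_summand: "graded_submodule M i (summand M i a)"
  unfolding graded_submodule_def
proof (intro conjI ballI submodule_summand)
  fix \<eta> assume "\<eta> \<in> summand M i a"
  then obtain p where p: "p \<in> carrier (S_ring N)" "\<eta> = CH_class M (generator a * pullback p)" unfolding summand_eq by blast
  obtain n f where f: "p = (\<Sum>k\<le>n. f k)" "\<And>k. homogeneous k (f k)" "\<And>k. vars (f k) \<subseteq> vars p"
    using homogeneous_decomposition[of p] by metis
  have fN: "f k \<in> carrier (S_ring N)" for k using f(3) p(1) unfolding carrier_S_ring by blast
  let ?d = "generator_degree a"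
  \<comment> \<open>The parts of \<open>p\<close> are shifted by the degree of the generator, so
    that index \<open>k\<close> carries the part of degree \<open>k\<close> of the product.\<close>
  define h where "h k = (if k < ?d then 0 else f (k - ?d))" for k
  have hN: "h k \<in> carrier (S_ring N)" for k using fN carrier_S_ring_intros(1)[of N] by (simp add: h_def)
  have hom: "homogeneous k (generator a * pullback (h k))" for k
  proof (cases "k < ?d")
    case False
    have "homogeneous (?d + (k - ?d)) (generator a * pullback (f (k - ?d)))"
      by (intro homogeneous_mult homogeneous_generator homogeneous_pullback f)
    then show ?thesis using False by (simp add: h_def)
  qed (simp add: h_def)
  have "(\<Sum>k\<le>n + ?d. h k) = (\<Sum>k\<in>{?d..n + ?d}. f (k - ?d))"
    by (rule sum.mono_neutral_cong_right) (auto simp: h_def)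
  also have "\<dots> = p"
    unfolding f(1) by (rule sum.reindex_bij_witness[of _ "\<lambda>k. k + ?d" "\<lambda>k. k - ?d"]) auto
  finally have sum: "p = (\<Sum>k\<le>n + ?d. h k)" by simp
  have "finsum (CH M) (\<lambda>k. CH_class M (generator a * pullback (h k))) {..n + ?d}
      = CH_class M (\<Sum>k\<in>{..n + ?d}. generator a * pullback (h k))"
    using generator_pullback_carrier by (intro CH_class_sum) auto
  also have "\<dots> = \<eta>" unfolding p(2) by (subst sum) (simp add: substitute_sum sum_distrib_left)
  finally have "\<eta> = finsum (CH M) (\<lambda>k. CH_class M (generator a * pullback (h k))) {..n + ?d}" by simp
  moreover have "CH_class M (generator a * pullback (h k)) \<in> summand M i a \<inter> CH_graded M k" for k
  proof
    show "CH_class M (generator a * pullback (h k)) \<in> summand M i a" unfolding summand_eq using hN by blast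
    show "CH_class M (generator a * pullback (h k)) \<in> CH_graded M k"
      unfolding CH_graded_iff using hom generator_pullback_carrier by blast
  qed
  ultimately show "\<exists>n f. (\<forall>k\<in>{..n}. f k \<in> summand M i a \<inter> CH_graded M k) \<and> \<eta> = finsum (CH M) f {..n}"
    by (intro exI conjI ballI)
qed

text \<open>Pairing with \<open>q\<close> sees only the component of \<open>\<alpha>\<close> in
  degree \<open>generator_degree a\<close>. That component lies in \<open>X\<close> and, inside the
  summand, on the line of the generator; as it is nonzero, scaling yields the generator.\<close>

lemma graded_part_in_generator_line:
  assumes X: "graded_submodule M i X" "X \<subseteq> summand M i a" and \<alpha>: "\<alpha> \<in> X"
    and p: "p \<in> carrier (S_ring N)" "\<alpha> = CH_class M (generator a * pullback p)"
    and q: "homogeneous (rk M E - 1 - generator_degree a) q" "generator_degree a < rk M E"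
    and nz: "chow_degree M (generator a * pullback p * q) \<noteq> 0"
  shows "CH_class M (generator a) \<in> X"
proof -
  let ?d = "generator_degree a"
  have "\<exists>n f. (\<forall>k\<in>{..n}. f k \<in> X \<inter> CH_graded M k) \<and> \<alpha> = finsum (CH M) f {..n}"
    using X(1) \<alpha> unfolding graded_submodule_def by blast
  then obtain n f where f': "\<forall>k\<in>{..n}. f k \<in> X \<inter> CH_graded M k" and sum: "\<alpha> = finsum (CH M) f {..n}" by blast
  have f: "f k \<in> X \<inter> CH_graded M k" if "k \<le> n" for k using f' that by simp
  have "\<forall>k. \<exists>r. k \<le> n \<longrightarrow> r \<in> carrier (S_ring M) \<and> homogeneous k r \<and> f k = CH_class M r"
    using f CH_graded_iff by blast
  then obtain r where r: "\<And>k. k \<le> n \<Longrightarrow> r k \<in> carrier (S_ring M) \<and> homogeneous k (r k) \<and> f k = CH_class M (r k)"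
    by metis
  have "finsum (CH M) f {..n} = CH_class M (\<Sum>k\<le>n. r k)" using r by (intro CH_class_sum) auto
  then have "generator a * pullback p - (\<Sum>k\<le>n. r k) \<in> chow_null M"
    using CH_class_eq_iff[OF generator_pullback_carrier carrier_S_ring_sum] r sum p(2) by (metis atMost_iff)
  then have "generator a * pullback p * q - (\<Sum>k\<le>n. r k) * q \<in> chow_null M"
    using chow_null_mult2 by (metis left_diff_distrib)
  then have "chow_degree M (generator a * pullback p * q) = chow_degree M ((\<Sum>k\<le>n. r k) * q)"
    by (rule chow_degree_cong)
  then have "(\<Sum>k\<le>n. chow_degree M (r k * q)) \<noteq> 0"
    using nz by (simp add: sum_distrib_right chow_degree_sum)
  then have "\<not> (\<forall>k\<in>{..n}. chow_degree M (r k * q) = 0)"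
    using sum.neutral[of "{..n}" "\<lambda>k. chow_degree M (r k * q)"] by argo
  then obtain k where "k \<in> {..n}" and nzk: "chow_degree M (r k * q) \<noteq> 0" by blast
  then have k: "k \<le> n" "chow_degree M (r k * q) \<noteq> 0" by simp_all
  have "homogeneous (k + (rk M E - 1 - ?d)) (r k * q)" using r[OF k(1)] q by (intro homogeneous_mult) auto
  then have "Suc (k + (rk M E - 1 - ?d)) = rk M E" using k(2) chow_degree_homogeneous by blast
  then have kd: "k = ?d" using q(2) by simp
  have "f k \<in> X" "f k = CH_class M (r k)" using f[OF k(1)] r[OF k(1)] by auto
  then obtain s where s: "s \<in> carrier (S_ring N)" "CH_class M (r k) = CH_class M (generator a * pullback s)"
    using X(2) unfolding summand_eq by auto
  obtain m g where g: "s = (\<Sum>j\<le>m. g j)" "\<And>j. homogeneous j (g j)"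
    using homogeneous_decomposition[of s] by metis
  have null: "r k - generator a * pullback s \<in> chow_null M"
    using s(2) CH_class_eq_iff[OF _ generator_pullback_carrier] r[OF k(1)] by blast
  obtain c where c: "g 0 = Const c" using homogeneous_0_Const g(2) by blast
  \<comment> \<open>Homogeneous parts of the null element
    \<open>r k - generator a * pullback s\<close>. The part of degree \<open>?d\<close> compares
    \<open>r k\<close> with a constant multiple of the generator.\<close>
  define h where "h j = (if j < ?d then 0 else if j = ?d then r k - generator a * pullback (g 0)
      else - (generator a * pullback (g (j - ?d))))" for j
  have "(\<Sum>j\<le>m + ?d. h j) = (\<Sum>j\<in>{?d..m + ?d}. h j)"
    by (rule sum.mono_neutral_right) (auto simp: h_def)
  also have "\<dots> = (\<Sum>j\<le>m. h (j + ?d))"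
    by (rule sum.reindex_bij_witness[of _ "\<lambda>j. j + ?d" "\<lambda>j. j - ?d"]) auto
  also have "\<dots> = (\<Sum>j\<le>m. (if j = 0 then r k else 0) - generator a * pullback (g j))"
    by (intro sum.cong) (auto simp: h_def)
  also have "\<dots> = r k - generator a * pullback s"
    unfolding sum_subtractf g(1) by (simp add: substitute_sum sum_distrib_left)
  finally have "(\<Sum>j\<le>m + ?d. h j) \<in> chow_null M" using null by simp
  moreover have "homogeneous j (h j)" for j
  proof -
    have "homogeneous (?d + l) (generator a * pullback (g l))" for l
      by (intro homogeneous_mult homogeneous_generator homogeneous_pullback g)
    from this[of "j - ?d"] this[of 0] show ?thesis
      using r[OF k(1)] kd by (auto simp: h_def intro: homogeneous_diff homogeneous_minus)
  qed
  ultimately have "h ?d \<in> chow_null M" by (rule chow_null_homogeneous) simp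
  then have rk: "r k - Const c * generator a \<in> chow_null M" by (simp add: h_def c mult.commute)
  have "chow_degree M (r k * q) = c * chow_degree M (generator a * q)"
  proof -
    have "r k * q - Const c * (generator a * q) \<in> chow_null M"
      using chow_null_mult2[OF rk, of q] by (simp add: left_diff_distrib mult.assoc)
    then show ?thesis using chow_degree_cong chow_degree_Const_mult by metis
  qed
  then have "c \<noteq> 0" using k(2) by auto
  have inv: "Const (inverse c) * Const c = 1" using \<open>c \<noteq> 0\<close> by (simp flip: Const_mult)
  have "CH_class M (pullback (Const (inverse c))) \<otimes>\<^bsub>CH M\<^esub> CH_class M (r k) \<in> X"
    using X(1) \<open>f k \<in> X\<close> \<open>f k = _\<close> carrier_S_ring_intros(3)[of "inverse c" N]
    unfolding graded_submodule_def submodule_CH_iff by auto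
  moreover have "CH_class M (pullback (Const (inverse c))) \<otimes>\<^bsub>CH M\<^esub> CH_class M (r k) = CH_class M (Const (inverse c) * r k)"
    using CH_class_mult[OF pullback_carrier] r[OF k(1)] by (metis substitute_Const)
  moreover have "CH_class M (Const (inverse c) * r k) = CH_class M (generator a)"
  proof -
    have "Const (inverse c) * r k - generator a = Const (inverse c) * (r k - Const c * generator a)"
      unfolding right_diff_distrib mult.assoc[symmetric] inv by simp
    then have "Const (inverse c) * r k - generator a \<in> chow_null M" using chow_null_mult[OF rk] by simp
    moreover have "Const (inverse c) * r k \<in> carrier (S_ring M)"
      using carrier_S_ring_intros(6)[OF carrier_S_ring_intros(3)] r[OF k(1)] by blast
    ultimately show ?thesis using CH_class_eq_iff[OF _ generator_carrier] by blast
  qed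
  ultimately show ?thesis by simp
qed

lemma submodule_containing_generator:
  assumes "submodule X (CH N) (CH_module M i)" "CH_class M (generator a) \<in> X"
  shows "summand M i a \<subseteq> X"
proof
  fix x assume "x \<in> summand M i a"
  then obtain p where p: "p \<in> carrier (S_ring N)" "x = CH_class M (generator a * pullback p)" unfolding summand_eq by blast
  have "x = CH_class M (pullback p) \<otimes>\<^bsub>CH M\<^esub> CH_class M (generator a)"
    using CH_class_mult[OF pullback_carrier generator_carrier] p(2) by (simp add: mult.commute)
  then show "x \<in> X" using assms p(1) unfolding submodule_CH_iff by simp
qed

text \<open>A summand is cyclic, with one-dimensional lowest degree piece spanned by its generator.\<close>

lemma indecomposable_summand:
  assumes nz: "generator a \<notin> chow_null M"
  shows "indecomposable M i (summand M i a)"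
  unfolding indecomposable_def
proof (intro conjI graded_summand notI)
  let ?d = "generator_degree a"
  have g1: "CH_class M (generator a) \<in> summand M i a"
    unfolding summand_eq using carrier_S_ring_intros(2)[of N] by (auto intro!: exI[of _ 1])
  show False if "summand M i a = {\<zero>\<^bsub>CH M\<^esub>}"
    using g1 nz that CH_class_eq_0_iff[OF generator_carrier] by auto
  assume "\<exists>X Y. graded_submodule M i X \<and> graded_submodule M i Y \<and>
          X \<noteq> {\<zero>\<^bsub>CH M\<^esub>} \<and> Y \<noteq> {\<zero>\<^bsub>CH M\<^esub>} \<and>
          X \<inter> Y = {\<zero>\<^bsub>CH M\<^esub>} \<and> summand M i a = X <+>\<^bsub>CH M\<^esub> Y"
  then obtain X Y where X: "graded_submodule M i X" "X \<noteq> {\<zero>\<^bsub>CH M\<^esub>}"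
    and Y: "graded_submodule M i Y" "Y \<noteq> {\<zero>\<^bsub>CH M\<^esub>}"
    and XY: "X \<inter> Y = {\<zero>\<^bsub>CH M\<^esub>}" "summand M i a = X <+>\<^bsub>CH M\<^esub> Y" by blast
  have subX: "submodule X (CH N) (CH_module M i)" and subY: "submodule Y (CH N) (CH_module M i)"
    using X Y by (auto simp: graded_submodule_def)
  interpret CH: cring "CH M" by (rule cring_CH)
  have sum: "summand M i a = {x \<oplus>\<^bsub>CH M\<^esub> y | x y. x \<in> X \<and> y \<in> Y}"
    unfolding XY(2) by (auto simp: set_add_def set_mult_def)
  have Xs: "X \<subseteq> summand M i a"
  proof
    fix x assume "x \<in> X"
    then have "x = x \<oplus>\<^bsub>CH M\<^esub> \<zero>\<^bsub>CH M\<^esub>" "\<zero>\<^bsub>CH M\<^esub> \<in> Y" using subX subY unfolding submodule_CH_iff by auto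
    then show "x \<in> summand M i a" unfolding sum using \<open>x \<in> X\<close> by blast
  qed
  have Ys: "Y \<subseteq> summand M i a"
  proof
    fix y assume "y \<in> Y"
    then have "y = \<zero>\<^bsub>CH M\<^esub> \<oplus>\<^bsub>CH M\<^esub> y" "\<zero>\<^bsub>CH M\<^esub> \<in> X" using subX subY unfolding submodule_CH_iff by auto
    then show "y \<in> summand M i a" unfolding sum using \<open>y \<in> Y\<close> by blast
  qed
  obtain w where w: "chow_degree M (generator a * w) \<noteq> 0" using nz chow_degree_nondegenerate by blast
  obtain n f where f: "w = (\<Sum>k\<le>n. f k)" "\<And>k. homogeneous k (f k)" using homogeneous_decomposition[of w] by metis
  have "(\<Sum>k\<le>n. chow_degree M (generator a * f k)) \<noteq> 0"
    using w unfolding f(1) by (simp add: sum_distrib_left chow_degree_sum)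
  then obtain k where k: "chow_degree M (generator a * f k) \<noteq> 0" by (metis sum.neutral)
  have "homogeneous (?d + k) (generator a * f k)" by (intro homogeneous_mult homogeneous_generator f)
  then have "Suc (?d + k) = rk M E" using k chow_degree_homogeneous by blast
  then have "rk M E - 1 - ?d = k" "?d < rk M E" by auto
  then have q: "homogeneous (rk M E - 1 - ?d) (f k)" "?d < rk M E" by (simp_all only: f(2))
  obtain x y where xy: "x \<in> X" "y \<in> Y" "CH_class M (generator a) = x \<oplus>\<^bsub>CH M\<^esub> y" using g1 unfolding sum by blast
  obtain p where p: "p \<in> carrier (S_ring N)" "x = CH_class M (generator a * pullback p)" using Xs xy(1) unfolding summand_eq by blast
  obtain r where r: "r \<in> carrier (S_ring N)" "y = CH_class M (generator a * pullback r)" using Ys xy(2) unfolding summand_eq by blast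
  have "CH_class M (generator a) = CH_class M (generator a * pullback p + generator a * pullback r)"
    unfolding xy(3) p(2) r(2) by (rule CH_class_add[OF generator_pullback_carrier generator_pullback_carrier])
  then have "generator a - (generator a * pullback p + generator a * pullback r) \<in> chow_null M"
    using CH_class_eq_iff[OF generator_carrier carrier_S_ring_intros(4)[OF generator_pullback_carrier generator_pullback_carrier]] by blast
  then have "generator a * f k - (generator a * pullback p * f k + generator a * pullback r * f k) \<in> chow_null M"
    using chow_null_mult2 by (metis left_diff_distrib distrib_right)
  then have "chow_degree M (generator a * f k) = chow_degree M (generator a * pullback p * f k) + chow_degree M (generator a * pullback r * f k)"
    using chow_degree_cong chow_degree_add by metis
  \<comment> \<open>The generator is the sum of \<open>x\<close> and \<open>y\<close>, so one of
    them pairs nontrivially with \<open>f k\<close>. Its submodule is then the whole summand and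
    contains the other one, against the trivial intersection.\<close>
  then consider "chow_degree M (generator a * pullback p * f k) \<noteq> 0" | "chow_degree M (generator a * pullback r * f k) \<noteq> 0"
    using k by fastforce
  then show False
  proof cases
    case 1
    have "CH_class M (generator a) \<in> X" by (rule graded_part_in_generator_line[OF X(1) Xs xy(1) p q 1])
    then have "Y \<subseteq> X" using submodule_containing_generator[OF subX] Ys by blast
    then show False using XY(1) Y(2) by blast
  next
    case 2
    have "CH_class M (generator a) \<in> Y" by (rule graded_part_in_generator_line[OF Y(1) Ys xy(2) r q 2])
    then have "X \<subseteq> Y" using submodule_containing_generator[OF subY] Xs by blast
    then show False using XY(1) X(2) by blast
  qed
qed

text \<open>\<open>chow_degree_flat_power\<close> exhibits a multiple of nonzero degree.\<close>

lemma Var_not_null: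
  assumes "F \<in> nonempty_proper_flats M" shows "Var F \<notin> chow_null M"
proof
  assume null: "Var F \<in> chow_null M"
  have F: "F \<in> flats M" "F \<subset> E" "F \<noteq> {}" "F \<noteq> E" using assms npf_iff by auto
  have v: "flat_var F = Var F" using F by (simp add: flat_var_def chow_var_proper)
  obtain m where "rk M F = Suc m" using rk_pos[OF F(1,3)] by (cases "rk M F") auto
  then have "flat_var F ^ rk M F * chow_var M E ^ (rk M E - rk M F - 1) =
      Var F * (Var F ^ m * chow_var M E ^ (rk M E - rk M F - 1))" by (simp add: v mult.assoc)
  then show False using chow_degree_flat_power[OF F(1,2)] chow_degree_null(2)[OF null] by simp
qed

lemma one_not_null: "1 \<notin> chow_null M"
proof
  assume "1 \<in> chow_null M"
  then show False
    using chow_degree_flat_power[OF empty_flat empty_psubset_E] chow_degree_null(2)[of 1] by fastforce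
qed

lemma generator_not_null:
  "a = None \<or> (\<exists>G\<in>extra_flats. a = Some G) \<Longrightarrow> generator a \<notin> chow_null M"
  using one_not_null Var_not_null S_flatsD(4)
  by (auto simp: extra_flats_def x_poly_def split: if_splits)

lemma generator_extra: "G \<in> extra_flats \<Longrightarrow> x_poly M G = Var G"
  using S_flatsD(4) by (auto simp: extra_flats_def x_poly_def split: if_splits)

text \<open>The set \<open>Z\<close> allows for the label \<open>{}\<close>, which occurs for a one-element ground set.\<close>

lemma is_direct_sum_summands:
  assumes Z: "finite Z" "Z \<inter> extra_flats = {}" "\<And>G. G \<in> Z \<Longrightarrow> G \<notin> nonempty_proper_flats M"
  shows "is_direct_sum M i (insert None (Some ` (extra_flats \<union> Z))) (summand M i)"
proof -
  let ?A = "insert None (Some ` (extra_flats \<union> Z))"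
  have finA: "finite ?A" using Z finite_extra_flats by simp
  have total: "(\<Sum>a\<in>?A. generator a * pullback (r a))
      = pullback (r None) + (\<Sum>G\<in>extra_flats. Var G * pullback (r (Some G)))" for r
  proof -
    have "(\<Sum>a\<in>?A. generator a * pullback (r a)) = pullback (r None) + (\<Sum>a\<in>Some ` (extra_flats \<union> Z). generator a * pullback (r a))"
      using finA by (subst sum.insert) auto
    also have "(\<Sum>a\<in>Some ` (extra_flats \<union> Z). generator a * pullback (r a)) = (\<Sum>G\<in>extra_flats \<union> Z. x_poly M G * pullback (r (Some G)))"
      by (subst sum.reindex) auto
    also have "\<dots> = (\<Sum>G\<in>extra_flats. x_poly M G * pullback (r (Some G)))"
      using Z finite_extra_flats by (intro sum.mono_neutral_right) (auto simp: x_poly_def)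
    also have "\<dots> = (\<Sum>G\<in>extra_flats. Var G * pullback (r (Some G)))"
      using generator_extra by (intro sum.cong) auto
    finally show ?thesis .
  qed
  have "\<exists>!f. f \<in> (\<Pi>\<^sub>E a\<in>?A. summand M i a) \<and> \<eta> = finsum (CH M) f ?A" if eta: "\<eta> \<in> carrier (CH M)" for \<eta>
  proof -
    obtain w where w: "w \<in> carrier (S_ring M)" "\<eta> = CH_class M w" using eta unfolding carrier_CH by blast
    obtain p q where pq: "p \<in> carrier (S_ring N)" "\<And>G. q G \<in> carrier (S_ring N)"
      "w - (pullback p + (\<Sum>G\<in>extra_flats. Var G * pullback (q G))) \<in> chow_null M"
      using decomposed_all[of w] unfolding decomposed_def by blast
    define r where "r a = (case a of None \<Rightarrow> p | Some G \<Rightarrow> q G)" for a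
    have rN: "r a \<in> carrier (S_ring N)" for a using pq by (simp add: r_def split: option.split)
    define f where "f = restrict (\<lambda>a. CH_class M (generator a * pullback (r a))) ?A"
    have carr: "(\<Sum>a\<in>?A. generator a * pullback (s a)) \<in> carrier (S_ring M)" for s
      using generator_pullback_carrier by (rule carrier_S_ring_sum)
    have fsum: "finsum (CH M) g ?A = CH_class M (\<Sum>a\<in>?A. generator a * pullback (s a))"
      if "\<And>a. a \<in> ?A \<Longrightarrow> g a = CH_class M (generator a * pullback (s a))" for g s
      using finA generator_pullback_carrier that by (intro CH_class_sum)
    show ?thesis
    proof (rule ex1I[of _ f])
      have "f \<in> (\<Pi>\<^sub>E a\<in>?A. summand M i a)"
        unfolding f_def summand_eq using rN by (auto intro!: restrict_PiE_iff[THEN iffD2])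
      moreover have "finsum (CH M) f ?A = CH_class M (\<Sum>a\<in>?A. generator a * pullback (r a))"
        by (rule fsum) (simp add: f_def)
      moreover have "CH_class M (\<Sum>a\<in>?A. generator a * pullback (r a)) = \<eta>"
      proof -
        have "w - (\<Sum>a\<in>?A. generator a * pullback (r a)) \<in> chow_null M"
          unfolding total using pq(3) by (simp add: r_def)
        then show ?thesis using CH_class_eq_iff[OF w(1) carr] w(2) by blast
      qed
      ultimately show "f \<in> (\<Pi>\<^sub>E a\<in>?A. summand M i a) \<and> \<eta> = finsum (CH M) f ?A" by simp
      fix g assume g: "g \<in> (\<Pi>\<^sub>E a\<in>?A. summand M i a) \<and> \<eta> = finsum (CH M) g ?A"
      have "\<forall>a\<in>?A. g a \<in> summand M i a" using g unfolding PiE_iff by blast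
      then have "\<forall>a\<in>?A. \<exists>t. t \<in> carrier (S_ring N) \<and> g a = CH_class M (generator a * pullback t)"
        unfolding summand_eq by blast
      then obtain s where s: "\<And>a. a \<in> ?A \<Longrightarrow> s a \<in> carrier (S_ring N) \<and> g a = CH_class M (generator a * pullback (s a))"
        by metis
      \<comment> \<open>Extended by zero, because \<open>decomposition_unique\<close> asks for
        coefficients at every label.\<close>
      define t where "t a = (if a \<in> ?A then s a - r a else 0)" for a
      have tN: "t a \<in> carrier (S_ring N)" for a
      proof (cases "a \<in> ?A")
        case True
        then show ?thesis using carrier_S_ring_intros(5)[of "s a" N "r a"] s rN by (simp only: t_def if_True)
      next
        case False
        then show ?thesis by (simp only: t_def if_False carrier_S_ring_intros(1))
      qed
      have "CH_class M (\<Sum>a\<in>?A. generator a * pullback (s a)) = CH_class M (\<Sum>a\<in>?A. generator a * pullback (r a))"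
        using fsum[of g s] s g \<open>finsum (CH M) f ?A = _\<close> \<open>_ = \<eta>\<close> by simp
      then have "(\<Sum>a\<in>?A. generator a * pullback (s a)) - (\<Sum>a\<in>?A. generator a * pullback (r a)) \<in> chow_null M"
        using CH_class_eq_iff[OF carr carr] by blast
      moreover have "(\<Sum>a\<in>?A. generator a * pullback (s a)) - (\<Sum>a\<in>?A. generator a * pullback (r a))
          = (\<Sum>a\<in>?A. generator a * pullback (t a))"
        unfolding sum_subtractf[symmetric]
        by (intro sum.cong HOL.refl) (simp add: t_def substitute_diff right_diff_distrib)
      ultimately have null: "pullback (t None) + (\<Sum>G\<in>extra_flats. Var G * pullback (t (Some G))) \<in> chow_null M"
        unfolding total by simp
      note uniq = decomposition_unique[of "t None" "\<lambda>G. t (Some G)", OF tN tN null]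
      have "generator a * pullback (t a) \<in> chow_null M" if a: "a \<in> ?A" for a
      proof -
        from a consider "a = None" | G where "a = Some G" "G \<in> extra_flats" | G where "a = Some G" "G \<in> Z" by auto
        then show ?thesis
        proof cases
          case 1
          then show ?thesis using uniq(1) by simp
        next
          case (2 G)
          then show ?thesis using uniq(2)[of G] generator_extra by simp
        next
          case (3 G)
          then show ?thesis using Z(3) by (simp add: x_poly_def)
        qed
      qed
      then have "generator a * pullback (s a) - generator a * pullback (r a) \<in> chow_null M" if "a \<in> ?A" for a
        using that by (simp add: t_def substitute_diff right_diff_distrib)
      then have "g a = f a" if "a \<in> ?A" for a
        using that s CH_class_eq_iff[OF generator_pullback_carrier generator_pullback_carrier] by (simp add: f_def)
      then show "g = f" using g \<open>f \<in> _\<close> by (meson PiE_ext)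
    qed
  qed
  then show ?thesis unfolding is_direct_sum_def by (intro conjI ballI finA graded_summand)
qed

text \<open>A homogeneous class of a summand has a homogeneous representative and one of the form
  generator times pullback, possibly different. The first evaluates the degree map, the second the
  hypothesis, and the products agree modulo the ideal.\<close>

lemma orthogonal_summands:
  assumes "\<And>p q. p \<in> carrier (S_ring N) \<Longrightarrow> q \<in> carrier (S_ring N) \<Longrightarrow>
    chow_degree M (generator a * pullback p * (generator b * pullback q)) = 0"
  shows "orthogonal M (summand M i a) (summand M i b)"
  unfolding orthogonal_def rank_eq
proof (intro allI impI ballI)
  fix k \<eta> \<xi> assume k: "k \<le> rk M E - 1" and \<eta>: "\<eta> \<in> summand M i a \<inter> CH_graded M k"
    and \<xi>: "\<xi> \<in> summand M i b \<inter> CH_graded M (rk M E - 1 - k)"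
  obtain p where p: "p \<in> carrier (S_ring N)" "\<eta> = CH_class M (generator a * pullback p)" using \<eta> unfolding summand_eq by blast
  obtain q where q: "q \<in> carrier (S_ring N)" "\<xi> = CH_class M (generator b * pullback q)" using \<xi> unfolding summand_eq by blast
  obtain r where r: "r \<in> carrier (S_ring M)" "homogeneous k r" "\<eta> = CH_class M r" using IntD2[OF \<eta>] unfolding CH_graded_iff by blast
  obtain s where s: "s \<in> carrier (S_ring M)" "homogeneous (rk M E - 1 - k) s" "\<xi> = CH_class M s" using IntD2[OF \<xi>] unfolding CH_graded_iff by blast
  have "k + (rk M E - 1 - k) = rk M E - 1" using k by simp
  then have "homogeneous (rk M E - 1) (r * s)" using homogeneous_mult[OF r(2) s(2)] by (simp only:)
  then have "degree_map M (\<eta> \<otimes>\<^bsub>CH M\<^esub> \<xi>) = chow_degree M (r * s)"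
    using degree_map_class[OF carrier_S_ring_intros(6)[OF r(1) s(1)]] CH_class_mult[OF r(1) s(1)] r(3) s(3) by simp
  also have "\<dots> = chow_degree M (generator a * pullback p * (generator b * pullback q))"
  proof (rule chow_degree_cong)
    have "CH_class M (r * s) = CH_class M (generator a * pullback p * (generator b * pullback q))"
      using CH_class_mult[OF r(1) s(1)] CH_class_mult[OF generator_pullback_carrier generator_pullback_carrier] p q r s by metis
    then show "r * s - generator a * pullback p * (generator b * pullback q) \<in> chow_null M"
      using CH_class_eq_iff[OF carrier_S_ring_intros(6)[OF r(1) s(1)] carrier_S_ring_intros(6)[OF generator_pullback_carrier generator_pullback_carrier]] by blast
  qed
  also have "\<dots> = 0" using assms p(1) q(1) by blast
  finally show "degree_map M (\<eta> \<otimes>\<^bsub>CH M\<^esub> \<xi>) = 0" .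
qed

lemma orthogonal_S_flat:
  assumes F: "F \<in> S_flats M i" and b: "b = None \<or> (\<exists>G. b = Some G \<and> (G \<in> extra_flats \<or> G \<notin> nonempty_proper_flats M))"
    and ne: "b \<noteq> Some (insert i F)"
  shows "orthogonal M (summand M i (Some (insert i F))) (summand M i b)"
    "orthogonal M (summand M i b) (summand M i (Some (insert i F)))"
proof -
  have "insert i F \<in> extra_flats" using F by (simp add: extra_flats_def)
  then have gF: "x_poly M (insert i F) = Var (insert i F)" by (rule generator_extra)
  have *: "chow_degree M (generator (Some (insert i F)) * pullback p * (generator b * pullback q)) = 0"
    if p: "p \<in> carrier (S_ring N)" and q: "q \<in> carrier (S_ring N)" for p q
  proof -
    from b consider "b = None" | G where "b = Some G" "G \<in> extra_flats" | G where "b = Some G" "G \<notin> nonempty_proper_flats M" by blast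
    then show ?thesis
    proof cases
      case 1
      then show ?thesis using chow_degree_S_flat[OF F carrier_S_ring_intros(6)[OF p q]] gF
        by (simp add: substitute_mult mult.assoc)
    next
      case (2 G)
      then have "G \<noteq> insert i F" using ne by blast
      then show ?thesis using chow_degree_extra_extra[OF F 2(2) _ carrier_S_ring_intros(6)[OF p q]] gF 2 generator_extra
        by (simp add: substitute_mult mult_ac)
    next
      case (3 G)
      then show ?thesis by (simp add: x_poly_def)
    qed
  qed
  then show "orthogonal M (summand M i (Some (insert i F))) (summand M i b)" by (rule orthogonal_summands)
  show "orthogonal M (summand M i b) (summand M i (Some (insert i F)))"
    by (rule orthogonal_summands) (use * in \<open>simp add: mult.commute\<close>)
qed

end

theorem theorem1p1:
  fixes M :: "'a matroid" and i :: 'a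
  assumes "matroid M" and "loopless M" and "i \<in> ground M"
  shows
    "(\<not> coloop M i \<longrightarrow>
        is_direct_sum M i (labels M i) (summand M i) \<and>
        (\<forall>a\<in>labels M i. indecomposable M i (summand M i a)) \<and>
        (\<forall>a\<in>labels M i. \<forall>b\<in>labels M i. a \<noteq> b \<longrightarrow>
           orthogonal M (summand M i a) (summand M i b)))
   \<and> (coloop M i \<longrightarrow>
        is_direct_sum M i (coloop_labels M i) (summand M i) \<and>
        (\<forall>a\<in>coloop_labels M i.
           \<not> (ground M = {i} \<and> a = Some (ground M - {i})) \<longrightarrow>
           indecomposable M i (summand M i a)) \<and>
        (\<forall>a\<in>coloop_labels M i. \<forall>b\<in>coloop_labels M i.
           a \<noteq> b \<and> {a, b} \<noteq> {None, Some (ground M - {i})} \<longrightarrow>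
           orthogonal M (summand M i a) (summand M i b)))"
proof -
  interpret matroid_element M i using assms by unfold_locales
  let ?B = "ground M - {i}"
  have S_labels: "{Some (insert i F) | F. F \<in> S_flats M i} = Some ` insert i ` S_flats M i" by blast
  show ?thesis
  proof (intro conjI impI)
    assume "\<not> coloop M i"
    then have "?B \<notin> nonempty_proper_flats M" using coloop_iff[OF i_in_E] npf_iff by blast
    then have ext: "extra_flats = insert i ` S_flats M i" by (simp add: extra_flats_def)
    have lab: "labels M i = insert None (Some ` extra_flats)" unfolding labels_def S_labels ext by simp
    show "is_direct_sum M i (labels M i) (summand M i)"
      using is_direct_sum_summands[of "{}"] lab by simp
    show "\<forall>a\<in>labels M i. indecomposable M i (summand M i a)"
      unfolding lab using indecomposable_summand generator_not_null by blast
    show "\<forall>a\<in>labels M i. \<forall>b\<in>labels M i. a \<noteq> b \<longrightarrow> orthogonal M (summand M i a) (summand M i b)"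
    proof (intro ballI impI)
      fix a b assume ab: "a \<in> labels M i" "b \<in> labels M i" "a \<noteq> b"
      show "orthogonal M (summand M i a) (summand M i b)"
      proof (cases "a = None")
        case False
        then obtain F where F: "F \<in> S_flats M i" "a = Some (insert i F)" using ab(1) unfolding lab ext by blast
        show ?thesis unfolding F(2) by (rule orthogonal_S_flat(1)[OF F(1)]) (use ab F in \<open>auto simp: lab\<close>)
      next
        case True
        then obtain F where F: "F \<in> S_flats M i" "b = Some (insert i F)" using ab unfolding lab ext by blast
        show ?thesis unfolding F(2) by (rule orthogonal_S_flat(2)[OF F(1)]) (use True in auto)
      qed
    qed
  next
    assume "coloop M i"
    then have B: "?B \<in> flats M" using coloop_iff[OF i_in_E] by blast
    have npf: "?B \<in> nonempty_proper_flats M \<longleftrightarrow> ground M \<noteq> {i}" using B i_in_E unfolding npf_iff by blast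
    \<comment> \<open>For \<open>ground M = {i}\<close> the second label is \<open>{}\<close>, which
      is not among \<open>extra_flats\<close>; it enters through the set \<open>Z\<close> of
      \<open>is_direct_sum_summands\<close>.\<close>
    have lab: "coloop_labels M i = insert None (Some ` (extra_flats \<union> (if ground M = {i} then {?B} else {})))"
      unfolding coloop_labels_def S_labels extra_flats_def npf by auto
    have SB: "?B \<notin> insert i ` S_flats M i" by blast
    show "is_direct_sum M i (coloop_labels M i) (summand M i)"
      unfolding lab
    proof (rule is_direct_sum_summands)
      show "(if ground M = {i} then {?B} else {}) \<inter> extra_flats = {}"
        using SB npf by (cases "ground M = {i}") (simp_all only: extra_flats_def if_True if_False, auto)
    qed (use npf in \<open>auto split: if_splits\<close>)
    show "\<forall>a\<in>coloop_labels M i. \<not> (ground M = {i} \<and> a = Some ?B) \<longrightarrow> indecomposable M i (summand M i a)"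
      unfolding lab by (auto intro!: indecomposable_summand generator_not_null split: if_splits)
    show "\<forall>a\<in>coloop_labels M i. \<forall>b\<in>coloop_labels M i.
        a \<noteq> b \<and> {a, b} \<noteq> {None, Some ?B} \<longrightarrow> orthogonal M (summand M i a) (summand M i b)"
    proof (intro ballI impI)
      fix a b assume ab: "a \<in> coloop_labels M i" "b \<in> coloop_labels M i" "a \<noteq> b \<and> {a, b} \<noteq> {None, Some ?B}"
      have ok: "c = None \<or> (\<exists>G. c = Some G \<and> (G \<in> extra_flats \<or> G \<notin> nonempty_proper_flats M))"
        if "c \<in> coloop_labels M i" for c
        using that npf unfolding lab by (auto split: if_splits)
      have shape: "c = None \<or> c = Some ?B \<or> (\<exists>F\<in>S_flats M i. c = Some (insert i F))" if "c \<in> coloop_labels M i" for c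
        using that unfolding coloop_labels_def by blast
      show "orthogonal M (summand M i a) (summand M i b)"
      proof (cases "\<exists>F\<in>S_flats M i. a = Some (insert i F)")
        case True
        then obtain F where F: "F \<in> S_flats M i" "a = Some (insert i F)" by blast
        show ?thesis unfolding F(2) by (rule orthogonal_S_flat(1)[OF F(1) ok[OF ab(2)]]) (use ab F in auto)
      next
        case False
        then obtain F where F: "F \<in> S_flats M i" "b = Some (insert i F)"
          using shape[OF ab(1)] shape[OF ab(2)] ab(3) by auto
        show ?thesis unfolding F(2) by (rule orthogonal_S_flat(2)[OF F(1) ok[OF ab(1)]]) (use ab F in auto)
      qed
    qed
  qed
qed

end
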